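(* Let $X=T[(\theta_n,\mathcal{F}_n)]$ be as in the context and suppose condition $(\dagger)$ fails. Then for every infinite $M\subseteq\mathbb{N}$ there exists an infinite $N\subseteq M$ such that $I([(e_k)_{k\in N}])=\omega^{\omega^\xi}$, where $[(e_k)_{k\in N}]$ is the closed linear span of $(e_k)_{k\in N}$ in $X$. In particular, $[(e_k)_{k\in N}]$ does not contain any $\ell^1$-$\mathcal{S}_{\omega^\xi}$-spreading model.
   Context: $(\theta_n)$ is a nonincreasing null sequence in $(0,1)$, $(\mathcal{F}_n)$ are regular families (hereditary, spreading, compact subsets of $[\mathbb{N}]^{<\infty}$ in the topology of $2^{\mathbb{N}}$), and $X=T[(\theta_n,\mathcal{F}_n)]$ is the completion of $c_{00}$ under $\|x\|=\max\{\|x\|_{c_0},\sup_n\sup\theta_n\sum_i\|E_ix\|\}$, inner sup over $\mathcal{F}_n$-admissible $(E_i)$ ($E_1<\dots<E_k$, i.e. $\max E_i<\min E_{i+1}$, and $\{\min E_i\}\in\mathcal{F}_n$), $Ex$ the restriction of $x$ to $E$; $(e_k)$ is the unit vector basis. $\alpha_n=\iota(\mathcal{F}_n)$ (Cantor–Bendixson index) with $\alpha_n>1$, $\alpha=\sup\alpha_n\ne\alpha_n$ for all $n$, $\alpha=\omega^{\omega^\xi}$, $0<\xi<\omega_1$. $\ell(\beta)$ = leading exponent in the Cantor normal form of a nonzero ordinal. $\gamma(\varepsilon,m)=\max\{\ell(\alpha_{n_s}\cdots\alpha_{n_1}):\varepsilon\theta_{n_1}\cdots\theta_{n_s}>\theta_m\}$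 ($\max\emptyset=0$). Condition $(\dagger)$: there exists $\varepsilon>0$ such that for every $\beta<\omega^\xi$ there is $m$ with $\gamma(\varepsilon,m)+2+\beta<\ell(\alpha_m)$. Schreier families: $\mathcal{S}_0$ singletons and $\emptyset$, $\mathcal{S}_1=\{F:|F|\le\min F\}$, $\mathcal{S}_{\beta+1}=\mathcal{S}_1[\mathcal{S}_\beta]$ ($\mathcal{M}[\mathcal{N}]$ = unions of $\mathcal{M}$-admissible sequences of members of $\mathcal{N}$), and for limit $\beta$, $\mathcal{S}_\beta=\{F\in\mathcal{S}_{\beta_k}\text{ for some }k\le\min F\}$ for a fixed sequence $\beta_k\uparrow\beta$. Bourgain $\ell^1$-index: for a Banach space $Y$ and $K\ge1$, let $T(Y,K)$ be the tree of finite sequences $(x_1,\dots,x_n)$ of norm-one vectors with $\|\sum a_ix_i\|\ge K^{-1}\sum|a_i|$ for all scalars; its derived trees are $T^{(0)}=T$, $T^{(\beta+1)}=\{s\in T^{(\beta)}:(s,x)\in T^{(\beta)}\text{ for some }x\}$, intersections at limits; $I(Y,K)$ is the least $\beta$ with $T(Y,K)^{(\beta)}=\emptyset$ and $I(Y)=\sup_{K\ge1}I(Y,K)$. A normalized sequence $(x_n)$ is an $\ell^1$-$\mathcal{F}$-spreading model if for some $K$, $\|\sum_{n\in F}a_nx_n\|\ge K^{-1}\sum_{n\in F}|a_n|$ for all $F\in\mathcal{F}$ and scalars. *)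

theory Defs
  imports Complex_Main
begin

text \<open>Every countable ordinal is represented by a Brouwer tree; BL f denotes the
supremum of the f n. Equality of ordinals is the equivalence induced by ord_le.\<close>

datatype bord = BZ | BS bord | BL "nat \<Rightarrow> bord"

inductive ord_le :: "bord \<Rightarrow> bord \<Rightarrow> bool" and ord_lt :: "bord \<Rightarrow> bord \<Rightarrow> bool" where
  le_Z: "ord_le BZ y"
| le_S: "ord_lt x y \<Longrightarrow> ord_le (BS x) y"
| le_L: "(\<And>n. ord_le (f n) y) \<Longrightarrow> ord_le (BL f) y"
| lt_S: "ord_le x y \<Longrightarrow> ord_lt x (BS y)"
| lt_L: "ord_lt x (g n) \<Longrightarrow> ord_lt x (BL g)"

definition ord_eq :: "bord \<Rightarrow> bord \<Rightarrow> bool" where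
  "ord_eq x y \<longleftrightarrow> ord_le x y \<and> ord_le y x"

primrec natord :: "nat \<Rightarrow> bord" where
  "natord 0 = BZ"
| "natord (Suc n) = BS (natord n)"

definition omega :: bord where "omega = BL natord"
definition one :: bord where "one = BS BZ"
definition two :: bord where "two = BS (BS BZ)"

primrec oadd :: "bord \<Rightarrow> bord \<Rightarrow> bord" where
  "oadd x BZ = x"
| "oadd x (BS y) = BS (oadd x y)"
| "oadd x (BL g) = BL (\<lambda>n. oadd x (g n))"

primrec omul :: "bord \<Rightarrow> bord \<Rightarrow> bord" where
  "omul x BZ = BZ"
| "omul x (BS y) = oadd (omul x y) x"
| "omul x (BL g) = BL (\<lambda>n. omul x (g n))"

text \<open>Ordinal exponentiation (only used with base omega, where the limit clause is the standard one).\<close>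
primrec oexp :: "bord \<Rightarrow> bord \<Rightarrow> bord" where
  "oexp x BZ = BS BZ"
| "oexp x (BS y) = omul (oexp x y) x"
| "oexp x (BL g) = BL (\<lambda>n. oexp x (g n))"

text \<open>Leading exponent in the Cantor normal form of a nonzero ordinal.\<close>
definition lead :: "bord \<Rightarrow> bord" where
  "lead b = (SOME g. ord_le (oexp omega g) b \<and> ord_lt b (oexp omega (BS g)))"

definition ordmax :: "bord set \<Rightarrow> bord" where
  "ordmax S = (if S = {} then BZ else SOME g. g \<in> S \<and> (\<forall>h\<in>S. ord_le h g))"

definition is_ord_sup :: "(nat \<Rightarrow> bord) \<Rightarrow> bord \<Rightarrow> bool" where
  "is_ord_sup a s \<longleftrightarrow> (\<forall>n. ord_le (a n) s) \<and> (\<forall>g. ord_lt g s \<longrightarrow> (\<exists>n. ord_lt g (a n)))"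

text \<open>Derived set in 2^N (subsets of N with the product topology; basic neighbourhoods
of A are the sets B with B \<inter> {..<n} = A \<inter> {..<n}).\<close>
definition cb_derived :: "nat set set \<Rightarrow> nat set set" where
  "cb_derived F = {A. \<forall>n. \<exists>B\<in>F. B \<noteq> A \<and> B \<inter> {..<n} = A \<inter> {..<n}}"

primrec cb_deriv :: "nat set set \<Rightarrow> bord \<Rightarrow> nat set set" where
  "cb_deriv F BZ = F"
| "cb_deriv F (BS b) = cb_derived (cb_deriv F b)"
| "cb_deriv F (BL g) = (\<Inter>n. cb_deriv F (g n))"

definition cb_index :: "nat set set \<Rightarrow> bord \<Rightarrow> bool" where
  "cb_index F b \<longleftrightarrow> cb_deriv F b = {} \<and> (\<forall>g. ord_lt g b \<longrightarrow> cb_deriv F g \<noteq> {})"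

definition regular_family :: "nat set set \<Rightarrow> bool" where
  "regular_family F \<longleftrightarrow>
     (\<forall>A\<in>F. finite A) \<and>
     (\<forall>A\<in>F. \<forall>B. B \<subseteq> A \<longrightarrow> B \<in> F) \<and>
     (\<forall>A\<in>F. \<forall>B. finite B \<and> card B = card A \<and>
         (\<forall>i<card A. sorted_list_of_set A ! i \<le> sorted_list_of_set B ! i) \<longrightarrow> B \<in> F) \<and>
     (\<forall>A. (\<forall>n. \<exists>B\<in>F. B \<inter> {..<n} = A \<inter> {..<n}) \<longrightarrow> A \<in> F)"

definition restr :: "nat set \<Rightarrow> (nat \<Rightarrow> real) \<Rightarrow> nat \<Rightarrow> real" where
  "restr E x = (\<lambda>k. if k \<in> E then x k else 0)"

definition supnorm :: "(nat \<Rightarrow> real) \<Rightarrow> real" where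
  "supnorm x = Sup (range (\<lambda>k. \<bar>x k\<bar>))"

definition admissible :: "nat set set \<Rightarrow> nat set list \<Rightarrow> bool" where
  "admissible F Es \<longleftrightarrow>
     (\<forall>E\<in>set Es. finite E \<and> E \<noteq> {}) \<and>
     (\<forall>i. Suc i < length Es \<longrightarrow> Max (Es ! i) < Min (Es ! Suc i)) \<and>
     Min ` set Es \<in> F"

text \<open>Iterative norms; the Tsirelson norm is their supremum (on finitely supported vectors),
which is the norm satisfying the implicit equation.\<close>
primrec tnorm_it :: "(nat \<Rightarrow> real) \<Rightarrow> (nat \<Rightarrow> nat set set) \<Rightarrow> nat \<Rightarrow> (nat \<Rightarrow> real) \<Rightarrow> real" where
  "tnorm_it \<theta> F 0 x = supnorm x"
| "tnorm_it \<theta> F (Suc j) x = max (supnorm x)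
     (Sup {\<theta> n * (\<Sum>E\<leftarrow>Es. tnorm_it \<theta> F j (restr E x)) | n Es. admissible (F n) Es})"

definition tnorm :: "(nat \<Rightarrow> real) \<Rightarrow> (nat \<Rightarrow> nat set set) \<Rightarrow> (nat \<Rightarrow> real) \<Rightarrow> real" where
  "tnorm \<theta> F x = Sup (range (\<lambda>j. tnorm_it \<theta> F j x))"

text \<open>The completion X, realised as coordinate sequences whose partial sums (basis
expansion) are Cauchy in the Tsirelson norm; the norm is the limit of the norms of partial sums.\<close>
definition Xspace :: "(nat \<Rightarrow> real) \<Rightarrow> (nat \<Rightarrow> nat set set) \<Rightarrow> (nat \<Rightarrow> real) set" where
  "Xspace \<theta> F = {x. \<forall>\<epsilon>>0. \<exists>n0. \<forall>n m. n0 \<le> n \<longrightarrow> n \<le> m \<longrightarrow> tnorm \<theta> F (restr {n..<m} x) < \<epsilon>}"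

definition Xnorm :: "(nat \<Rightarrow> real) \<Rightarrow> (nat \<Rightarrow> nat set set) \<Rightarrow> (nat \<Rightarrow> real) \<Rightarrow> real" where
  "Xnorm \<theta> F x = lim (\<lambda>n. tnorm \<theta> F (restr {..<n} x))"

definition espan :: "(nat \<Rightarrow> real) \<Rightarrow> (nat \<Rightarrow> nat set set) \<Rightarrow> nat set \<Rightarrow> (nat \<Rightarrow> real) set" where
  "espan \<theta> F N = {y \<in> Xspace \<theta> F. \<forall>\<epsilon>>0. \<exists>z. finite {k. z k \<noteq> 0} \<and> {k. z k \<noteq> 0} \<subseteq> N \<and>
        Xnorm \<theta> F (\<lambda>k. y k - z k) < \<epsilon>}"

definition l1_tree :: "(nat \<Rightarrow> real) set \<Rightarrow> ((nat \<Rightarrow> real) \<Rightarrow> real) \<Rightarrow> real \<Rightarrow> (nat \<Rightarrow> real) list set" where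
  "l1_tree Y nm K = {xs. xs \<noteq> [] \<and> set xs \<subseteq> Y \<and> (\<forall>x\<in>set xs. nm x = 1) \<and>
      (\<forall>a :: nat \<Rightarrow> real. nm (\<lambda>k. \<Sum>i<length xs. a i * (xs ! i) k) \<ge> (\<Sum>i<length xs. \<bar>a i\<bar>) / K)}"

primrec tree_deriv :: "'a list set \<Rightarrow> bord \<Rightarrow> 'a list set" where
  "tree_deriv T BZ = T"
| "tree_deriv T (BS b) = {s \<in> tree_deriv T b. \<exists>x. s @ [x] \<in> tree_deriv T b}"
| "tree_deriv T (BL g) = (\<Inter>n. tree_deriv T (g n))"

definition l1_index_K :: "(nat \<Rightarrow> real) set \<Rightarrow> ((nat \<Rightarrow> real) \<Rightarrow> real) \<Rightarrow> real \<Rightarrow> bord \<Rightarrow> bool" where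
  "l1_index_K Y nm K b \<longleftrightarrow> tree_deriv (l1_tree Y nm K) b = {} \<and>
      (\<forall>g. ord_lt g b \<longrightarrow> tree_deriv (l1_tree Y nm K) g \<noteq> {})"

definition l1_index_is :: "(nat \<Rightarrow> real) set \<Rightarrow> ((nat \<Rightarrow> real) \<Rightarrow> real) \<Rightarrow> bord \<Rightarrow> bool" where
  "l1_index_is Y nm a \<longleftrightarrow>
     (\<forall>K\<ge>1. \<exists>b. l1_index_K Y nm K b \<and> ord_le b a) \<and>
     (\<forall>g. ord_lt g a \<longrightarrow> (\<exists>K\<ge>1. \<exists>b. l1_index_K Y nm K b \<and> ord_lt g b))"

definition prod_ord :: "(nat \<Rightarrow> bord) \<Rightarrow> nat list \<Rightarrow> bord" where
  "prod_ord \<alpha> ns = foldl (\<lambda>p n. omul p (\<alpha> n)) one (rev ns)"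

definition gam :: "(nat \<Rightarrow> real) \<Rightarrow> (nat \<Rightarrow> bord) \<Rightarrow> real \<Rightarrow> nat \<Rightarrow> bord" where
  "gam \<theta> \<alpha> \<epsilon> m = ordmax {lead (prod_ord \<alpha> ns) | ns. ns \<noteq> [] \<and> \<epsilon> * prod_list (map \<theta> ns) > \<theta> m}"

definition dagger :: "(nat \<Rightarrow> real) \<Rightarrow> (nat \<Rightarrow> bord) \<Rightarrow> bord \<Rightarrow> bool" where
  "dagger \<theta> \<alpha> \<xi> \<longleftrightarrow> (\<exists>\<epsilon>>0. \<forall>b. ord_lt b (oexp omega \<xi>) \<longrightarrow>
      (\<exists>m. ord_lt (oadd (oadd (gam \<theta> \<alpha> \<epsilon> m) two) b) (lead (\<alpha> m))))"

definition fam_comp :: "nat set set \<Rightarrow> nat set set \<Rightarrow> nat set set" where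
  "fam_comp M N = {\<Union>(set Fs) | Fs. (\<forall>G\<in>set Fs. G \<in> N \<and> finite G \<and> G \<noteq> {}) \<and>
      (\<forall>i. Suc i < length Fs \<longrightarrow> Max (Fs ! i) < Min (Fs ! Suc i)) \<and> Min ` set Fs \<in> M}"

definition schreier1 :: "nat set set" where
  "schreier1 = {F. finite F \<and> (F = {} \<or> card F \<le> Min F)}"

definition is_limit_ord :: "bord \<Rightarrow> bool" where
  "is_limit_ord b \<longleftrightarrow> \<not> ord_eq b BZ \<and> \<not> (\<exists>g. ord_eq b (BS g))"

definition schreier_system :: "(bord \<Rightarrow> nat set set) \<Rightarrow> bool" where
  "schreier_system S \<longleftrightarrow>
     (\<forall>b c. ord_eq b c \<longrightarrow> S b = S c) \<and>
     (\<forall>b. ord_eq b BZ \<longrightarrow> S b = {F. finite F \<and> card F \<le> 1}) \<and>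
     (\<forall>b c. ord_eq b (BS c) \<longrightarrow> S b = fam_comp schreier1 (S c)) \<and>
     (\<forall>b. is_limit_ord b \<longrightarrow> (\<exists>bk. (\<forall>k. ord_lt (bk k) (bk (Suc k))) \<and> is_ord_sup bk b \<and>
          S b = {F. finite F \<and> (F = {} \<or> (\<exists>k\<le>Min F. F \<in> S (bk k)))}))"

definition l1_spreading_model :: "nat set set \<Rightarrow> ((nat \<Rightarrow> real) \<Rightarrow> real) \<Rightarrow> (nat \<Rightarrow> nat \<Rightarrow> real) \<Rightarrow> bool" where
  "l1_spreading_model \<F> nm x \<longleftrightarrow> (\<forall>n. nm (x n) = 1) \<and>
     (\<exists>K>0. \<forall>F\<in>\<F>. \<forall>a :: nat \<Rightarrow> real. nm (\<lambda>k. \<Sum>n\<in>F. a n * x n k) \<ge> (\<Sum>n\<in>F. \<bar>a n\<bar>) / K)"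

end

theory Submission
  imports Defs
begin

text \<open>
The failure of the condition is only needed for \<open>\<epsilon> = \<theta> 0\<close>. It provides an exponent
\<open>\<beta> < \<omega>\<^sup>\<xi>\<close> and, for every \<open>m\<close>, indices \<open>n\<^sub>1, \<dots>, n\<^sub>s\<close> such that
\<open>\<theta> m \<le> \<theta> 0 \<cdot> \<theta> n\<^sub>1 \<cdots> \<theta> n\<^sub>s\<close> while the index of \<open>F m\<close> is at most that of
\<open>J[F n\<^sub>1[\<dots>[F n\<^sub>s]]]\<close>, where \<open>J\<close> is one fixed member of the sequence \<open>F\<close>, independent of \<open>m\<close>. A
diagonal argument yields \<open>N \<subseteq> M\<close> on which, for every \<open>m\<close>, each set of \<open>F m\<close> whose minimum is large
enough belongs to that composition. Hence for a rapidly increasing block sequence supported in \<open>N\<close>,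
with norms at most \<open>c\<close>, an \<open>F m\<close>-admissible sum either does not split a given block (factor
\<open>\<theta> m \<le> \<theta> 0\<close>), splits it inside one group (factor \<open>\<theta> m / (\<theta> n\<^sub>1 \<cdots> \<theta> n\<^sub>s) \<le> \<theta> 0\<close>), or splits it
between groups, which happens only for blocks whose positions form a set of \<open>J\<close>. A convex combination
giving mass at most \<open>e\<close> to every set of \<open>J\<close> therefore has norm at most \<open>\<theta> 0 \<cdot> c + 3 \<cdot> e\<close>. Such
combinations exist along branches of any tree whose order is \<open>\<omega>\<^sup>\<rho>\<close> times the order needed to produce
a single block, where \<open>\<omega>\<^sup>\<rho>\<close> bounds the index of \<open>J\<close>. Finitely many iterations bring the norm below
\<open>1 / K\<close>, so the \<open>\<ell>\<^sup>1\<close>-\<open>K\<close>-tree vanishes at some ordinal strictly below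
\<open>\<omega>^\<omega>^\<xi>\<close>. The lower bound comes from the unit vectors.
\<close>

section \<open>Arithmetic of Brouwer ordinals\<close>

\<comment> \<open>The obstacle: the indices of the families \<open>F m\<close> are cofinal in
  \<omega>^(\<omega>^\<xi>), so no averaging of bounded cost makes a convex combination small on all
  of them. The failure of the condition supplies uniformity instead: on N, groups of blocks are
  separated only by the outermost layer J, which does not depend on m. Each contraction by
  \<open>\<theta> 0\<close> therefore costs the same factor \<omega>^\<rho> with \<rho> <
  \<omega>^\<xi>, and since \<omega>^\<xi> is additively indecomposable, the exponent 1 + \<rho> d
  stays below it for every number d of contractions. The same indecomposability yields J: its index
  only has to exceed \<omega>^(2 + \<beta> + 1), where 2 + \<beta> is the gap in the negated
  condition and the last 1 accounts for passing from a leading exponent to the ordinal itself. A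
  further difficulty is that the vectors of an \<ell>1-tree are neither blocks nor finitely
  supported. The summand 1 in the exponent pays for killing initial coordinates by linear algebra,
  and finitely supported vectors replace the combinations up to an arbitrarily small error.\<close>
inductive_simps ord_le_BS_iff [simp]: "ord_le (BS x) y"
inductive_simps ord_le_BL_iff [simp]: "ord_le (BL f) y"
inductive_simps ord_lt_BS_iff [simp]: "ord_lt x (BS y)"
inductive_simps ord_lt_BL_iff [simp]: "ord_lt x (BL g)"
inductive_simps ord_lt_BZ_iff [simp]: "ord_lt x BZ"

declare le_Z [simp]

lemma ord_le_BL: "ord_le x (g n) \<Longrightarrow> ord_le x (BL g)"
  by (induction x) auto

lemma ord_le_refl [simp]: "ord_le x x"
  by (induction x) (auto intro: ord_le_BL)

lemma ord_le_lt_trans_aux: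
  "(\<And>z. ord_le y z \<Longrightarrow> ord_le x z) \<Longrightarrow> ord_lt y z \<Longrightarrow> ord_lt x z"
  by (induction z) auto

lemma ord_trans_aux:
  "ord_le x y \<Longrightarrow> (\<forall>z. ord_le y z \<longrightarrow> ord_le x z)"
  "ord_lt x y \<Longrightarrow> (\<forall>z. ord_le y z \<longrightarrow> ord_lt x z)"
proof (induction rule: ord_le_ord_lt.inducts)
  case (lt_S x y)
  then show ?case using ord_le_lt_trans_aux[of y x] by auto
qed auto

lemma ord_le_trans [trans]: "ord_le x y \<Longrightarrow> ord_le y z \<Longrightarrow> ord_le x z"
  and ord_lt_le_trans [trans]: "ord_lt x y \<Longrightarrow> ord_le y z \<Longrightarrow> ord_lt x z"
  using ord_trans_aux by blast+

lemma ord_le_lt_trans [trans]: "ord_le x y \<Longrightarrow> ord_lt y z \<Longrightarrow> ord_lt x z"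
  using ord_le_lt_trans_aux[of y x z] ord_le_trans by blast

lemma ord_le_imp_aux:
  "ord_le x y \<Longrightarrow> ord_le x (BS y)"
  "ord_lt x y \<Longrightarrow> ord_le x y"
  by (induction rule: ord_le_ord_lt.inducts) (auto intro: ord_le_BL)

lemma ord_lt_imp_le: "ord_lt x y \<Longrightarrow> ord_le x y"
  using ord_le_imp_aux by blast

lemma ord_lt_trans [trans]: "ord_lt x y \<Longrightarrow> ord_lt y z \<Longrightarrow> ord_lt x z"
  using ord_lt_imp_le ord_lt_le_trans by blast

lemma ord_less_induct:
  assumes step: "\<And>x. (\<And>y. ord_lt y x \<Longrightarrow> P y) \<Longrightarrow> P x"
  shows "P x"
proof -
  have "\<forall>y. ord_lt y x \<longrightarrow> P y"
  proof (induction x)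
    case (BS x)
    show ?case
    proof (intro allI impI)
      fix y assume "ord_lt y (BS x)"
      then have "ord_le y x" by simp
      then show "P y" using BS step ord_lt_le_trans by blast
    qed
  qed auto
  then show ?thesis using step by blast
qed

lemma ord_lt_irrefl [simp]: "\<not> ord_lt x x"
  by (induction x rule: ord_less_induct) blast

lemma ord_lt_total_aux:
  assumes "\<forall>y. ord_le x y \<or> ord_lt y x"
  shows "ord_lt x y \<or> ord_le y x"
  using assms by (induction y) auto

text \<open>Induction on x. In the successor case a nested induction on y, isolated in
  \<open>ord_lt_total_aux\<close>, uses comparability of the predecessor with every y.\<close>

lemma ord_total: "ord_le x y \<or> ord_lt y x"
proof (induction x arbitrary: y)
  case (BS x)
  then show ?case using ord_lt_total_aux[of x y] by auto
qed auto

lemma not_ord_lt_iff [simp]: "\<not> ord_lt x y \<longleftrightarrow> ord_le y x"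
  using ord_total ord_lt_irrefl ord_le_lt_trans by blast

lemma not_ord_le_iff [simp]: "\<not> ord_le x y \<longleftrightarrow> ord_lt y x"
  using not_ord_lt_iff by blast

lemma ord_lt_BS_self [simp]: "ord_lt x (BS x)"
  by simp

lemma finite_ord_max:
  assumes "finite S" "S \<noteq> {}"
  shows "\<exists>g\<in>S. \<forall>h\<in>S. ord_le h g"
  using assms
proof (induction rule: finite_ne_induct)
  case (insert x S)
  then obtain g where g: "g \<in> S" "\<forall>h\<in>S. ord_le h g" by blast
  show ?case
  proof (cases "ord_le x g")
    case True
    then show ?thesis using g by auto
  next
    case False
    then have "ord_le g x" using ord_lt_imp_le by simp
    then show ?thesis using g ord_le_trans by (intro bexI[of _ x]) auto
  qed
qed auto

section \<open>Sums, products and powers of \<omega>\<close>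

lemma oadd_BZ_left [simp]: "oadd BZ y = y"
  by (induction y) auto

lemma oadd_assoc: "oadd (oadd x y) z = oadd x (oadd y z)"
  by (induction z) auto

lemma omul_oadd: "omul x (oadd y z) = oadd (omul x y) (omul x z)"
  by (induction z) (auto simp: oadd_assoc)

lemma omul_assoc: "omul (omul x y) z = omul x (omul y z)"
  by (induction z) (auto simp: omul_oadd)

lemma omul_one_left [simp]: "omul (BS BZ) z = z"
  by (induction z) auto

lemma oexp_oadd: "oexp x (oadd y z) = omul (oexp x y) (oexp x z)"
  by (induction z) (auto simp: omul_assoc)

lemma natord_add: "natord (k + l) = oadd (natord k) (natord l)"
  by (induction l) auto

lemma natord_mono: "k \<le> l \<Longrightarrow> ord_le (natord k) (natord l)"
proof (induction l)
  case (Suc l)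
  then show ?case by (cases "k = Suc l") (auto intro: ord_le_imp_aux(1))
qed auto

lemma natord_mult: "natord (k * l) = omul (natord k) (natord l)"
proof (induction l)
  case (Suc l)
  have "k * Suc l = k * l + k" by simp
  then show ?case using Suc by (simp only: natord_add natord.simps omul.simps)
qed simp

lemma ord_le_oadd: "ord_le x (oadd x y)"
  by (induction y) (auto intro: ord_le_BL ord_le_imp_aux(1))

lemma oadd_mono_right:
  "ord_le y z \<Longrightarrow> ord_le (oadd x y) (oadd x z)"
  "ord_lt y z \<Longrightarrow> ord_lt (oadd x y) (oadd x z)"
  by (induction rule: ord_le_ord_lt.inducts) (auto intro: ord_le_oadd)

lemma oadd_mono_left: "ord_le x y \<Longrightarrow> ord_le (oadd x z) (oadd y z)"
  by (induction z) (auto intro: ord_le_BL)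

lemma oadd_mono: "ord_le x x' \<Longrightarrow> ord_le y y' \<Longrightarrow> ord_le (oadd x y) (oadd x' y')"
  using oadd_mono_left oadd_mono_right(1) ord_le_trans by blast

text \<open>The strict clause only gives a weak inequality at \<open>BS y\<close>, because multiples
  of zero do not increase; strictness for positive x is recovered in
  \<open>omul_strict_mono_right\<close>.\<close>

lemma omul_mono_right_aux:
  "ord_le y z \<Longrightarrow> ord_le (omul x y) (omul x z)"
  "ord_lt y z \<Longrightarrow> ord_le (omul x (BS y)) (omul x z)"
  by (induction rule: ord_le_ord_lt.inducts) (auto intro: ord_le_BL oadd_mono_left)

lemmas omul_mono_right = omul_mono_right_aux(1)

lemma omul_mono_left: "ord_le x y \<Longrightarrow> ord_le (omul x z) (omul y z)"
  by (induction z) (auto intro: ord_le_BL oadd_mono)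

lemma omul_mono: "ord_le x x' \<Longrightarrow> ord_le y y' \<Longrightarrow> ord_le (omul x y) (omul x' y')"
  using omul_mono_left omul_mono_right ord_le_trans by blast

lemma omul_strict_mono_right:
  assumes "ord_lt BZ x" "ord_lt y z"
  shows "ord_lt (omul x y) (omul x z)"
proof -
  have "ord_lt (omul x y) (oadd (omul x y) x)"
    using oadd_mono_right(2)[OF assms(1), of "omul x y"] by simp
  then show ?thesis
    using omul_mono_right_aux(2)[OF assms(2), of x] by (auto intro: ord_lt_le_trans)
qed

lemma natord_lt_omega: "ord_lt (natord n) omega"
  unfolding omega_def by (auto intro!: exI[of _ "Suc n"])

lemma oexp_omega_pos: "ord_lt BZ (oexp omega x)"
proof (induction x)
  case (BS x)
  have "ord_lt BZ omega" using natord_lt_omega[of 0] by simp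
  then show ?case using omul_strict_mono_right[OF BS, of BZ omega] by simp
qed auto

lemma oexp_mono_aux:
  "ord_le y z \<Longrightarrow> ord_le (oexp omega y) (oexp omega z)"
  "ord_lt y z \<Longrightarrow> ord_le (oexp omega (BS y)) (oexp omega z)"
  by (induction rule: ord_le_ord_lt.inducts)
     (auto intro: ord_le_BL omul_mono_left simp: oexp_omega_pos)

lemmas oexp_mono = oexp_mono_aux(1)

lemma omul_natord_lt: "ord_lt (omul (oexp omega x) (natord n)) (oexp omega (BS x))"
  using omul_strict_mono_right[OF oexp_omega_pos natord_lt_omega] by simp

lemma oexp_lt_BS: "ord_lt (oexp omega x) (oexp omega (BS x))"
  using omul_natord_lt[of x 1] by simp

lemma oexp_strict_mono: "ord_lt y z \<Longrightarrow> ord_lt (oexp omega y) (oexp omega z)"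
  using oexp_mono_aux(2) oexp_lt_BS ord_lt_le_trans by blast

lemma oexp_lt_cancel: "ord_lt (oexp omega y) (oexp omega z) \<Longrightarrow> ord_lt y z"
  using oexp_mono not_ord_lt_iff by blast

lemma ord_le_oexp: "ord_le x (oexp omega x)"
proof (induction x)
  case (BS x)
  then show ?case using oexp_lt_BS ord_le_lt_trans by (simp del: oexp.simps)
next
  case (BL f)
  then show ?case by (auto intro: ord_le_BL)
qed auto

section \<open>Leading exponents and finite coefficients\<close>

lemma lead_ex_aux:
  assumes "ord_lt BZ b" "ord_lt b (oexp omega c)"
  shows "\<exists>g. ord_le (oexp omega g) b \<and> ord_lt b (oexp omega (BS g))"
  using assms(2)
proof (induction c)
  case BZ
  then have "ord_le b BZ" by simp
  then show ?case using assms(1) ord_le_lt_trans ord_lt_irrefl by blast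
next
  case (BS c)
  then show ?case using not_ord_lt_iff by blast
qed auto

text \<open>Justifies the choice in \<open>lead\<close>: b \<le> \<omega>^b < \<omega>^(b+1) gives
  some power above b, and the induction of \<open>lead_ex_aux\<close> descends from it to the
  exponent where b is crossed.\<close>

lemma lead_spec:
  assumes "ord_lt BZ b"
  shows "ord_le (oexp omega (lead b)) b" "ord_lt b (oexp omega (BS (lead b)))"
proof -
  have "ord_lt b (oexp omega (BS b))"
    using ord_le_oexp oexp_lt_BS ord_le_lt_trans by blast
  then have "\<exists>g. ord_le (oexp omega g) b \<and> ord_lt b (oexp omega (BS g))"
    using lead_ex_aux[OF assms] by blast
  from someI_ex[OF this]
  show "ord_le (oexp omega (lead b)) b" "ord_lt b (oexp omega (BS (lead b)))"
    unfolding lead_def by blast+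
qed

lemma lt_oexp_BS_imp_le:
  assumes "ord_lt x (oexp omega (BS a))"
  shows "\<exists>k. ord_le x (omul (oexp omega a) (natord k))"
  using assms ord_lt_imp_le by (auto simp: omega_def)

text \<open>Additive indecomposability of powers of \<omega>. With exponent \<xi> it keeps exponents
  such as 1 + \<rho> d below \<omega>^\<xi>; with exponent \<omega>^\<xi> it keeps successors below
  the final bound.\<close>

lemma oadd_lt_oexp:
  assumes "ord_lt x (oexp omega a)" "ord_lt y (oexp omega a)"
  shows "ord_lt (oadd x y) (oexp omega a)"
  using assms
proof (induction a)
  case BZ
  then have "ord_le (oadd x y) (oadd BZ BZ)" by (intro oadd_mono) auto
  then show ?case by simp
next
  case (BS a)
  obtain k l where "ord_le x (omul (oexp omega a) (natord k))"
      "ord_le y (omul (oexp omega a) (natord l))"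
    using BS.prems lt_oexp_BS_imp_le by blast
  then have "ord_le (oadd x y) (omul (oexp omega a) (natord (k + l)))"
    by (simp add: natord_add omul_oadd oadd_mono)
  then show ?case using omul_natord_lt ord_le_lt_trans by blast
next
  case (BL g)
  then obtain k l where kl: "ord_lt x (oexp omega (g k))" "ord_lt y (oexp omega (g l))" by auto
  have "ord_le (oexp omega (g k)) (oexp omega (g l)) \<or> ord_le (oexp omega (g l)) (oexp omega (g k))"
    using ord_total ord_lt_imp_le by blast
  then show ?case using kl BL.IH ord_lt_le_trans by (auto simp del: not_ord_lt_iff) blast+
qed

lemma natord_lt_oexp: "ord_lt BZ a \<Longrightarrow> ord_lt (natord n) (oexp omega a)"
proof -
  assume "ord_lt BZ a"
  then have "ord_le (oexp omega (BS BZ)) (oexp omega a)" by (intro oexp_mono) simp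
  moreover have "ord_lt (natord n) (oexp omega (BS BZ))"
    using natord_lt_omega by simp
  ultimately show ?thesis using ord_lt_le_trans by blast
qed

text \<open>A positive finite factor is absorbed by a following \<omega>, so finite coefficients can
  be moved to the right of powers of \<omega> and collected there.\<close>

lemma natord_omul_oexp: "ord_le (omul (natord k) (oexp omega a)) (omul (oexp omega a) (natord k))"
proof (induction a)
  case (BS b)
  have k: "k = 0 \<or> ord_le (BS BZ) (natord k)" by (cases k) auto
  have "ord_le (omul (natord k) omega) omega"
    unfolding omega_def
    by (simp add: natord_mult[symmetric]) (blast intro: ord_le_BL ord_le_refl)
  have "omul (natord k) (oexp omega (BS b)) = omul (omul (natord k) (oexp omega b)) omega"
    by (simp add: omul_assoc)
  also have "ord_le \<dots> (omul (omul (oexp omega b) (natord k)) omega)"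
    using BS by (rule omul_mono_left)
  also have "omul (omul (oexp omega b) (natord k)) omega = omul (oexp omega b) (omul (natord k) omega)"
    by (simp add: omul_assoc)
  also have "ord_le \<dots> (omul (oexp omega b) omega)"
    by (rule omul_mono_right) fact
  finally have *: "ord_le (omul (natord k) (oexp omega (BS b))) (oexp omega (BS b))" by simp
  show ?case
  proof (cases "k = 0")
    case True
    have "ord_le (omul BZ z) BZ" for z by (induction z) auto
    then show ?thesis using True by simp
  next
    case False
    then have "ord_le (omul (oexp omega (BS b)) (natord 1)) (omul (oexp omega (BS b)) (natord k))"
      by (intro omul_mono_right natord_mono) auto
    then show ?thesis using * ord_le_trans by (simp del: oexp.simps)
  qed
next
  case (BL g)
  have "ord_le (omul (natord k) (oexp omega (g n))) (omul (oexp omega (BL g)) (natord k))" for n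
    by (rule ord_le_trans[OF BL[OF rangeI]]) (intro omul_mono_left oexp_mono ord_le_BL[of _ _ n] ord_le_refl)
  then show ?case by simp
qed auto

text \<open>The head is added on the right because \<open>prod_ord\<close> multiplies by the head
  last; ordinal addition does not commute, so the orders have to match.\<close>

primrec osum :: "(nat \<Rightarrow> bord) \<Rightarrow> nat list \<Rightarrow> bord" where
  "osum a [] = BZ"
| "osum a (n # ns) = oadd (osum a ns) (a n)"

lemma prod_ord_Nil: "prod_ord \<alpha> [] = one"
  and prod_ord_Cons: "prod_ord \<alpha> (n # ns) = omul (prod_ord \<alpha> ns) (\<alpha> n)"
  by (simp_all add: prod_ord_def)

lemma prod_ord_pos: "(\<And>n. ord_lt BZ (\<alpha> n)) \<Longrightarrow> ord_lt BZ (prod_ord \<alpha> ns)"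
proof (induction ns)
  case Nil
  then show ?case by (simp add: prod_ord_Nil one_def)
next
  case (Cons n ns)
  then show ?case
    using omul_strict_mono_right[of "prod_ord \<alpha> ns" BZ "\<alpha> n"] by (simp add: prod_ord_Cons)
qed

text \<open>Each factor is at most a power of \<omega> times a finite coefficient. Moving the
  coefficients to the right multiplies the powers, so their exponents add up.\<close>

lemma prod_ord_le:
  assumes "\<And>n. ord_lt BZ (\<alpha> n)"
  shows "\<exists>k. ord_le (prod_ord \<alpha> ns) (omul (oexp omega (osum (\<lambda>n. lead (\<alpha> n)) ns)) (natord k))"
proof (induction ns)
  case Nil
  show ?case by (intro exI[of _ 1]) (simp add: prod_ord_Nil one_def)
next
  case (Cons n ns)
  let ?s = "oexp omega (osum (\<lambda>n. lead (\<alpha> n)) ns)"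
  obtain k where k: "ord_le (prod_ord \<alpha> ns) (omul ?s (natord k))" using Cons by blast
  obtain l where l: "ord_le (\<alpha> n) (omul (oexp omega (lead (\<alpha> n))) (natord l))"
    using lt_oexp_BS_imp_le lead_spec(2)[OF assms] by blast
  have "ord_le (prod_ord \<alpha> (n # ns)) (omul (omul ?s (natord k)) (omul (oexp omega (lead (\<alpha> n))) (natord l)))"
    unfolding prod_ord_Cons by (rule omul_mono[OF k l])
  also have "\<dots> = omul (omul ?s (omul (natord k) (oexp omega (lead (\<alpha> n))))) (natord l)"
    by (simp add: omul_assoc)
  also have "ord_le \<dots> (omul (omul ?s (omul (oexp omega (lead (\<alpha> n))) (natord k))) (natord l))"
    by (intro omul_mono_left omul_mono_right natord_omul_oexp)
  also have "\<dots> = omul (oexp omega (osum (\<lambda>n. lead (\<alpha> n)) (n # ns))) (natord (k * l))"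
    by (simp add: omul_assoc oexp_oadd natord_mult)
  finally show ?case by blast
qed

lemma lead_prod_ord_le:
  assumes "\<And>n. ord_lt BZ (\<alpha> n)"
  shows "ord_le (lead (prod_ord \<alpha> ns)) (osum (\<lambda>n. lead (\<alpha> n)) ns)"
proof -
  obtain k where "ord_le (prod_ord \<alpha> ns) (omul (oexp omega (osum (\<lambda>n. lead (\<alpha> n)) ns)) (natord k))"
    using prod_ord_le[of \<alpha>, OF assms] by blast
  then have "ord_lt (oexp omega (lead (prod_ord \<alpha> ns))) (oexp omega (BS (osum (\<lambda>n. lead (\<alpha> n)) ns)))"
    using lead_spec(1)[OF prod_ord_pos[of \<alpha>, OF assms]] omul_natord_lt ord_le_trans ord_le_lt_trans by metis
  then show ?thesis using oexp_lt_cancel by fastforce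
qed

section \<open>Derivatives and composition of families\<close>

text \<open>A derivative by end extensions: a set survives if a point above all its elements can be
  added. On regular families it is the Cantor-Bendixson derivative, but it is equally usable for
  tails, compositions and families of continuations, without a topology.\<close>

primrec fderiv :: "nat set set \<Rightarrow> bord \<Rightarrow> nat set set" where
  "fderiv H BZ = H"
| "fderiv H (BS b) = {A \<in> fderiv H b. \<exists>k. (\<forall>a\<in>A. a < k) \<and> insert k A \<in> fderiv H b}"
| "fderiv H (BL g) = (\<Inter>n. fderiv H (g n))"

definition hereditary :: "nat set set \<Rightarrow> bool" where
  "hereditary H \<longleftrightarrow> (\<forall>A\<in>H. \<forall>B. B \<subseteq> A \<longrightarrow> B \<in> H)"

text \<open>Increasing maps take the place of enumerations, so that images can be pushed through
  derivatives and compositions; finiteness of the members is built in.\<close>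

definition spreading :: "nat set set \<Rightarrow> bool" where
  "spreading H \<longleftrightarrow> (\<forall>A\<in>H. finite A \<and>
     (\<forall>\<phi>. strict_mono_on A \<phi> \<longrightarrow> (\<forall>a\<in>A. a \<le> \<phi> a) \<longrightarrow> \<phi> ` A \<in> H))"

definition tail :: "nat \<Rightarrow> nat set set \<Rightarrow> nat set set" where
  "tail p H = {A \<in> H. A \<subseteq> {p..}}"

lemma fderiv_subset: "fderiv H b \<subseteq> H"
  by (induction b) auto

lemma fderiv_anti_aux:
  "ord_le x y \<Longrightarrow> fderiv H y \<subseteq> fderiv H x"
  "ord_lt x y \<Longrightarrow> fderiv H y \<subseteq> fderiv H (BS x)"
  using fderiv_subset[of H] by (induction rule: ord_le_ord_lt.inducts) auto

lemma fderiv_anti: "ord_le x y \<Longrightarrow> A \<in> fderiv H y \<Longrightarrow> A \<in> fderiv H x"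
  using fderiv_anti_aux(1) by blast

lemma fderiv_oadd: "fderiv (fderiv H a) b = fderiv H (oadd a b)"
  by (induction b) auto

lemma fderiv_mono: "H \<subseteq> H' \<Longrightarrow> fderiv H b \<subseteq> fderiv H' b"
  by (induction b) auto

lemma hereditaryD: "hereditary H \<Longrightarrow> A \<in> H \<Longrightarrow> B \<subseteq> A \<Longrightarrow> B \<in> H"
  unfolding hereditary_def by blast

lemma hereditary_fderiv:
  assumes "hereditary H" shows "hereditary (fderiv H b)"
proof (induction b)
  case (BS b)
  have "B \<in> fderiv H (BS b)" if A: "A \<in> fderiv H (BS b)" and B: "B \<subseteq> A" for A B
  proof -
    obtain k where k: "\<forall>a\<in>A. a < k" "insert k A \<in> fderiv H b" using A by auto
    have "insert k B \<subseteq> insert k A" using B by auto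
    then have "insert k B \<in> fderiv H b" by (rule hereditaryD[OF BS k(2)])
    moreover have "A \<in> fderiv H b" using A by simp
    then have "B \<in> fderiv H b" by (rule hereditaryD[OF BS _ B])
    moreover have "\<forall>a\<in>B. a < k" using k(1) B by blast
    ultimately show ?thesis by auto
  qed
  then show ?case unfolding hereditary_def by blast
next
  case (BL g)
  then have h: "hereditary (fderiv H (g n))" for n by blast
  show ?case
    unfolding hereditary_def
  proof (intro ballI allI impI)
    fix A B assume A: "A \<in> fderiv H (BL g)" and B: "B \<subseteq> A"
    then have "A \<in> fderiv H (g n)" for n by simp
    then show "B \<in> fderiv H (BL g)" using hereditaryD[OF h _ B] by simp
  qed
qed (use assms in simp)

lemma spreadingD:
  "spreading H \<Longrightarrow> A \<in> H \<Longrightarrow> strict_mono_on A \<phi> \<Longrightarrow> (\<And>a. a \<in> A \<Longrightarrow> a \<le> \<phi> a) \<Longrightarrow> \<phi> ` A \<in> H"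
  unfolding spreading_def by blast

lemma spreading_insert:
  assumes "spreading H" "insert k A \<in> H" "\<forall>a\<in>A. a < k" "k \<le> l"
  shows "insert l A \<in> H"
proof -
  have "(\<lambda>a. if a = k then l else a) ` insert k A \<in> H"
    by (rule spreadingD[OF assms(1,2)])
       (use assms(3,4) in \<open>auto simp: strict_mono_on_def dest: less_le_trans\<close>)
  moreover have "(\<lambda>a. if a = k then l else a) ` insert k A = insert l A"
    using assms(3) by auto
  ultimately show ?thesis by simp
qed

lemma spreading_fderiv:
  assumes "spreading H" shows "spreading (fderiv H b)"
proof (induction b)
  case (BS b)
  have "\<phi> ` A \<in> fderiv H (BS b)"
    if A: "A \<in> fderiv H (BS b)" and \<phi>: "strict_mono_on A \<phi>" "\<forall>a\<in>A. a \<le> \<phi> a" for A \<phi>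
  proof -
    have 1: "\<phi> ` A \<in> fderiv H b" using BS A \<phi> unfolding spreading_def by auto
    have fin: "finite A" using A BS unfolding spreading_def by auto
    obtain k where k: "\<forall>a\<in>A. a < k" "insert k A \<in> fderiv H b" using A by auto
    \<comment> \<open>The witness k is moved to a point l that is at least k and beyond the image of
      A, so that the extended map stays increasing and above the identity.\<close>
    define l where "l = Max (insert k (Suc ` \<phi> ` A))"
    have l: "k \<le> l" "\<And>a. a \<in> A \<Longrightarrow> \<phi> a < l"
      unfolding l_def using fin by (auto simp: Suc_le_eq[symmetric] intro!: Max_ge)
    let ?\<psi> = "\<lambda>a. if a = k then l else \<phi> a"
    have "?\<psi> ` insert k A \<in> fderiv H b"
    proof (rule spreadingD[OF BS k(2)])
      show "strict_mono_on (insert k A) ?\<psi>"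
        using \<phi>(1) k(1) l by (auto simp: strict_mono_on_def)
    qed (use \<phi>(2) l in auto)
    moreover have "?\<psi> ` insert k A = insert l (\<phi> ` A)" using k(1) by force
    ultimately show ?thesis using 1 l(2) by auto
  qed
  moreover have "finite A" if "A \<in> fderiv H (BS b)" for A
    using that BS unfolding spreading_def by auto
  ultimately show ?case unfolding spreading_def by blast
next
  case (BL g)
  then have h: "spreading (fderiv H (g n))" for n by blast
  show ?case
    unfolding spreading_def
  proof (intro ballI conjI allI impI)
    fix A assume A: "A \<in> fderiv H (BL g)"
    then have mem: "A \<in> fderiv H (g n)" for n by simp
    show "finite A" using h mem unfolding spreading_def by blast
    fix \<phi> assume "strict_mono_on A \<phi>" "\<forall>a\<in>A. a \<le> \<phi> a"
    then show "\<phi> ` A \<in> fderiv H (BL g)" using spreadingD[OF h mem] by simp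
  qed
qed (use assms in simp)

section \<open>Regular families and the Cantor-Bendixson index\<close>

lemma sorted_list_of_set_image:
  fixes A :: "nat set" and \<phi> :: "nat \<Rightarrow> nat"
  assumes "finite A" "strict_mono_on A \<phi>"
  shows "sorted_list_of_set (\<phi> ` A) = map \<phi> (sorted_list_of_set A)"
proof (rule sorted_list_of_set_unique[THEN iffD1])
  let ?l = "map \<phi> (sorted_list_of_set A)"
  have "sorted_wrt (\<lambda>x y. \<phi> x < \<phi> y) (sorted_list_of_set A)"
    using strict_sorted_list_of_set[of A]
    by (rule sorted_wrt_mono_rel[rotated]) (use assms in \<open>auto simp: strict_mono_on_def\<close>)
  then show "sorted_wrt (<) ?l \<and> set ?l = \<phi> ` A \<and> length ?l = card (\<phi> ` A)"
    using assms by (auto simp: sorted_wrt_map card_image strict_mono_on_imp_inj_on)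
qed (use assms in simp)

lemma regular_finite: "regular_family H \<Longrightarrow> A \<in> H \<Longrightarrow> finite A"
  unfolding regular_family_def by (elim conjE) (rule bspec)

lemma regular_hereditary: "regular_family H \<Longrightarrow> hereditary H"
  unfolding regular_family_def hereditary_def by (elim conjE) assumption

lemma regular_closed:
  "regular_family H \<Longrightarrow> (\<And>n. \<exists>B\<in>H. B \<inter> {..<n} = A \<inter> {..<n}) \<Longrightarrow> A \<in> H"
  unfolding regular_family_def by (elim conjE) (rule mp, erule spec, rule allI)

lemma regular_spread:
  assumes "regular_family H" "A \<in> H" "finite B" "card B = card A"
    and "\<And>i. i < card A \<Longrightarrow> sorted_list_of_set A ! i \<le> sorted_list_of_set B ! i"
  shows "B \<in> H"
proof -
  have "\<forall>A\<in>H. \<forall>B. finite B \<and> card B = card A \<and>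
      (\<forall>i<card A. sorted_list_of_set A ! i \<le> sorted_list_of_set B ! i) \<longrightarrow> B \<in> H"
    using assms(1) unfolding regular_family_def by (elim conjE) assumption
  from bspec[OF this assms(2)] show ?thesis using assms(3-5) by simp
qed

lemma regular_spreading:
  assumes "regular_family H" shows "spreading H"
proof -
  have "\<phi> ` A \<in> H" if A: "A \<in> H" and \<phi>: "strict_mono_on A \<phi>" "\<forall>a\<in>A. a \<le> \<phi> a" for A \<phi>
  proof -
    have fin: "finite A" using regular_finite[OF assms A] .
    have c: "card (\<phi> ` A) = card A"
      using \<phi>(1) by (auto intro: card_image strict_mono_on_imp_inj_on)
    have "sorted_list_of_set A ! i \<le> sorted_list_of_set (\<phi> ` A) ! i" if "i < card A" for i
    proof -
      have "sorted_list_of_set A ! i \<in> A"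
        using that fin nth_mem[of i "sorted_list_of_set A"] by simp
      then show ?thesis
        using \<phi> that fin by (simp add: sorted_list_of_set_image)
    qed
    then show ?thesis
      using regular_spread[OF assms A _ c] fin by simp
  qed
  moreover have "finite A" if "A \<in> H" for A
    using regular_finite[OF assms that] .
  ultimately show ?thesis unfolding spreading_def by blast
qed

text \<open>A limit point A of X lies in H by closedness and is thus finite. A member of X agreeing
  with A past max A contains A and a later point k, and hereditariness cuts it down to A with k
  added. Conversely, spreading sends k to infinity and so produces members converging to A.\<close>

lemma cb_derived_subset:
  assumes reg: "regular_family H" and X: "X \<subseteq> H" "hereditary X" "spreading X"
  shows "cb_derived X = {A \<in> X. \<exists>k. (\<forall>a\<in>A. a < k) \<and> insert k A \<in> X}"
proof (intro equalityI subsetI)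
  fix A assume A: "A \<in> cb_derived X"
  then have "\<exists>B\<in>H. B \<inter> {..<n} = A \<inter> {..<n}" for n
    using X(1) unfolding cb_derived_def by blast
  then have "A \<in> H" using regular_closed[OF reg] by blast
  then have fin: "finite A" using regular_finite[OF reg] by blast
  define n where "n = Suc (Max (insert 0 A))"
  have n: "a < n" if "a \<in> A" for a
    using that fin unfolding n_def by (auto simp: less_Suc_eq_le)
  obtain B where B: "B \<in> X" "B \<noteq> A" "B \<inter> {..<n} = A \<inter> {..<n}"
    using A unfolding cb_derived_def by blast
  have sub: "A \<subseteq> B" using B(3) n by auto
  then obtain k where k: "k \<in> B" "k \<notin> A" using B(2) by blast
  then have "\<not> k < n" using B(3) by auto
  then have "\<forall>a\<in>A. a < k" using n by fastforce
  moreover have "insert k A \<in> X" "A \<in> X"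
    using hereditaryD[OF X(2) B(1)] sub k(1) by simp_all
  ultimately show "A \<in> {A \<in> X. \<exists>k. (\<forall>a\<in>A. a < k) \<and> insert k A \<in> X}" by blast
next
  fix A assume "A \<in> {A \<in> X. \<exists>k. (\<forall>a\<in>A. a < k) \<and> insert k A \<in> X}"
  then obtain k where k: "\<forall>a\<in>A. a < k" "insert k A \<in> X" by blast
  have "\<exists>B\<in>X. B \<noteq> A \<and> B \<inter> {..<n} = A \<inter> {..<n}" for n
  proof (intro bexI conjI)
    show "insert (max k n) A \<in> X" using spreading_insert[OF X(3) k(2,1)] by simp
    have "max k n \<notin> A" using k(1) by fastforce
    then show "insert (max k n) A \<noteq> A" by blast
    show "insert (max k n) A \<inter> {..<n} = A \<inter> {..<n}" by auto
  qed
  then show "A \<in> cb_derived X" unfolding cb_derived_def by blast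
qed

lemma cb_deriv_eq_fderiv:
  assumes "regular_family H" shows "cb_deriv H b = fderiv H b"
proof (induction b)
  case (BS b)
  show ?case
    using cb_derived_subset[OF assms fderiv_subset hereditary_fderiv spreading_fderiv, of b]
      regular_hereditary[OF assms] regular_spreading[OF assms] BS by simp
qed auto

lemma cb_index_fderiv:
  assumes "regular_family H" "cb_index H a"
  shows "fderiv H a = {}" "\<And>b. ord_lt b a \<Longrightarrow> {} \<in> fderiv H b"
  using assms hereditary_fderiv[OF regular_hereditary[OF assms(1)]]
  unfolding cb_index_def cb_deriv_eq_fderiv[OF assms(1)] hereditary_def by blast+

text \<open>The hypothesis speaks of ordinals strictly below a, whereas \<omega>^l = a is permitted.
  For l > 0 the power is a limit, and the empty set survives there once it survives below; for l = 0
  the assumption that a exceeds one is used.\<close>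

lemma fderiv_oexp_le_index:
  assumes "\<And>b. ord_lt b a \<Longrightarrow> {} \<in> fderiv H b" "ord_lt one a" "ord_le (oexp omega l) a"
  shows "{} \<in> fderiv H (oexp omega l)"
  using assms(3)
proof (induction l)
  case BZ
  then show ?case using assms(1)[OF assms(2)] by (simp add: one_def)
next
  case (BS l)
  have "{} \<in> fderiv H (omul (oexp omega l) (natord n))" for n
    using assms(1) omul_natord_lt BS.prems ord_lt_le_trans by blast
  then show ?case by (simp add: omega_def)
qed auto

text \<open>Spreading replaces the point witnessing an extension by a later one in S, so that
  passing to an infinite set of indices loses no rank. This carries the lower bound over to
  N.\<close>

lemma fderiv_restrict:
  assumes H: "spreading H" and S: "infinite S" and A: "A \<in> fderiv H b" "A \<subseteq> S"
  shows "A \<in> fderiv {A \<in> H. A \<subseteq> S} b"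
  using A
proof (induction b arbitrary: A)
  case (BS b)
  then obtain k where k: "\<forall>a\<in>A. a < k" "insert k A \<in> fderiv H b" by auto
  obtain l where l: "l \<in> S" "k \<le> l"
    using S unfolding finite_nat_set_iff_bounded by (meson not_le)
  have "insert l A \<in> fderiv H b"
    using spreading_insert[OF spreading_fderiv[OF H] k(2,1) l(2)] .
  then have "insert l A \<in> fderiv {A \<in> H. A \<subseteq> S} b" using BS l(1) by simp
  moreover have "\<forall>a\<in>A. a < l" using k(1) l(2) by auto
  ultimately show ?case using BS by auto
qed auto

section \<open>Composition of families\<close>

definition seg :: "nat set \<Rightarrow> nat \<Rightarrow> nat set" where
  "seg A a = {k. a \<le> k \<and> (\<forall>b\<in>A. a < b \<longrightarrow> k < b)}"

text \<open>\<open>seg C c\<close> is the interval from c up to the next element of C, or to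
  infinity if there is none. Cutting along these intervals encodes a decomposition into successive
  pieces by the minima alone, without lists.\<close>

definition splits :: "nat set set \<Rightarrow> nat set \<Rightarrow> nat set \<Rightarrow> bool" where
  "splits G A C \<longleftrightarrow> C \<subseteq> A \<and> (\<forall>a\<in>A. \<exists>c\<in>C. c \<le> a) \<and> (\<forall>c\<in>C. A \<inter> seg C c \<in> G)"

lemma splits_cover:
  assumes "splits G A C" "finite C"
  shows "A \<subseteq> (\<Union>c\<in>C. A \<inter> seg C c)"
proof
  fix a assume a: "a \<in> A"
  let ?D = "{c \<in> C. c \<le> a}"
  have D: "finite ?D" "?D \<noteq> {}" using a assms unfolding splits_def by auto
  have "Max ?D \<in> ?D" using Max_in[OF D] .
  moreover have "a < b" if "b \<in> C" "Max ?D < b" for b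
  proof (rule ccontr)
    assume "\<not> a < b"
    then have "b \<in> ?D" using that by simp
    from Max_ge[OF D(1) this] show False using that(2) by linarith
  qed
  ultimately show "a \<in> (\<Union>c\<in>C. A \<inter> seg C c)" using a by (auto simp: seg_def)
qed

text \<open>The family written \<open>J[G]\<close>; \<open>C\<close> is the set of minima of the pieces.\<close>
definition family_comp :: "nat set set \<Rightarrow> nat set set \<Rightarrow> nat set set" where
  "family_comp J G = {A. finite A \<and> (\<exists>C\<in>J. splits G A C)}"

lemma spreading_comp:
  assumes J: "spreading J" and G: "spreading G"
  shows "spreading (family_comp J G)"
proof -
  have "\<phi> ` A \<in> family_comp J G"
    if A: "A \<in> family_comp J G" and \<phi>: "strict_mono_on A \<phi>" "\<forall>a\<in>A. a \<le> \<phi> a" for A \<phi>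
  proof -
    obtain C where C: "C \<in> J" "splits G A C" "finite A" using A unfolding family_comp_def by blast
    have CA: "C \<subseteq> A" using C(2) unfolding splits_def by blast
    have less: "\<phi> a < \<phi> b \<longleftrightarrow> a < b" "\<phi> a \<le> \<phi> b \<longleftrightarrow> a \<le> b" if "a \<in> A" "b \<in> A" for a b
      using \<phi>(1) that strict_mono_on_less strict_mono_on_less_eq by blast+
    have "\<phi> ` C \<in> J"
      using spreadingD[OF J C(1) monotone_on_subset[OF \<phi>(1) CA]] CA \<phi>(2) by blast
    moreover have "splits G (\<phi> ` A) (\<phi> ` C)"
      unfolding splits_def
    proof (intro conjI ballI)
      show "\<phi> ` C \<subseteq> \<phi> ` A" using CA by blast
    next
      fix a assume "a \<in> \<phi> ` A"
      then obtain x where x: "x \<in> A" "a = \<phi> x" by blast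
      then obtain c where "c \<in> C" "c \<le> x" using C(2) unfolding splits_def by blast
      then show "\<exists>c\<in>\<phi> ` C. c \<le> a" using x less CA by blast
    next
      fix d assume "d \<in> \<phi> ` C"
      then obtain c where c: "c \<in> C" "d = \<phi> c" by blast
      have "\<phi> x \<in> seg (\<phi> ` C) d \<longleftrightarrow> x \<in> seg C c" if "x \<in> A" for x
      proof -
        have "\<phi> c \<le> \<phi> x \<longleftrightarrow> c \<le> x" "\<And>b. b \<in> C \<Longrightarrow> \<phi> c < \<phi> b \<longleftrightarrow> c < b"
          "\<And>b. b \<in> C \<Longrightarrow> \<phi> x < \<phi> b \<longleftrightarrow> x < b"
          using less that c(1) CA by blast+
        then show ?thesis unfolding seg_def c(2) by auto
      qed
      then have "\<phi> ` A \<inter> seg (\<phi> ` C) d = \<phi> ` (A \<inter> seg C c)" by auto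
      moreover have "\<phi> ` (A \<inter> seg C c) \<in> G"
        using C(2) c(1) \<phi>(2) unfolding splits_def
        by (intro spreadingD[OF G _ monotone_on_subset[OF \<phi>(1)]]) auto
      ultimately show "\<phi> ` A \<inter> seg (\<phi> ` C) d \<in> G" by simp
    qed
    ultimately show ?thesis using C(3) unfolding family_comp_def by blast
  qed
  then show ?thesis unfolding spreading_def by (auto simp: family_comp_def)
qed

text \<open>The new piece contributes its minimum to C and becomes the last segment; the older
  segments are only truncated at that minimum, beyond all of A.\<close>

lemma comp_append:
  assumes "splits G A C" "finite A" "B \<in> G" "finite B" "B \<noteq> {}" "B \<subseteq> {p..}" "\<forall>a\<in>A. a < p"
  shows "splits G (A \<union> B) (insert (Min B) C)"
proof -
  let ?m = "Min B"
  have m: "?m \<in> B" "\<And>b. b \<in> B \<Longrightarrow> ?m \<le> b" using assms by auto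
  have lt: "a < b" if "a \<in> A" "b \<in> B" for a b using assms(6,7) that by fastforce
  have CA: "C \<subseteq> A" using assms(1) unfolding splits_def by blast
  have A: "A \<subseteq> {..<?m}" using lt m(1) by blast
  have B: "B \<subseteq> {?m..}" using m(2) by blast
  have C: "c < ?m" "\<not> ?m < c" if "c \<in> C" for c using A CA that by auto
  have "seg (insert ?m C) ?m = {?m..}" using C(2) unfolding seg_def by blast
  then have 1: "(A \<union> B) \<inter> seg (insert ?m C) ?m = B" using A B by auto
  have "seg (insert ?m C) c = seg C c \<inter> {..<?m}" if "c \<in> C" for c
    using C(1)[OF that] unfolding seg_def by blast
  then have 2: "(A \<union> B) \<inter> seg (insert ?m C) c = A \<inter> seg C c" if "c \<in> C" for c
    using that A B by auto
  show ?thesis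
    unfolding splits_def
  proof (intro conjI ballI)
    show "insert ?m C \<subseteq> A \<union> B" using m CA by auto
  next
    fix a assume "a \<in> A \<union> B"
    then show "\<exists>c\<in>insert ?m C. c \<le> a" using assms(1) m unfolding splits_def by blast
  next
    fix c assume "c \<in> insert ?m C"
    then show "(A \<union> B) \<inter> seg (insert ?m C) c \<in> G"
    proof (cases "c = ?m")
      case True
      then show ?thesis using 1 assms(3) by simp
    next
      case False
      then show ?thesis using 2 assms(1) \<open>c \<in> insert ?m C\<close> unfolding splits_def by auto
    qed
  qed
qed

text \<open>Induction on the rank \<mu> of C in J: lowering it by one makes room for a further piece
  from G, and building this piece point by point costs g derivatives, whence the product. The rank g
  is assumed on every tail of G because the piece has to start beyond A and beyond the point
  extending C.\<close>

lemma fderiv_comp_aux: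
  assumes J: "spreading J" and finG: "\<forall>B\<in>G. finite B"
    and G: "\<And>p. {} \<in> fderiv (tail p G) g"
    and "C \<in> fderiv J \<mu>" "splits G A C" "finite A" "A \<subseteq> {p..}"
  shows "A \<in> fderiv (tail p (family_comp J G)) (omul g \<mu>)"
  using assms(4-)
proof (induction \<mu> arbitrary: A C)
  case BZ
  then show ?case by (auto simp: tail_def family_comp_def)
next
  case (BS \<mu>)
  let ?Q = "tail p (family_comp J G)"
  obtain k where k: "\<forall>c\<in>C. c < k" "insert k C \<in> fderiv J \<mu>" and C: "C \<in> fderiv J \<mu>"
    using BS.prems(1) by auto
  define q where "q = k + p + Suc (Max (insert 0 A))"
  have "a \<le> Max (insert 0 A)" if "a \<in> A" for a
    using that BS.prems(3) by (intro Max_ge) auto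
  then have q: "k \<le> q" "p \<le> q" "\<And>a. a \<in> A \<Longrightarrow> a < q"
    unfolding q_def by fastforce+
  have step: "A \<union> B \<in> fderiv ?Q (oadd (omul g \<mu>) \<gamma>)"
    if "B \<in> fderiv (tail q G) \<gamma>" "B \<noteq> {}" for B \<gamma>
    using that
  proof (induction \<gamma> arbitrary: B)
    case BZ
    then have B: "B \<in> G" "B \<subseteq> {q..}" "finite B" using finG by (auto simp: tail_def)
    have "Min B \<in> B" using BZ B by simp
    then have "k \<le> Min B" using B(2) q(1) by auto
    then have "insert (Min B) C \<in> fderiv J \<mu>"
      using spreading_insert[OF spreading_fderiv[OF J] k(2,1)] by simp
    moreover have "splits G (A \<union> B) (insert (Min B) C)"
      using comp_append[OF BS.prems(2,3) B(1,3) BZ(2) B(2)] q(3) by blast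
    moreover have "A \<union> B \<subseteq> {p..}" using BS.prems(4) B(2) q(2) by auto
    ultimately show ?case
      using BS.IH[of "insert (Min B) C" "A \<union> B"] B(3) BS.prems(3) by simp
  next
    case (BS \<gamma>)
    then obtain l where l: "\<forall>a\<in>B. a < l" "insert l B \<in> fderiv (tail q G) \<gamma>" by auto
    then have "insert l B \<in> tail q G" using fderiv_subset by blast
    then have "q \<le> l" by (auto simp: tail_def)
    then have "\<forall>a\<in>A \<union> B. a < l" using l(1) q(3) by fastforce
    moreover have "insert l (A \<union> B) \<in> fderiv ?Q (oadd (omul g \<mu>) \<gamma>)"
      using BS.IH[OF l(2)] by simp
    ultimately show ?case using BS by auto
  qed auto
  have base: "A \<in> fderiv ?Q (omul g \<mu>)" using BS.IH[OF C] BS.prems by blast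
  \<comment> \<open>The empty continuation is treated apart: it adds no minimum to C, and only its
    first point creates a new piece.\<close>
  have "A \<in> fderiv ?Q (oadd (omul g \<mu>) \<gamma>)" if "{} \<in> fderiv (tail q G) \<gamma>" for \<gamma>
    using that
  proof (induction \<gamma>)
    case BZ
    then show ?case using base by simp
  next
    case (BS \<gamma>)
    then obtain l where l: "{l} \<in> fderiv (tail q G) \<gamma>" by auto
    then have "{l} \<in> tail q G" using fderiv_subset by blast
    then have "\<forall>a\<in>A. a < l" using q(3) by (fastforce simp: tail_def)
    then show ?case using step[OF l] BS by auto
  qed auto
  then show ?case using G by simp
next
  case (BL h)
  have "A \<in> fderiv (tail p (family_comp J G)) (omul g (h n))" for n
    by (rule BL.IH[OF rangeI, of C]) (use BL.prems in auto)
  then show ?case by simp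
qed

lemma fderiv_comp:
  assumes "spreading J" "\<forall>B\<in>G. finite B" "\<And>p. {} \<in> fderiv (tail p G) g" "{} \<in> fderiv J \<mu>"
  shows "{} \<in> fderiv (tail p (family_comp J G)) (omul g \<mu>)"
  by (rule fderiv_comp_aux[OF assms]) (auto simp: splits_def)

text \<open>The head of the list is the outermost family. The sets with at most one point at the
  bottom act as a unit, matching the empty product of the weights.\<close>

primrec fam :: "(nat \<Rightarrow> nat set set) \<Rightarrow> nat list \<Rightarrow> nat set set" where
  "fam F [] = {A. finite A \<and> card A \<le> 1}"
| "fam F (n # ns) = family_comp (F n) (fam F ns)"

lemma spreading_fam: "(\<And>n. spreading (F n)) \<Longrightarrow> spreading (fam F ns)"
proof (induction ns)
  case Nil
  then show ?case by (auto simp: spreading_def intro: card_image_le order_trans)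
qed (simp add: spreading_comp)

lemma fderiv_singletons: "{} \<in> fderiv (tail p {A. finite A \<and> card A \<le> 1}) (BS BZ)"
  by (auto simp: tail_def intro: exI[of _ p])

lemma fderiv_fam:
  assumes F: "\<And>n. spreading (F n)" and a: "\<And>n. {} \<in> fderiv (F n) (oexp omega (a n))"
  shows "{} \<in> fderiv (tail p (fam F ns)) (oexp omega (osum a ns))"
proof (induction ns arbitrary: p)
  case Nil
  then show ?case using fderiv_singletons by simp
next
  case (Cons n ns)
  have "\<forall>B\<in>fam F ns. finite B" using spreading_fam[of F ns, OF F] unfolding spreading_def by blast
  from fderiv_comp[OF F[of n] this Cons a] show ?case by (simp add: oexp_oadd)
qed

section \<open>Rank comparison and diagonalisation\<close>

definition dominated :: "nat set set \<Rightarrow> nat set set \<Rightarrow> nat set \<Rightarrow> bool" where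
  "dominated H Q A \<longleftrightarrow> A \<notin> H \<or> (\<exists>b. A \<notin> fderiv H b \<and> A \<in> fderiv Q b)"

lemma dominated_imp: "dominated H Q A \<Longrightarrow> A \<in> H \<Longrightarrow> A \<in> Q"
  unfolding dominated_def using fderiv_subset by blast

text \<open>For members of H, domination says that some ordinal b separates a smaller rank in H from
  a larger one in Q. If b = b' + 1 and A survives b' in H, then no extension of A by a later point
  survives b' in H, while spreading makes all sufficiently late extensions survive b' in Q.\<close>

lemma dominated_step:
  assumes H: "hereditary H" and Q: "spreading Q" and A: "finite A" "dominated H Q A"
  shows "\<exists>t. \<forall>k\<ge>t. dominated H Q (insert k A)"
proof (cases "A \<in> H")
  case False
  then have "insert k A \<notin> H" for k using H unfolding hereditary_def by blast
  then show ?thesis unfolding dominated_def by blast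
next
  case True
  then obtain b where "A \<notin> fderiv H b" "A \<in> fderiv Q b" using A unfolding dominated_def by blast
  then show ?thesis
  proof (induction b)
    case BZ
    then show ?case using True by simp
  next
    case (BS b)
    show ?case
    proof (cases "A \<in> fderiv H b")
      case False
      then show ?thesis using BS by simp
    next
      case mem: True
      obtain k where k: "\<forall>a\<in>A. a < k" "insert k A \<in> fderiv Q b" using BS.prems(2) by auto
      have "dominated H Q (insert l A)" if "k \<le> l" for l
      proof -
        have "\<forall>a\<in>A. a < l" using k(1) that by fastforce
        then have "insert l A \<notin> fderiv H b" using BS.prems(1) mem by auto
        moreover have "insert l A \<in> fderiv Q b"
          using spreading_insert[OF spreading_fderiv[OF Q] k(2,1) that] .
        ultimately show ?thesis unfolding dominated_def by blast
      qed
      then show ?thesis by blast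
    qed
  qed auto
qed

lemma diagonal_subset:
  fixes P :: "nat \<Rightarrow> nat set \<Rightarrow> bool"
  assumes base: "\<And>i. P i {}"
    and step: "\<And>i A. finite A \<Longrightarrow> P i A \<Longrightarrow> \<exists>t. \<forall>k\<ge>t. P i (insert k A)"
    and M: "infinite M"
  shows "\<exists>N\<subseteq>M. infinite N \<and> (\<forall>i. \<exists>q. \<forall>A. finite A \<longrightarrow> A \<subseteq> N \<inter> {q..} \<longrightarrow> P i A)"
proof -
  define t where "t i A = (SOME t. \<forall>k\<ge>t. P i (insert k A))" for i A
  have t: "P i (insert k A)" if "finite A" "P i A" "t i A \<le> k" for i A k
    using someI_ex[OF step[OF that(1,2)]] that(3) unfolding t_def by blast
  \<comment> \<open>Only finitely many pairs of an index i \<le> n and a subset of {..n} occur, so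
    one threshold serves them all.\<close>
  define T where "T n = Max (insert 0 ((\<lambda>(i, A). t i A) ` ({..n} \<times> Pow {..n})))" for n
  have T: "t i A \<le> T n" if "i \<le> n" "A \<subseteq> {..n}" for i A n
    unfolding T_def using that by (intro Max_ge) (auto intro!: image_eqI[of _ _ "(i, A)"])
  have "\<exists>y. y \<in> M \<and> x < y \<and> T x \<le> y" for x
    using M finite_nat_set_iff_bounded_le[of M]
    by (metis linorder_not_le max.strict_boundedE order_less_imp_le)
  then obtain nx where nx: "\<And>x. nx x \<in> M" "\<And>x. x < nx x" "\<And>x. T x \<le> nx x" by metis
  define f where "f r = (nx ^^ Suc r) 0" for r
  have f: "f r \<in> M" "f r < f (Suc r)" "T (f r) \<le> f (Suc r)" for r
    unfolding f_def using nx by auto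
  have sm: "strict_mono f" using f(2) by (simp add: strict_mono_Suc_iff)
  \<comment> \<open>Points are added in increasing order. Adding \<open>f (Suc r)\<close> is
    governed by \<open>T (f r)\<close>, which covers condition i because i \<le> r \<le>
    \<open>f r\<close>; this is why condition i starts at \<open>f (Suc i)\<close>.\<close>
  have "P i A" if "finite A" "A \<subseteq> range f \<inter> {f (Suc i)..}" for i A
    using that
  proof (induction A rule: finite_linorder_max_induct)
    case empty
    then show ?case using base by simp
  next
    case (insert b A)
    then obtain s where s: "b = f s" "f (Suc i) \<le> f s" by auto
    then obtain r where r: "s = Suc r" "i \<le> r"
      using strict_mono_less_eq[OF sm] by (cases s) auto
    have "A \<subseteq> {..f r}"
    proof
      fix a assume a: "a \<in> A"
      then obtain s' where s': "a = f s'" using insert by auto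
      then have "f s' < f (Suc r)" using a insert.hyps(2) s r by auto
      then have "s' \<le> r" using strict_mono_less[OF sm] by (simp add: less_Suc_eq_le)
      then show "a \<in> {..f r}" using s' strict_mono_less_eq[OF sm] by auto
    qed
    moreover have "i \<le> f r" using r(2) strict_mono_imp_increasing[OF sm, of r] by simp
    ultimately have "t i A \<le> b" using T f(3) s r order_trans by blast
    then show ?case using t insert by auto
  qed
  moreover have "infinite (range f)" using sm strict_mono_imp_inj_on finite_imageD by blast
  moreover have "range f \<subseteq> M" using f(1) by blast
  ultimately show ?thesis by blast
qed

section \<open>Ranks of Schreier families\<close>

lemma spreading_schreier1: "spreading schreier1"
proof -
  have "\<phi> ` A \<in> schreier1"
    if A: "A \<in> schreier1" and \<phi>: "strict_mono_on A \<phi>" "\<forall>a\<in>A. a \<le> \<phi> a" for A \<phi>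
  proof (cases "A = {}")
    case False
    then have fin: "finite A" "card A \<le> Min A" using A by (auto simp: schreier1_def)
    have "Min A \<le> \<phi> a" if "a \<in> A" for a
      using \<phi>(2) that fin(1) Min_le order_trans by blast
    then have "Min A \<le> Min (\<phi> ` A)" using fin False by simp
    moreover have "card (\<phi> ` A) \<le> card A" using fin card_image_le by blast
    ultimately show ?thesis using fin by (auto simp: schreier1_def)
  qed (simp add: schreier1_def)
  then show ?thesis unfolding spreading_def by (auto simp: schreier1_def)
qed

text \<open>A nonempty set whose minimum exceeds its size by at least n survives n derivatives. The
  empty set survives n of them through the singleton of n + 1 or a shorter stage, hence it survives
  \<omega>.\<close>

lemma fderiv_schreier1: "{} \<in> fderiv schreier1 omega"
proof -
  have *: "A \<in> fderiv schreier1 (natord n)" if "finite A" "A \<noteq> {}" "card A + n \<le> Min A" for A n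
    using that
  proof (induction n arbitrary: A)
    case 0
    then show ?case by (simp add: schreier1_def)
  next
    case (Suc n)
    let ?k = "Suc (Max A)"
    have k: "\<forall>a\<in>A. a < ?k" using Suc by (auto simp: less_Suc_eq_le)
    have "Min (insert ?k A) = Min A"
      using Min_insert[of A ?k] Min_in[of A] Suc.prems(1,2) k min.absorb2 less_imp_le by metis
    moreover have "card (insert ?k A) = Suc (card A)" using Suc.prems k by (subst card_insert_disjoint) auto
    ultimately have "card (insert ?k A) + n \<le> Min (insert ?k A)" using Suc.prems(3) by linarith
    then have "insert ?k A \<in> fderiv schreier1 (natord n)"
      using Suc.IH[of "insert ?k A"] Suc.prems(1) by blast
    moreover have "A \<in> fderiv schreier1 (natord n)" using Suc.IH[of A] Suc.prems by linarith
    ultimately show ?case using k by auto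
  qed
  have "{} \<in> fderiv schreier1 (natord n)" for n
  proof (induction n)
    case (Suc n)
    have "{Suc n} \<in> fderiv schreier1 (natord n)" using *[of "{Suc n}" n] by simp
    then show ?case using Suc by auto
  qed (simp add: schreier1_def)
  then show ?thesis by (simp add: omega_def)
qed

text \<open>Schreier families enter through lower bounds on their rank, for which this inclusion is
  the one that matters: the pieces of a decomposition by minima are listed in increasing
  order.\<close>

lemma comp_subset_fam_comp:
  assumes "\<forall>G\<in>\<G>. finite G" "\<forall>C\<in>J. finite C"
  shows "family_comp J \<G> \<subseteq> fam_comp J \<G>"
proof
  fix A assume "A \<in> family_comp J \<G>"
  then obtain C where C: "finite A" "C \<in> J" "splits \<G> A C" unfolding family_comp_def by blast
  then have fin: "finite C" using assms(2) by blast
  let ?l = "sorted_list_of_set C"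
  let ?Fs = "map (\<lambda>c. A \<inter> seg C c) ?l"
  have CA: "C \<subseteq> A" using C(3) unfolding splits_def by blast
  have mem: "c \<in> A \<inter> seg C c" if "c \<in> C" for c using that CA by (auto simp: seg_def)
  have Min: "Min (A \<inter> seg C c) = c" if "c \<in> C" for c
    using mem[OF that] C(1) by (intro Min_eqI) (auto simp: seg_def)
  note cover = splits_cover[OF C(3) fin]
  have un: "A = \<Union> (set ?Fs)" using cover fin by auto
  have 1: "\<forall>G\<in>set ?Fs. G \<in> \<G> \<and> finite G \<and> G \<noteq> {}"
    using C(1,3) mem fin unfolding splits_def by fastforce
  have 2: "\<forall>i. Suc i < length ?Fs \<longrightarrow> Max (?Fs ! i) < Min (?Fs ! Suc i)"
  proof (intro allI impI)
    fix i assume i: "Suc i < length ?Fs"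
    have in_C: "?l ! i \<in> C" "?l ! Suc i \<in> C" using i fin nth_mem[of _ ?l] by simp_all
    have lt: "?l ! i < ?l ! Suc i"
      using i strict_sorted_list_of_set[of C] by (simp add: sorted_wrt_iff_nth_less)
    have "Max (A \<inter> seg C (?l ! i)) < ?l ! Suc i"
      using C(1) mem[OF in_C(1)] in_C lt by (subst Max_less_iff) (auto simp: seg_def)
    moreover have "?Fs ! i = A \<inter> seg C (?l ! i)" "?Fs ! Suc i = A \<inter> seg C (?l ! Suc i)"
      using i by simp_all
    ultimately show "Max (?Fs ! i) < Min (?Fs ! Suc i)"
      using Min[OF in_C(2)] by (simp only:)
  qed
  have "Min ` set ?Fs = (\<lambda>c. Min (A \<inter> seg C c)) ` C" using fin by (simp add: image_image)
  then have "Min ` set ?Fs = C" using Min by simp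
  then have 3: "Min ` set ?Fs \<in> J" using C(2) by simp
  show "A \<in> fam_comp J \<G>"
    unfolding fam_comp_def mem_Collect_eq by (intro exI[of _ ?Fs] conjI un 1 2 3)
qed

lemma schreier_zero:
  assumes "schreier_system S" "ord_eq b BZ"
  shows "S b = {F. finite F \<and> card F \<le> 1}"
proof -
  have "\<forall>b. ord_eq b BZ \<longrightarrow> S b = {F. finite F \<and> card F \<le> 1}"
    using assms(1) unfolding schreier_system_def by (elim conjE)
  then show ?thesis using assms(2) by simp
qed

lemma schreier_succ:
  assumes "schreier_system S" "ord_eq b (BS c)"
  shows "S b = fam_comp schreier1 (S c)"
proof -
  have "\<forall>b c. ord_eq b (BS c) \<longrightarrow> S b = fam_comp schreier1 (S c)"
    using assms(1) unfolding schreier_system_def by (elim conjE)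
  then show ?thesis using assms(2) by simp
qed

lemma schreier_limit:
  assumes "schreier_system S" "is_limit_ord b"
  shows "\<exists>bk. (\<forall>k. ord_lt (bk k) (bk (Suc k))) \<and> is_ord_sup bk b \<and>
    S b = {F. finite F \<and> (F = {} \<or> (\<exists>k\<le>Min F. F \<in> S (bk k)))}"
proof -
  have "\<forall>b. is_limit_ord b \<longrightarrow> (\<exists>bk. (\<forall>k. ord_lt (bk k) (bk (Suc k))) \<and> is_ord_sup bk b \<and>
    S b = {F. finite F \<and> (F = {} \<or> (\<exists>k\<le>Min F. F \<in> S (bk k)))})"
    using assms(1) unfolding schreier_system_def by (elim conjE)
  from this[rule_format, OF assms(2)] show ?thesis .
qed

text \<open>The lower bound is proved on every tail. Tails feed the composition at successors; at
  limits, discarding the points below k provides the condition k \<le> min A.\<close>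

lemma schreier_rank:
  assumes S: "schreier_system S"
  shows "(\<forall>A\<in>S b. finite A) \<and> (\<forall>p. {} \<in> fderiv (tail p (S b)) (oexp omega b))"
proof (induction b rule: ord_less_induct)
  case (1 b)
  consider "ord_eq b BZ" | c where "ord_eq b (BS c)" | "is_limit_ord b"
    unfolding is_limit_ord_def by blast
  then show ?case
  proof cases
    case 1
    then have "S b = {A. finite A \<and> card A \<le> 1}" by (rule schreier_zero[OF S])
    moreover have "ord_le (oexp omega b) (BS BZ)"
      using 1 oexp_mono[of b BZ] by (simp add: ord_eq_def)
    ultimately show ?thesis using fderiv_anti fderiv_singletons by auto
  next
    case (2 c)
    then have Sb: "S b = fam_comp schreier1 (S c)" by (rule schreier_succ[OF S])
    have lt: "ord_lt c b" using 2 ord_lt_BS_self ord_lt_le_trans unfolding ord_eq_def by blast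
    note IH = 1[OF lt]
    have sub: "family_comp schreier1 (S c) \<subseteq> S b"
      unfolding Sb using IH by (intro comp_subset_fam_comp) (auto simp: schreier1_def)
    have "{} \<in> fderiv (tail p (S b)) (oexp omega b)" for p
    proof -
      have "{} \<in> fderiv (tail p (family_comp schreier1 (S c))) (omul (oexp omega c) omega)"
        using IH by (intro fderiv_comp spreading_schreier1 fderiv_schreier1) auto
      moreover have "tail p (family_comp schreier1 (S c)) \<subseteq> tail p (S b)"
        using sub unfolding tail_def by blast
      ultimately have "{} \<in> fderiv (tail p (S b)) (oexp omega (BS c))"
        using fderiv_mono by (simp only: oexp.simps) blast
      then show ?thesis using 2 fderiv_anti oexp_mono unfolding ord_eq_def by blast
    qed
    moreover have "\<forall>A\<in>S b. finite A" unfolding Sb fam_comp_def by auto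
    ultimately show ?thesis by blast
  next
    case 3
    then obtain bk where bk: "\<forall>k. ord_lt (bk k) (bk (Suc k))" "is_ord_sup bk b"
      "S b = {F. finite F \<and> (F = {} \<or> (\<exists>k\<le>Min F. F \<in> S (bk k)))}"
      using schreier_limit[OF S] by blast
    have lt: "ord_lt (bk k) b" for k using bk(1,2) ord_lt_le_trans unfolding is_ord_sup_def by blast
    have le: "ord_le b (BL bk)"
    proof (rule ccontr)
      assume "\<not> ord_le b (BL bk)"
      then obtain n where "ord_lt (BL bk) (bk n)" using bk(2) unfolding is_ord_sup_def by auto
      then show False using ord_le_BL[of "bk n" bk n] ord_le_refl ord_lt_le_trans ord_lt_irrefl by blast
    qed
    have "{} \<in> fderiv (tail p (S b)) (oexp omega (bk k))" for p k
    proof -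
      have "tail (max k p) (S (bk k)) \<subseteq> tail p (S b)"
      proof
        fix A assume A: "A \<in> tail (max k p) (S (bk k))"
        then have "finite A" "A \<subseteq> {max k p..}" "A \<in> S (bk k)" using 1[OF lt] by (auto simp: tail_def)
        moreover from this have "A = {} \<or> k \<le> Min A" using Min_in[of A] by fastforce
        ultimately show "A \<in> tail p (S b)" unfolding bk(3) tail_def by auto
      qed
      then show ?thesis using 1[OF lt] fderiv_mono by blast
    qed
    then have "{} \<in> fderiv (tail p (S b)) (oexp omega (BL bk))" for p by simp
    then have "{} \<in> fderiv (tail p (S b)) (oexp omega b)" for p
      using fderiv_anti oexp_mono[OF le] by blast
    moreover have "\<forall>A\<in>S b. finite A" unfolding bk(3) by auto
    ultimately show ?thesis by blast
  qed
qed

section \<open>The Tsirelson norm on finitely supported vectors\<close>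

lemma restr_restr: "restr A (restr B x) = restr (A \<inter> B) x"
  by (auto simp: restr_def)

lemma restr_sum: "restr E (\<lambda>k. \<Sum>i\<in>I. a i * v i k) = (\<lambda>k. \<Sum>i\<in>I. a i * restr E (v i) k)"
  by (auto simp: restr_def)

lemma restr_id: "{k. x k \<noteq> 0} \<subseteq> E \<Longrightarrow> restr E x = x"
  by (rule ext) (auto simp: restr_def)

definition fsupp :: "(nat \<Rightarrow> real) \<Rightarrow> bool" where
  "fsupp x \<longleftrightarrow> finite {k. x k \<noteq> 0}"

lemma fsupp_restr [simp]: "fsupp x \<Longrightarrow> fsupp (restr E x)"
  unfolding fsupp_def by (rule finite_subset[of _ "{k. x k \<noteq> 0}"]) (auto simp: restr_def)

lemma fsupp_restr_finite [simp]: "finite E \<Longrightarrow> fsupp (restr E x)"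
  unfolding fsupp_def by (rule finite_subset[of _ E]) (auto simp: restr_def)

lemma fsupp_add [simp]: "fsupp x \<Longrightarrow> fsupp y \<Longrightarrow> fsupp (\<lambda>k. x k + y k)"
  unfolding fsupp_def
  by (rule finite_subset[of _ "{k. x k \<noteq> 0} \<union> {k. y k \<noteq> 0}"]) auto

lemma fsupp_scale [simp]: "fsupp x \<Longrightarrow> fsupp (\<lambda>k. c * x k)"
  unfolding fsupp_def by (rule finite_subset[of _ "{k. x k \<noteq> 0}"]) auto

lemma fsupp_zero [simp]: "fsupp (\<lambda>k. 0)"
  by (simp add: fsupp_def)

lemma fsupp_sum [simp]: "(\<And>i. i \<in> I \<Longrightarrow> fsupp (v i)) \<Longrightarrow> fsupp (\<lambda>k. \<Sum>i\<in>I. a i * v i k)"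
  by (induction I rule: infinite_finite_induct) auto

text \<open>The a priori bound behind all suprema of norms: \<open>Sup\<close> on the reals is
  informative only for bounded sets, so every iterate is first dominated by this quantity.\<close>

definition l1n :: "(nat \<Rightarrow> real) \<Rightarrow> real" where
  "l1n x = (\<Sum>k | x k \<noteq> 0. \<bar>x k\<bar>)"

lemma l1n_nonneg [simp]: "0 \<le> l1n x"
  by (simp add: l1n_def sum_nonneg)

lemma l1n_restr:
  assumes "fsupp x"
  shows "l1n (restr E x) = (\<Sum>k\<in>{k. x k \<noteq> 0} \<inter> E. \<bar>x k\<bar>)"
  unfolding l1n_def by (rule sum.cong) (auto simp: restr_def split: if_splits)

lemma abs_le_l1n: "fsupp x \<Longrightarrow> \<bar>x k\<bar> \<le> l1n x"
proof (cases "x k = 0")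
  case False
  assume "fsupp x"
  then show ?thesis
    unfolding l1n_def fsupp_def using False by (intro member_le_sum) auto
qed simp

lemma supnorm_le: "(\<And>k. \<bar>x k\<bar> \<le> b) \<Longrightarrow> supnorm x \<le> b"
  unfolding supnorm_def by (rule cSup_least) auto

lemma abs_le_supnorm: "fsupp x \<Longrightarrow> \<bar>x k\<bar> \<le> supnorm x"
  unfolding supnorm_def by (rule cSup_upper) (auto intro!: bdd_aboveI2 abs_le_l1n)

lemma seg_disjoint: "a \<in> A \<Longrightarrow> b \<in> A \<Longrightarrow> a \<noteq> b \<Longrightarrow> seg A a \<inter> seg A b = {}"
  by (cases a b rule: linorder_cases) (auto simp: seg_def)

lemma seg_sum_le:
  fixes g :: "nat \<Rightarrow> real"
  assumes "finite A" "finite S" "\<And>k. 0 \<le> g k"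
  shows "(\<Sum>a\<in>A. \<Sum>k\<in>S \<inter> seg A a. g k) \<le> (\<Sum>k\<in>S. g k)"
proof -
  have "(\<Sum>a\<in>A. \<Sum>k\<in>S \<inter> seg A a. g k) = (\<Sum>k\<in>(\<Union>a\<in>A. S \<inter> seg A a). g k)"
    by (rule sum.UNION_disjoint[symmetric]) (use assms seg_disjoint in \<open>auto, blast\<close>)
  also have "\<dots> \<le> (\<Sum>k\<in>S. g k)" using assms by (intro sum_mono2) auto
  finally show ?thesis .
qed

lemma admissible_less:
  assumes "admissible H Es" "i < j" "j < length Es" "a \<in> Es ! i" "b \<in> Es ! j"
  shows "a < b"
  using assms(2-)
proof (induction j arbitrary: b)
  case (Suc j)
  have Es: "finite (Es ! n)" "Es ! n \<noteq> {}" if "n < length Es" for n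
    using assms(1) that unfolding admissible_def by (auto dest: nth_mem)
  have "Max (Es ! j) < Min (Es ! Suc j)"
    using assms(1) Suc.prems(2) unfolding admissible_def by blast
  also have "\<dots> \<le> b" using Es Suc.prems by simp
  finally have *: "Max (Es ! j) < b" .
  have "a \<le> Max (Es ! j)"
  proof (cases "i = j")
    case True
    then show ?thesis using Es[of j] Suc.prems by simp
  next
    case False
    then have "a < Max (Es ! j)" using Suc.IH[of "Max (Es ! j)"] Es[of j] Suc.prems by simp
    then show ?thesis by simp
  qed
  then show ?case using * by simp
qed simp

text \<open>An admissible list is traded for the set A of its minima, each member lying inside its
  segment. Sums over lists become sums over a finite set of integers.\<close>

lemma admissible_seg:
  assumes adm: "admissible H Es"
  obtains A e where "A \<in> H" "finite A" "\<forall>a\<in>A. e a \<subseteq> seg A a"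
    "\<forall>f :: nat set \<Rightarrow> real. (\<Sum>E\<leftarrow>Es. f E) = (\<Sum>a\<in>A. f (e a))"
proof -
  define A where "A = Min ` set Es"
  have Es: "finite E" "E \<noteq> {}" if "E \<in> set Es" for E
    using adm that unfolding admissible_def by auto
  have less: "Min (Es ! i) < Min (Es ! j)" if "i < j" "j < length Es" for i j
    using admissible_less[OF adm that] Es[of "Es ! i"] Es[of "Es ! j"] that by simp
  have inj: "inj_on Min (set Es)"
  proof (rule inj_onI)
    fix D E assume "D \<in> set Es" "E \<in> set Es" "Min D = Min E"
    then obtain i j where "i < length Es" "j < length Es" "D = Es ! i" "E = Es ! j"
      by (auto simp: in_set_conv_nth)
    then show "D = E" using less[of i j] less[of j i] \<open>Min D = Min E\<close>
      by (cases i j rule: linorder_cases) auto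
  qed
  have dist: "distinct Es"
    unfolding distinct_conv_nth
  proof (intro allI impI)
    fix i j assume "i < length Es" "j < length Es" "i \<noteq> j"
    then show "Es ! i \<noteq> Es ! j" using less[of i j] less[of j i]
      by (cases i j rule: linorder_cases) auto
  qed
  let ?e = "the_inv_into (set Es) Min"
  have sub: "?e a \<subseteq> seg A a" if a: "a \<in> A" for a
  proof -
    obtain E where E: "E \<in> set Es" "a = Min E" using a unfolding A_def by blast
    then obtain i where i: "i < length Es" "E = Es ! i" by (auto simp: in_set_conv_nth)
    have "k < b" if k: "k \<in> E" and b: "b \<in> A" "a < b" for k b
    proof -
      obtain D where D: "D \<in> set Es" "b = Min D" using b unfolding A_def by blast
      then obtain j where j: "j < length Es" "D = Es ! j" by (auto simp: in_set_conv_nth)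
      have "i < j" using less[of j i] i j E(2) D(2) b(2) by (cases i j rule: linorder_cases) auto
      then show ?thesis using admissible_less[OF adm _ j(1), of i k b] i j k D Es[OF D(1)] by simp
    qed
    then have "E \<subseteq> seg A a" using E Es[OF E(1)] unfolding seg_def by auto
    then show ?thesis using E inj by (simp add: the_inv_into_f_f)
  qed
  have "(\<Sum>E\<leftarrow>Es. f E) = (\<Sum>a\<in>A. f (?e a))" for f :: "nat set \<Rightarrow> real"
    unfolding A_def sum.reindex[OF inj] using dist inj
    by (simp add: sum_list_distinct_conv_sum_set the_inv_into_f_f)
  moreover have "A \<in> H" using adm unfolding A_def admissible_def by blast
  moreover have "finite A" by (simp add: A_def)
  ultimately show ?thesis using that[of A ?e] sub by blast
qed

text \<open>The segment after the last point of A is infinite while members of admissible sequences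
  are finite, hence the cut at n.\<close>

lemma seg_admissible:
  assumes "A \<in> H" "finite A" "\<forall>a\<in>A. a < n"
  obtains Es where "admissible H Es"
    "\<forall>f :: nat set \<Rightarrow> real. (\<Sum>E\<leftarrow>Es. f E) = (\<Sum>a\<in>A. f (seg A a \<inter> {..<n}))"
proof -
  let ?l = "sorted_list_of_set A"
  let ?Es = "map (\<lambda>a. seg A a \<inter> {..<n}) ?l"
  have mem: "a \<in> seg A a \<inter> {..<n}" if "a \<in> A" for a using that assms(3) by (simp add: seg_def)
  have Min: "Min (seg A a \<inter> {..<n}) = a" if "a \<in> A" for a
    using mem[OF that] by (intro Min_eqI) (auto simp: seg_def)
  have "Min ` set ?Es = (\<lambda>a. Min (seg A a \<inter> {..<n})) ` A"
    using assms(2) by (simp add: image_image)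
  then have 3: "Min ` set ?Es \<in> H" using Min assms(1) by simp
  have 1: "\<forall>E\<in>set ?Es. finite E \<and> E \<noteq> {}" using mem assms(2) by fastforce
  have 2: "\<forall>i. Suc i < length ?Es \<longrightarrow> Max (?Es ! i) < Min (?Es ! Suc i)"
  proof (intro allI impI)
    fix i assume i: "Suc i < length ?Es"
    have in_A: "?l ! i \<in> A" "?l ! Suc i \<in> A" using i assms(2) nth_mem[of _ ?l] by simp_all
    have lt: "?l ! i < ?l ! Suc i"
      using i strict_sorted_list_of_set[of A] by (simp add: sorted_wrt_iff_nth_less)
    have "Max (seg A (?l ! i) \<inter> {..<n}) < ?l ! Suc i"
      using mem[OF in_A(1)] in_A lt by (subst Max_less_iff) (auto simp: seg_def)
    moreover have "?Es ! i = seg A (?l ! i) \<inter> {..<n}" "?Es ! Suc i = seg A (?l ! Suc i) \<inter> {..<n}"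
      using i by simp_all
    ultimately show "Max (?Es ! i) < Min (?Es ! Suc i)"
      using Min[OF in_A(2)] by (simp only:)
  qed
  have "admissible H ?Es" unfolding admissible_def using 1 2 3 by blast
  moreover have "(\<Sum>E\<leftarrow>?Es. f E) = (\<Sum>a\<in>A. f (seg A a \<inter> {..<n}))" for f :: "nat set \<Rightarrow> real"
    using assms(2) by (simp add: sum_list_distinct_conv_sum_set o_def)
  ultimately show ?thesis using that by blast
qed

section \<open>The implicit equation of the norm\<close>

locale mixed_tsirelson =
  fixes \<theta> :: "nat \<Rightarrow> real" and F :: "nat \<Rightarrow> nat set set"
  assumes theta_pos: "0 < \<theta> n" and theta_lt1: "\<theta> n < 1" and theta_decseq: "decseq \<theta>"
    and spread: "spreading (F n)" and hered: "hereditary (F n)" and empty_in: "{} \<in> F n"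
begin

abbreviation it where "it \<equiv> tnorm_it \<theta> F"
abbreviation T where "T \<equiv> tnorm \<theta> F"

definition itset where
  "itset j x = {\<theta> n * (\<Sum>E\<leftarrow>Es. it j (restr E x)) | n Es. admissible (F n) Es}"

lemma finite_F: "A \<in> F n \<Longrightarrow> finite A"
  using spread unfolding spreading_def by blast

lemma it_Suc: "it (Suc j) x = max (supnorm x) (Sup (itset j x))"
  by (simp add: itset_def)

declare tnorm_it.simps(2) [simp del]

lemma itsetI: "admissible (F n) Es \<Longrightarrow> \<theta> n * (\<Sum>E\<leftarrow>Es. it j (restr E x)) \<in> itset j x"
  unfolding itset_def by blast

lemma itsetE:
  assumes "s \<in> itset j x"
  obtains n Es where "admissible (F n) Es" "s = \<theta> n * (\<Sum>E\<leftarrow>Es. it j (restr E x))"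
  using assms unfolding itset_def by blast

lemma itset_nonempty: "itset j x \<noteq> {}"
  using itsetI[of 0 "[]" j x] empty_in by (auto simp: admissible_def)

text \<open>Nonnegativity and the upper bound are proved together: replacing the weight by 1 in an
  admissible sum requires the sum to be nonnegative.\<close>

lemma it_bound: "fsupp x \<Longrightarrow> 0 \<le> it j x \<and> it j x \<le> l1n x"
  and itset_bound: "fsupp x \<Longrightarrow> s \<in> itset j x \<Longrightarrow> s \<le> l1n x"
proof -
  have set: "s \<le> l1n x"
    if IH: "\<And>x. fsupp x \<Longrightarrow> 0 \<le> it j x \<and> it j x \<le> l1n x" and x: "fsupp x" and s: "s \<in> itset j x"
    for j x s
  proof -
    obtain n Es where Es: "admissible (F n) Es" "s = \<theta> n * (\<Sum>E\<leftarrow>Es. it j (restr E x))"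
      using s by (rule itsetE)
    obtain A e where "A \<in> F n" and A: "finite A" "\<forall>a\<in>A. e a \<subseteq> seg A a"
      and f: "\<forall>f :: nat set \<Rightarrow> real. (\<Sum>E\<leftarrow>Es. f E) = (\<Sum>a\<in>A. f (e a))"
      using Es(1) by (rule admissible_seg)
    have fin: "finite {k. x k \<noteq> 0}" using x by (simp add: fsupp_def)
    have nn: "0 \<le> (\<Sum>a\<in>A. it j (restr (e a) x))" using IH x by (intro sum_nonneg) simp
    have "s \<le> 1 * (\<Sum>a\<in>A. it j (restr (e a) x))"
      unfolding Es spec[OF f] using theta_lt1[of n] nn by (intro mult_right_mono) auto
    also have "\<dots> \<le> (\<Sum>a\<in>A. \<Sum>k\<in>{k. x k \<noteq> 0} \<inter> seg A a. \<bar>x k\<bar>)"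
      unfolding mult_1
    proof (rule sum_mono)
      fix a assume a: "a \<in> A"
      have "it j (restr (e a) x) \<le> l1n (restr (e a) x)" using IH x by simp
      also have "\<dots> \<le> (\<Sum>k\<in>{k. x k \<noteq> 0} \<inter> seg A a. \<bar>x k\<bar>)"
        unfolding l1n_restr[OF x] using bspec[OF A(2) a] fin by (intro sum_mono2) auto
      finally show "it j (restr (e a) x) \<le> (\<Sum>k\<in>{k. x k \<noteq> 0} \<inter> seg A a. \<bar>x k\<bar>)" .
    qed
    also have "\<dots> \<le> l1n x" unfolding l1n_def using A(1) fin by (intro seg_sum_le) auto
    finally show ?thesis .
  qed
  show main: "0 \<le> it j x \<and> it j x \<le> l1n x" if "fsupp x" for j x
    using that
  proof (induction j arbitrary: x)
    case 0
    have "0 \<le> \<bar>x 0\<bar>" by simp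
    also have "\<dots> \<le> supnorm x" using abs_le_supnorm 0 by blast
    finally show ?case using supnorm_le[of x "l1n x"] abs_le_l1n 0 by simp
  next
    case (Suc j)
    have "supnorm x \<le> l1n x" by (rule supnorm_le) (rule abs_le_l1n[OF Suc.prems])
    moreover have "0 \<le> supnorm x" using abs_le_supnorm[OF Suc.prems, of 0] by simp
    moreover have "Sup (itset j x) \<le> l1n x"
      by (rule cSup_least[OF itset_nonempty]) (rule set[OF Suc.IH Suc.prems])
    ultimately show ?case by (simp add: it_Suc)
  qed
  show "s \<le> l1n x" if "fsupp x" "s \<in> itset j x" for j x s
    using set main that by blast
qed

lemma it_nonneg: "fsupp x \<Longrightarrow> 0 \<le> it j x"
  and it_le_l1n: "fsupp x \<Longrightarrow> it j x \<le> l1n x"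
  using it_bound by blast+

lemma supnorm_le_it: "supnorm x \<le> it j x"
  by (cases j) (auto simp: it_Suc)

lemma itset_le: "fsupp x \<Longrightarrow> s \<in> itset j x \<Longrightarrow> s \<le> it (Suc j) x"
proof -
  assume "fsupp x" "s \<in> itset j x"
  then have "s \<le> Sup (itset j x)" using itset_bound by (intro cSup_upper bdd_aboveI)
  then show ?thesis by (simp add: it_Suc)
qed

lemma it_Suc_leI:
  assumes "supnorm x \<le> b" "\<And>s. s \<in> itset j x \<Longrightarrow> s \<le> b"
  shows "it (Suc j) x \<le> b"
proof -
  have "Sup (itset j x) \<le> b" by (rule cSup_least[OF itset_nonempty assms(2)])
  then show ?thesis using assms(1) by (simp add: it_Suc)
qed

lemma it_restr_le: "fsupp x \<Longrightarrow> it j (restr E x) \<le> it j x"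
proof (induction j arbitrary: x)
  case 0
  have "\<bar>restr E x k\<bar> \<le> supnorm x" for k
    using abs_le_supnorm[OF 0, of k] abs_ge_zero[of "x k"] by (auto simp: restr_def simp del: abs_ge_zero)
  then show ?case using supnorm_le by simp
next
  case (Suc j)
  show ?case
  proof (rule it_Suc_leI)
    have "\<bar>restr E x k\<bar> \<le> supnorm x" for k
      using abs_le_supnorm[OF Suc.prems, of k] abs_ge_zero[of "x k"] by (auto simp: restr_def simp del: abs_ge_zero)
    then show "supnorm (restr E x) \<le> it (Suc j) x"
      using supnorm_le supnorm_le_it order_trans by blast
    fix s assume "s \<in> itset j (restr E x)"
    then obtain n Es where Es: "admissible (F n) Es" "s = \<theta> n * (\<Sum>D\<leftarrow>Es. it j (restr D (restr E x)))"
      by (rule itsetE)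
    have "it j (restr D (restr E x)) \<le> it j (restr D x)" for D
      using Suc.IH[of "restr D x"] Suc.prems by (simp add: restr_restr Int_commute)
    then have "s \<le> \<theta> n * (\<Sum>D\<leftarrow>Es. it j (restr D x))"
      unfolding Es(2) using theta_pos[of n] by (intro mult_left_mono sum_list_mono) auto
    also have "\<dots> \<le> it (Suc j) x" by (rule itset_le[OF Suc.prems itsetI[OF Es(1)]])
    finally show "s \<le> it (Suc j) x" .
  qed
qed

text \<open>Enlarging the members of an admissible sequence to full segments can only increase the
  sum, so it suffices to test the sums indexed by sets A in \<open>F n\<close>.\<close>

lemma it_upper:
  assumes x: "fsupp x" and sup: "supnorm x \<le> b"
    and A: "\<And>n A. A \<in> F n \<Longrightarrow> \<theta> n * (\<Sum>a\<in>A. it j (restr (seg A a) x)) \<le> b"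
  shows "it (Suc j) x \<le> b"
proof (rule it_Suc_leI[OF sup])
  fix s assume "s \<in> itset j x"
  then obtain n Es where Es: "admissible (F n) Es" "s = \<theta> n * (\<Sum>E\<leftarrow>Es. it j (restr E x))"
    by (rule itsetE)
  obtain A e where Ae: "A \<in> F n" "finite A" "\<forall>a\<in>A. e a \<subseteq> seg A a"
    and f: "\<forall>f :: nat set \<Rightarrow> real. (\<Sum>E\<leftarrow>Es. f E) = (\<Sum>a\<in>A. f (e a))"
    using Es(1) by (rule admissible_seg)
  have "it j (restr (e a) x) \<le> it j (restr (seg A a) x)" if "a \<in> A" for a
    using it_restr_le[of "restr (seg A a) x" j "e a"] x bspec[OF Ae(3) that]
    by (simp add: restr_restr Int_absorb2)
  then have "s \<le> \<theta> n * (\<Sum>a\<in>A. it j (restr (seg A a) x))"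
    unfolding Es(2) spec[OF f] using theta_pos[of n] by (intro mult_left_mono sum_mono) auto
  then show "s \<le> b" using A[OF Ae(1)] by linarith
qed

lemma it_lower:
  assumes x: "fsupp x" and A: "A \<in> F n"
  shows "\<theta> n * (\<Sum>a\<in>A. it j (restr (seg A a) x)) \<le> it (Suc j) x"
proof -
  have "finite ({k. x k \<noteq> 0} \<union> A)" using x finite_F[OF A] by (simp add: fsupp_def)
  then obtain N where N: "\<forall>k\<in>{k. x k \<noteq> 0} \<union> A. k < N" unfolding finite_nat_set_iff_bounded by blast
  obtain Es where Es: "admissible (F n) Es"
    "\<forall>f :: nat set \<Rightarrow> real. (\<Sum>E\<leftarrow>Es. f E) = (\<Sum>a\<in>A. f (seg A a \<inter> {..<N}))"
    by (rule seg_admissible[OF A finite_F[OF A], of N]) (use N in auto)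
  have "restr (seg A a \<inter> {..<N}) x = restr (seg A a) x" for a
    using N by (intro ext) (auto simp: restr_def)
  then have "\<theta> n * (\<Sum>a\<in>A. it j (restr (seg A a) x)) = \<theta> n * (\<Sum>E\<leftarrow>Es. it j (restr E x))"
    unfolding spec[OF Es(2)] by simp
  also have "\<dots> \<le> it (Suc j) x" by (rule itset_le[OF x itsetI[OF Es(1)]])
  finally show ?thesis .
qed

lemma it_Suc_ge: "fsupp x \<Longrightarrow> it j x \<le> it (Suc j) x"
proof (induction j arbitrary: x)
  case (Suc j)
  show ?case
  proof (rule it_upper[OF Suc.prems])
    show "supnorm x \<le> it (Suc (Suc j)) x" by (simp add: it_Suc)
    fix n A assume A: "A \<in> F n"
    have "\<theta> n * (\<Sum>a\<in>A. it j (restr (seg A a) x)) \<le> \<theta> n * (\<Sum>a\<in>A. it (Suc j) (restr (seg A a) x))"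
      using Suc theta_pos[of n] by (intro mult_left_mono sum_mono) auto
    also have "\<dots> \<le> it (Suc (Suc j)) x" by (rule it_lower[OF Suc.prems A])
    finally show "\<theta> n * (\<Sum>a\<in>A. it j (restr (seg A a) x)) \<le> it (Suc (Suc j)) x" .
  qed
qed (simp add: it_Suc)

lemma it_le_T: "fsupp x \<Longrightarrow> it j x \<le> T x"
  unfolding tnorm_def by (rule cSup_upper) (auto intro!: bdd_aboveI2 it_le_l1n)

lemma T_leI: "(\<And>j. it j x \<le> b) \<Longrightarrow> T x \<le> b"
  unfolding tnorm_def by (rule cSup_least) auto

lemma it_tendsto_T: "fsupp x \<Longrightarrow> (\<lambda>j. it j x) \<longlonglongrightarrow> T x"
  unfolding tnorm_def
  by (rule LIMSEQ_incseq_SUP) (auto intro!: bdd_aboveI2 it_le_l1n incseq_SucI it_Suc_ge)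

lemma T_nonneg: "fsupp x \<Longrightarrow> 0 \<le> T x"
  using it_le_T it_nonneg order_trans by blast

lemma T_le_l1n: "fsupp x \<Longrightarrow> T x \<le> l1n x"
  using T_leI it_le_l1n by blast

lemma abs_le_T: "fsupp x \<Longrightarrow> \<bar>x k\<bar> \<le> T x"
  using abs_le_supnorm it_le_T[of x 0] order_trans by fastforce

lemma T_restr_le: "fsupp x \<Longrightarrow> T (restr E x) \<le> T x"
  using T_leI it_restr_le it_le_T order_trans by blast

lemma T_restr_mono: "fsupp x \<Longrightarrow> D \<inter> {k. x k \<noteq> 0} \<subseteq> E \<Longrightarrow> T (restr D x) \<le> T (restr E x)"
proof -
  assume x: "fsupp x" and sub: "D \<inter> {k. x k \<noteq> 0} \<subseteq> E"
  have "restr D x = restr D (restr E x)" using sub by (intro ext) (auto simp: restr_def)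
  then show ?thesis using T_restr_le[of "restr E x" D] x by simp
qed

text \<open>With A in \<open>F n\<close>, the numbers \<open>\<theta> n * nu A x\<close> are the
  weighted sums of the implicit equation over full segments; \<open>T_upper\<close> and
  \<open>T_lower\<close> are the two halves of that equation.\<close>

definition nu :: "nat set \<Rightarrow> (nat \<Rightarrow> real) \<Rightarrow> real" where
  "nu A x = (\<Sum>a\<in>A. T (restr (seg A a) x))"

lemma nu_nonneg: "fsupp x \<Longrightarrow> 0 \<le> nu A x"
  unfolding nu_def by (intro sum_nonneg T_nonneg) simp

lemma T_upper:
  assumes x: "fsupp x" and sup: "supnorm x \<le> b" and A: "\<And>n A. A \<in> F n \<Longrightarrow> \<theta> n * nu A x \<le> b"
  shows "T x \<le> b"
proof (rule T_leI)
  fix j show "it j x \<le> b"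
  proof (cases j)
    case 0
    then show ?thesis using sup by simp
  next
    case (Suc i)
    have "it (Suc i) x \<le> b"
    proof (rule it_upper[OF x sup])
      fix n A assume "A \<in> F n"
      have "\<theta> n * (\<Sum>a\<in>A. it i (restr (seg A a) x)) \<le> \<theta> n * nu A x"
        unfolding nu_def using theta_pos[of n] x by (intro mult_left_mono sum_mono it_le_T) auto
      then show "\<theta> n * (\<Sum>a\<in>A. it i (restr (seg A a) x)) \<le> b" using A[OF \<open>A \<in> F n\<close>] by linarith
    qed
    then show ?thesis using Suc by blast
  qed
qed

lemma T_lower:
  assumes x: "fsupp x" and A: "A \<in> F n"
  shows "\<theta> n * nu A x \<le> T x"
proof (rule LIMSEQ_le_const2)
  show "(\<lambda>j. \<theta> n * (\<Sum>a\<in>A. it j (restr (seg A a) x))) \<longlonglongrightarrow> \<theta> n * nu A x"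
    unfolding nu_def using x by (intro tendsto_mult_left tendsto_sum it_tendsto_T) simp
  show "\<exists>N. \<forall>j\<ge>N. \<theta> n * (\<Sum>a\<in>A. it j (restr (seg A a) x)) \<le> T x"
    using it_lower[OF x A] it_le_T[OF x] order_trans by blast
qed

lemma T_add_le:
  assumes "fsupp x" "fsupp y"
  shows "T (\<lambda>k. x k + y k) \<le> T x + T y"
proof (rule T_leI)
  \<comment> \<open>The iterate on the left is compared with the full norms on the right, so that
    \<open>T_lower\<close> closes the induction step.\<close>
  have it: "it j (\<lambda>k. x k + y k) \<le> T x + T y" if "fsupp x" "fsupp y" for j x y
    using that
  proof (induction j arbitrary: x y)
    case 0
    have "\<bar>x k + y k\<bar> \<le> T x + T y" for k
      using abs_le_T[OF 0(1), of k] abs_le_T[OF 0(2), of k] by linarith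
    then show ?case using supnorm_le by simp
  next
    case (Suc j)
    show ?case
    proof (rule it_upper)
      have "\<bar>x k + y k\<bar> \<le> T x + T y" for k
        using abs_le_T[OF Suc.prems(1), of k] abs_le_T[OF Suc.prems(2), of k] by linarith
      then show "supnorm (\<lambda>k. x k + y k) \<le> T x + T y" by (rule supnorm_le)
      fix n A assume A: "A \<in> F n"
      have r: "restr E (\<lambda>k. x k + y k) = (\<lambda>k. restr E x k + restr E y k)" for E
        by (auto simp: restr_def)
      have "\<theta> n * (\<Sum>a\<in>A. it j (restr (seg A a) (\<lambda>k. x k + y k))) \<le> \<theta> n * (nu A x + nu A y)"
        unfolding nu_def r sum.distrib[symmetric] using theta_pos[of n] Suc
        by (intro mult_left_mono sum_mono) auto
      also have "\<dots> \<le> T x + T y"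
        using T_lower[OF Suc.prems(1) A] T_lower[OF Suc.prems(2) A] by (simp add: distrib_left)
      finally show "\<theta> n * (\<Sum>a\<in>A. it j (restr (seg A a) (\<lambda>k. x k + y k))) \<le> T x + T y" .
    qed (use Suc.prems in simp)
  qed
  show "it j (\<lambda>k. x k + y k) \<le> T x + T y" for j using it assms by blast
qed

lemma T_scale_le:
  assumes "fsupp x"
  shows "T (\<lambda>k. c * x k) \<le> \<bar>c\<bar> * T x"
proof (rule T_leI)
  have it: "it j (\<lambda>k. c * x k) \<le> \<bar>c\<bar> * T x" if "fsupp x" for j x
    using that
  proof (induction j arbitrary: x)
    case 0
    have "\<bar>c * x k\<bar> \<le> \<bar>c\<bar> * T x" for k
      unfolding abs_mult using abs_le_T[OF 0, of k] by (intro mult_left_mono) auto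
    then show ?case using supnorm_le by simp
  next
    case (Suc j)
    show ?case
    proof (rule it_upper)
      have "\<bar>c * x k\<bar> \<le> \<bar>c\<bar> * T x" for k
        unfolding abs_mult using abs_le_T[OF Suc.prems, of k] by (intro mult_left_mono) auto
      then show "supnorm (\<lambda>k. c * x k) \<le> \<bar>c\<bar> * T x" by (rule supnorm_le)
      fix n A assume A: "A \<in> F n"
      have r: "restr E (\<lambda>k. c * x k) = (\<lambda>k. c * restr E x k)" for E
        by (auto simp: restr_def)
      have "\<theta> n * (\<Sum>a\<in>A. it j (restr (seg A a) (\<lambda>k. c * x k))) \<le> \<theta> n * (\<bar>c\<bar> * nu A x)"
        unfolding nu_def r sum_distrib_left[of "\<bar>c\<bar>"] using theta_pos[of n] Suc
        by (intro mult_left_mono sum_mono) auto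
      also have "\<dots> = \<bar>c\<bar> * (\<theta> n * nu A x)" by simp
      also have "\<dots> \<le> \<bar>c\<bar> * T x" using T_lower[OF Suc.prems A] by (intro mult_left_mono) auto
      finally show "\<theta> n * (\<Sum>a\<in>A. it j (restr (seg A a) (\<lambda>k. c * x k))) \<le> \<bar>c\<bar> * T x" .
    qed (use Suc.prems in simp)
  qed
  show "it j (\<lambda>k. c * x k) \<le> \<bar>c\<bar> * T x" for j using it assms by blast
qed

lemma T_zero [simp]: "T (\<lambda>k. 0) = 0"
  using T_le_l1n[of "\<lambda>k. 0"] T_nonneg[of "\<lambda>k. 0"] by (simp add: l1n_def)

lemma T_sum_le:
  assumes "\<And>i. i \<in> I \<Longrightarrow> fsupp (v i)"
  shows "T (\<lambda>k. \<Sum>i\<in>I. a i * v i k) \<le> (\<Sum>i\<in>I. \<bar>a i\<bar> * T (v i))"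
  using assms
proof (induction I rule: infinite_finite_induct)
  case (insert i I)
  have "T (\<lambda>k. a i * v i k + (\<Sum>i\<in>I. a i * v i k)) \<le> T (\<lambda>k. a i * v i k) + T (\<lambda>k. \<Sum>i\<in>I. a i * v i k)"
    using insert by (intro T_add_le) auto
  also have "\<dots> \<le> \<bar>a i\<bar> * T (v i) + (\<Sum>i\<in>I. \<bar>a i\<bar> * T (v i))"
    using insert by (intro add_mono T_scale_le) auto
  finally show ?case using insert by simp
qed auto

lemma nu_sum_le:
  assumes "\<And>i. i \<in> I \<Longrightarrow> fsupp (v i)"
  shows "nu A (\<lambda>k. \<Sum>i\<in>I. a i * v i k) \<le> (\<Sum>i\<in>I. \<bar>a i\<bar> * nu A (v i))"
proof -
  have "nu A (\<lambda>k. \<Sum>i\<in>I. a i * v i k) \<le> (\<Sum>b\<in>A. \<Sum>i\<in>I. \<bar>a i\<bar> * T (restr (seg A b) (v i)))"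
    unfolding nu_def restr_sum using assms by (intro sum_mono T_sum_le) simp
  also have "\<dots> = (\<Sum>i\<in>I. \<bar>a i\<bar> * nu A (v i))"
    unfolding nu_def by (subst sum.swap) (simp add: sum_distrib_left)
  finally show ?thesis .
qed

lemma nu_add_le:
  assumes "fsupp x" "fsupp y"
  shows "nu A (\<lambda>k. x k + y k) \<le> nu A x + nu A y"
proof -
  have "restr E (\<lambda>k. x k + y k) = (\<lambda>k. restr E x k + restr E y k)" for E
    by (auto simp: restr_def)
  then show ?thesis
    unfolding nu_def sum.distrib[symmetric] using assms by (intro sum_mono) (simp add: T_add_le)
qed

lemma nu_le_l1n:
  assumes "finite A" "fsupp x"
  shows "nu A x \<le> l1n x"
proof -
  have "nu A x \<le> (\<Sum>a\<in>A. \<Sum>k\<in>{k. x k \<noteq> 0} \<inter> seg A a. \<bar>x k\<bar>)"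
    unfolding nu_def l1n_restr[OF assms(2), symmetric] using assms by (intro sum_mono T_le_l1n) simp
  also have "\<dots> \<le> l1n x"
    unfolding l1n_def using assms by (intro seg_sum_le) (auto simp: fsupp_def)
  finally show ?thesis .
qed

end

section \<open>Averages of block sequences\<close>

lemma seg_refine:
  assumes "C \<subseteq> A" "a \<in> A" "a \<in> seg C c"
  shows "seg A a \<subseteq> seg (A \<inter> seg C c) a \<inter> seg C c"
  using assms unfolding seg_def by (auto intro: order_trans less_le_trans)

lemma sum_zero_except:
  fixes f :: "'a \<Rightarrow> real"
  assumes "finite V" "k \<in> V" "\<And>i. i \<in> V \<Longrightarrow> i \<noteq> k \<Longrightarrow> f i = 0"
  shows "sum f V = f k"
  using assms by (simp add: sum.remove[of V k])

context mixed_tsirelson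
begin

lemma nu_refine:
  assumes "C \<subseteq> A" "finite A" "fsupp x"
  shows "(\<Sum>a\<in>A \<inter> seg C c. T (restr (seg A a) x)) \<le> nu (A \<inter> seg C c) (restr (seg C c) x)"
  unfolding nu_def restr_restr
proof (rule sum_mono)
  fix a assume "a \<in> A \<inter> seg C c"
  then show "T (restr (seg A a) x) \<le> T (restr (seg (A \<inter> seg C c) a \<inter> seg C c) x)"
    using seg_refine[OF assms(1)] assms(3) by (intro T_restr_mono) blast+
qed

text \<open>\<open>T_lower\<close> is iterated along the composition, which thus acts like a single
  family whose weight is the product of the weights.\<close>

lemma nu_fam_le:
  assumes "fsupp x" "A \<in> fam F ns"
  shows "prod_list (map \<theta> ns) * nu A x \<le> T x"
  using assms
proof (induction ns arbitrary: A x)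
  case Nil
  show ?case
  proof (cases "A = {}")
    case True
    then show ?thesis using T_nonneg[OF Nil(1)] by (simp add: nu_def)
  next
    case False
    then have "card A = 1" using Nil by (auto simp: le_Suc_eq)
    then obtain a where "A = {a}" by (auto simp: card_1_singleton_iff)
    then show ?thesis using T_restr_le[OF Nil(1)] by (simp add: nu_def)
  qed
next
  case (Cons n ns)
  let ?p = "prod_list (map \<theta> ns)"
  obtain C where C: "finite A" "C \<in> F n" "splits (fam F ns) A C"
    using Cons.prems(2) unfolding fam.simps family_comp_def by blast
  have p: "0 \<le> ?p" using theta_pos by (induction ns) (auto intro: mult_nonneg_nonneg less_imp_le)
  have CA: "C \<subseteq> A" using C(3) unfolding splits_def by blast
  have finC: "finite C" using finite_F[OF C(2)] .
  have "A = (\<Union>c\<in>C. A \<inter> seg C c)" using splits_cover[OF C(3) finC] by blast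
  then have "nu A x = (\<Sum>a\<in>(\<Union>c\<in>C. A \<inter> seg C c). T (restr (seg A a) x))"
    unfolding nu_def by (rule arg_cong)
  also have "\<dots> = (\<Sum>c\<in>C. \<Sum>a\<in>A \<inter> seg C c. T (restr (seg A a) x))"
  proof (rule sum.UNION_disjoint)
    show "\<forall>i\<in>C. finite (A \<inter> seg C i)" using C(1) by simp
    show "\<forall>i\<in>C. \<forall>j\<in>C. i \<noteq> j \<longrightarrow> A \<inter> seg C i \<inter> (A \<inter> seg C j) = {}"
      using seg_disjoint[of _ C] by blast
  qed (rule finC)
  finally have "nu A x = (\<Sum>c\<in>C. \<Sum>a\<in>A \<inter> seg C c. T (restr (seg A a) x))" .
  also have "\<dots> \<le> (\<Sum>c\<in>C. nu (A \<inter> seg C c) (restr (seg C c) x))"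
    by (intro sum_mono nu_refine[OF CA C(1) Cons.prems(1)])
  finally have "?p * nu A x \<le> (\<Sum>c\<in>C. ?p * nu (A \<inter> seg C c) (restr (seg C c) x))"
    using p by (simp add: sum_distrib_left[symmetric] mult_left_mono)
  also have "\<dots> \<le> nu C x"
    unfolding nu_def[of C]
  proof (rule sum_mono)
    fix c assume "c \<in> C"
    then have "A \<inter> seg C c \<in> fam F ns" using C(3) unfolding splits_def by blast
    then show "?p * nu (A \<inter> seg C c) (restr (seg C c) x) \<le> T (restr (seg C c) x)"
      using Cons.IH Cons.prems(1) by simp
  qed
  finally have "\<theta> n * (?p * nu A x) \<le> \<theta> n * nu C x" using theta_pos[of n] by simp
  also have "\<dots> \<le> T x" by (rule T_lower[OF Cons.prems(1) C(2)])
  finally show ?case by (simp add: mult.assoc)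
qed

text \<open>Segments missing the support are dropped, and each remaining minimum moves to the first
  support point in its segment. Hereditariness and spreading keep the result in \<open>F m\<close>,
  and each new segment covers the old part of the support. This is how sets of \<open>F m\<close>
  are brought inside N.\<close>

lemma nu_push:
  assumes x: "fsupp x" and A: "A \<in> F m" and S: "{k. x k \<noteq> 0} \<subseteq> S"
  shows "\<exists>A'\<in>F m. A' \<subseteq> S \<and> nu A x \<le> nu A' x"
proof -
  define A1 where "A1 = {a \<in> A. seg A a \<inter> {k. x k \<noteq> 0} \<noteq> {}}"
  define \<phi> where "\<phi> a = Min (seg A a \<inter> {k. x k \<noteq> 0})" for a
  have fin: "finite (seg A a \<inter> {k. x k \<noteq> 0})" for a using x by (simp add: fsupp_def)
  have \<phi>: "\<phi> a \<in> seg A a" "x (\<phi> a) \<noteq> 0" if "a \<in> A1" for a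
    using Min_in[OF fin, of a] that unfolding A1_def \<phi>_def by auto
  have ge: "a \<le> \<phi> a" if "a \<in> A1" for a using \<phi>(1)[OF that] by (simp add: seg_def)
  have lt: "\<phi> a < b" if "a \<in> A1" "b \<in> A1" "a < b" for a b
    using \<phi>(1)[OF that(1)] that unfolding seg_def A1_def by auto
  have mono: "strict_mono_on A1 \<phi>"
    using lt ge by (intro strict_mono_onI) (meson less_le_trans)
  have inj: "inj_on \<phi> A1" using mono by (rule strict_mono_on_imp_inj_on)
  have "A1 \<in> F m" by (rule hereditaryD[OF hered A]) (auto simp: A1_def)
  then have 1: "\<phi> ` A1 \<in> F m" by (rule spreadingD[OF spread _ mono ge])
  have "nu A x = (\<Sum>a\<in>A1. T (restr (seg A a) x))"
    unfolding nu_def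
  proof (rule sum.mono_neutral_right[OF finite_F[OF A]])
    show "\<forall>a\<in>A - A1. T (restr (seg A a) x) = 0"
    proof
      fix a assume "a \<in> A - A1"
      then have "restr (seg A a) x = (\<lambda>k. 0)" by (intro ext) (auto simp: A1_def restr_def)
      then show "T (restr (seg A a) x) = 0" by simp
    qed
  qed (auto simp: A1_def)
  also have "\<dots> \<le> (\<Sum>a\<in>A1. T (restr (seg (\<phi> ` A1) (\<phi> a)) x))"
  proof (intro sum_mono T_restr_mono[OF x] subsetI)
    fix a k assume a: "a \<in> A1" and k: "k \<in> seg A a \<inter> {k. x k \<noteq> 0}"
    have "\<phi> a \<le> k" unfolding \<phi>_def using fin k by (rule Min_le)
    moreover have "k < \<phi> b" if b: "b \<in> A1" "\<phi> a < \<phi> b" for b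
    proof -
      have "a < b" using mono a b by (metis strict_mono_on_less)
      then have "k < b" using k b(1) by (auto simp: seg_def A1_def)
      then show ?thesis using ge[OF b(1)] by simp
    qed
    ultimately show "k \<in> seg (\<phi> ` A1) (\<phi> a)" by (auto simp: seg_def)
  qed
  also have "\<dots> = nu (\<phi> ` A1) x" unfolding nu_def by (simp add: sum.reindex[OF inj])
  finally have 2: "nu A x \<le> nu (\<phi> ` A1) x" .
  have "\<phi> ` A1 \<subseteq> S" using \<phi>(2) S by blast
  then show ?thesis using 1 2 by (intro bexI[of _ "\<phi> ` A1"] conjI)
qed

text \<open>A block cut by no point of C lies within a single segment of C, so that only one group
  of A acts on it, and this group belongs to \<open>fam F ns\<close>. If all of C lies beyond the
  block, so does A.\<close>

lemma nu_comp_le: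
  assumes A: "splits (fam F ns) A C" "finite A" and x: "fsupp x" "{j. x j \<noteq> 0} \<subseteq> {..k}"
    and good: "\<forall>c\<in>C. c \<le> k \<longrightarrow> (\<forall>j. x j \<noteq> 0 \<longrightarrow> c \<le> j)"
  shows "prod_list (map \<theta> ns) * nu A x \<le> T x"
proof -
  have CA: "C \<subseteq> A" using A(1) unfolding splits_def by blast
  have finC: "finite C" using CA A(2) finite_subset by blast
  let ?D = "{c \<in> C. c \<le> k}"
  show ?thesis
  proof (cases "?D = {}")
    case True
    have "T (restr (seg A a) x) = 0" if a: "a \<in> A" for a
    proof -
      obtain c where "c \<in> C" "c \<le> a" using A(1) a unfolding splits_def by blast
      then have "k < a" using True by force
      then have "restr (seg A a) x = (\<lambda>j. 0)" using x(2) by (intro ext) (auto simp: restr_def seg_def)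
      then show ?thesis by simp
    qed
    then show ?thesis using T_nonneg[OF x(1)] by (simp add: nu_def)
  next
    case False
    define c where "c = Max ?D"
    have D: "finite ?D" using finC by simp
    have c: "c \<in> C" "c \<le> k" using Max_in[OF D False] unfolding c_def by auto
    have above: "k < b" if "b \<in> C" "c < b" for b
    proof (rule ccontr)
      assume "\<not> k < b"
      then have "b \<in> ?D" using that by simp
      from Max_ge[OF D this] show False using that(2) unfolding c_def by linarith
    qed
    have sub: "{j. x j \<noteq> 0} \<subseteq> seg C c"
    proof
      fix j assume j: "j \<in> {j. x j \<noteq> 0}"
      then have "c \<le> j" "j \<le> k" using good c x(2) by auto
      then show "j \<in> seg C c" using above unfolding seg_def by (auto intro: le_less_trans)
    qed
    let ?G = "A \<inter> seg C c"
    have "nu A x = (\<Sum>a\<in>?G. T (restr (seg A a) x))"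
      unfolding nu_def
    proof (rule sum.mono_neutral_right[OF A(2)])
      show "\<forall>a\<in>A - ?G. T (restr (seg A a) x) = 0"
      proof
        fix a assume a: "a \<in> A - ?G"
        have "seg A a \<inter> seg C c = {}"
        proof (cases "a < c")
          case True
          then show ?thesis using c CA unfolding seg_def by fastforce
        next
          case False
          then obtain b where "b \<in> C" "c < b" "b \<le> a" using a unfolding seg_def by auto
          then show ?thesis unfolding seg_def by fastforce
        qed
        then have "restr (seg A a) x = (\<lambda>j. 0)" using sub by (intro ext) (auto simp: restr_def)
        then show "T (restr (seg A a) x) = 0" by simp
      qed
    qed auto
    also have "\<dots> \<le> nu ?G x"
      using nu_refine[OF CA A(2) x(1), of c] restr_id[OF sub] by simp
    finally have "prod_list (map \<theta> ns) * nu A x \<le> prod_list (map \<theta> ns) * nu ?G x"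
      using theta_pos by (intro mult_left_mono prod_list_nonneg) (auto intro: less_imp_le)
    also have "\<dots> \<le> T x"
      using A(1) c(1) by (intro nu_fam_le[OF x(1)]) (auto simp: splits_def)
    finally show ?thesis .
  qed
qed

text \<open>The constant 3 counts three errors of size e: the blocks negligible for the weight
  (\<open>V1\<close>), the at most one block starting before \<open>q m\<close> (\<open>V3\<close>),
  and the blocks cut between groups (\<open>B\<close>).\<close>

lemma average_bound:
  assumes J: "spreading J" "hereditary J"
    and dom: "\<And>m A. A \<in> F m \<Longrightarrow> A \<subseteq> N \<inter> {q m..} \<Longrightarrow> A \<in> family_comp J (fam F (ns m))"
    and ns: "\<And>m. \<theta> m \<le> \<theta> 0 * prod_list (map \<theta> (ns m))"
    and V: "finite V" and a: "\<And>k. k \<in> V \<Longrightarrow> 0 \<le> a k" "sum a V = 1"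
    and v: "\<And>k. k \<in> V \<Longrightarrow> {j. v k j \<noteq> 0} \<subseteq> N \<inter> {..k}" "\<And>k. k \<in> V \<Longrightarrow> T (v k) \<le> c"
    and c: "0 \<le> c" "c \<le> 1" and e: "0 \<le> e"
    and sep: "\<And>k k'. k \<in> V \<Longrightarrow> k' \<in> V \<Longrightarrow> k < k' \<Longrightarrow> {j. v k' j \<noteq> 0} \<subseteq> {Suc k..}"
    and fast: "\<And>k k' m. k \<in> V \<Longrightarrow> k' \<in> V \<Longrightarrow> k < k' \<Longrightarrow> e < \<theta> m * l1n (v k) \<Longrightarrow> {j. v k' j \<noteq> 0} \<subseteq> {q m..}"
    and small: "\<And>B. B \<in> J \<Longrightarrow> B \<subseteq> V \<Longrightarrow> sum a B \<le> e" "\<And>k. k \<in> V \<Longrightarrow> a k \<le> e"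
  shows "T (\<lambda>j. \<Sum>k\<in>V. a k * v k j) \<le> \<theta> 0 * c + 3 * e"
proof (rule T_upper)
  let ?x = "\<lambda>j. \<Sum>k\<in>V. a k * v k j"
  have fs: "fsupp (v k)" if "k \<in> V" for k
    unfolding fsupp_def by (rule finite_subset[OF v(1)[OF that]]) simp
  then show "fsupp ?x" by simp
  have tc: "0 \<le> \<theta> 0 * c" using theta_pos[of 0] c by simp
  show "supnorm ?x \<le> \<theta> 0 * c + 3 * e"
  proof (rule supnorm_le)
    fix j show "\<bar>?x j\<bar> \<le> \<theta> 0 * c + 3 * e"
    proof (cases "\<exists>k\<in>V. v k j \<noteq> 0")
      case False
      then have "?x j = 0" by (intro sum.neutral) auto
      then show ?thesis using tc e by simp
    next
      case True
      then obtain k where k: "k \<in> V" "v k j \<noteq> 0" by blast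
      have "v i j = 0" if "i \<in> V" "i \<noteq> k" for i
      proof (cases i k rule: linorder_cases)
        case less
        then have "Suc i \<le> j" using sep[OF that(1) k(1)] k(2) by auto
        then show ?thesis using v(1)[OF that(1)] by force
      next
        case greater
        then have "j \<le> k" using v(1)[OF k(1)] k(2) by auto
        then show ?thesis using sep[OF k(1) that(1) greater] by force
      qed (use that in simp)
      then have "?x j = a k * v k j" using V k(1) by (intro sum_zero_except) auto
      also have "\<bar>a k * v k j\<bar> \<le> e * 1"
        unfolding abs_mult using a(1)[OF k(1)] small(2)[OF k(1)] abs_le_T[OF fs[OF k(1)], of j] v(2)[OF k(1)] c e
        by (intro mult_mono) linarith+
      finally show ?thesis using tc e by simp
    qed
  qed
  fix m A assume A: "A \<in> F m"
  define V1 where "V1 = {k \<in> V. \<theta> m * l1n (v k) \<le> e}"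
  define V2 where "V2 = {k \<in> V. e < \<theta> m * l1n (v k) \<and> {j. v k j \<noteq> 0} \<subseteq> {q m..}}"
  define V3 where "V3 = {k \<in> V. e < \<theta> m * l1n (v k) \<and> \<not> {j. v k j \<noteq> 0} \<subseteq> {q m..}}"
  have part: "V = V1 \<union> V2 \<union> V3" "V1 \<inter> V2 = {}" "(V1 \<union> V2) \<inter> V3 = {}"
    unfolding V1_def V2_def V3_def by auto
  have fin: "finite V1" "finite V2" "finite V3" using V unfolding V1_def V2_def V3_def by auto
  have split: "sum f V = sum f V1 + sum f V2 + sum f V3" for f :: "nat \<Rightarrow> real"
    using part fin by (simp add: sum.union_disjoint)
  have th: "0 < \<theta> m" using theta_pos .
  have part_le: "\<theta> m * nu D (\<lambda>j. \<Sum>k\<in>W. a k * v k j) \<le> (\<Sum>k\<in>W. a k * (\<theta> m * nu D (v k)))"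
    if "W \<subseteq> V" for W D
  proof -
    have "nu D (\<lambda>j. \<Sum>k\<in>W. a k * v k j) \<le> (\<Sum>k\<in>W. \<bar>a k\<bar> * nu D (v k))"
      using that fs by (intro nu_sum_le) blast
    also have "\<dots> = (\<Sum>k\<in>W. a k * nu D (v k))" using that a(1) by (intro sum.cong) auto
    finally have "\<theta> m * nu D (\<lambda>j. \<Sum>k\<in>W. a k * v k j) \<le> \<theta> m * (\<Sum>k\<in>W. a k * nu D (v k))"
      using th by simp
    then show ?thesis by (simp add: sum_distrib_left mult.left_commute)
  qed
  have gen: "\<theta> m * nu D (v k) \<le> c" if "k \<in> V" "D \<in> F m" for k D
    using T_lower[OF fs[OF that(1)] that(2)] v(2)[OF that(1)] by linarith
  have S1: "\<theta> m * nu A (\<lambda>j. \<Sum>k\<in>V1. a k * v k j) \<le> e"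
  proof -
    have "\<theta> m * nu A (v k) \<le> e" if k: "k \<in> V1" for k
    proof -
      have "\<theta> m * nu A (v k) \<le> \<theta> m * l1n (v k)"
        using nu_le_l1n[OF finite_F[OF A] fs[of k]] k th unfolding V1_def by simp
      then show ?thesis using k unfolding V1_def by simp
    qed
    then have "(\<Sum>k\<in>V1. a k * (\<theta> m * nu A (v k))) \<le> (\<Sum>k\<in>V1. a k * e)"
      using a(1) part(1) by (intro sum_mono mult_left_mono) auto
    also have "\<dots> = sum a V1 * e" by (simp add: sum_distrib_right)
    also have "\<dots> \<le> sum a V * e"
      using V a(1) e part(1) by (intro mult_right_mono sum_mono2) auto
    also have "\<dots> = e" using a(2) by simp
    finally have "(\<Sum>k\<in>V1. a k * (\<theta> m * nu A (v k))) \<le> e" .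
    moreover have "V1 \<subseteq> V" using part(1) by blast
    ultimately show ?thesis using part_le[of V1 A] by linarith
  qed
  have S3: "\<theta> m * nu A (\<lambda>j. \<Sum>k\<in>V3. a k * v k j) \<le> e"
  proof -
    \<comment> \<open>If there were two such blocks, the earlier one, not being negligible, would
      force the later one beyond \<open>q m\<close>.\<close>
    have single: "k = k'" if "k \<in> V3" "k' \<in> V3" for k k'
      using that fast[of k k' m] fast[of k' k m] unfolding V3_def
      by (cases k k' rule: linorder_cases) auto
    have "(\<Sum>k\<in>V3. a k * (\<theta> m * nu A (v k))) \<le> e"
    proof (cases "V3 = {}")
      case False
      then obtain k where k: "k \<in> V3" by blast
      then have "V3 = {k}" using single by blast
      moreover have "a k * (\<theta> m * nu A (v k)) \<le> e * 1"
        using k small(2)[of k] a(1)[of k] gen[of k A] A c e fs[of k] th nu_nonneg[of "v k" A] unfolding V3_def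
        by (intro mult_mono) auto
      ultimately show ?thesis by simp
    qed (use e in simp)
    then show ?thesis using part_le[of V3 A] part(1) by auto
  qed
  have S2: "\<theta> m * nu A (\<lambda>j. \<Sum>k\<in>V2. a k * v k j) \<le> \<theta> 0 * c + e"
  proof -
    let ?x2 = "\<lambda>j. \<Sum>k\<in>V2. a k * v k j"
    have V2V: "V2 \<subseteq> V" using part(1) by blast
    have fx2: "fsupp ?x2" using V2V fs by (intro fsupp_sum) blast
    have "{j. ?x2 j \<noteq> 0} \<subseteq> N \<inter> {q m..}"
    proof
      fix j assume "j \<in> {j. ?x2 j \<noteq> 0}"
      then obtain k where "k \<in> V2" "v k j \<noteq> 0"
        using sum.neutral[of V2 "\<lambda>k. a k * v k j"] by force
      then show "j \<in> N \<inter> {q m..}" using v(1)[of k] V2V unfolding V2_def by blast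
    qed
    then obtain A' where A': "A' \<in> F m" "A' \<subseteq> N \<inter> {q m..}" "nu A ?x2 \<le> nu A' ?x2"
      using nu_push[OF fx2 A] by blast
    obtain C where C: "finite A'" "C \<in> J" "splits (fam F (ns m)) A' C"
      using dom[OF A'(1,2)] unfolding family_comp_def by blast
    \<comment> \<open>The cut blocks: a minimum c of a group falls after a support point of the
      block but not after its label k.\<close>
    define B where "B = {k \<in> V2. \<exists>c\<in>C. c \<le> k \<and> (\<exists>j. v k j \<noteq> 0 \<and> j < c)}"
    have BV: "B \<subseteq> V" using V2V unfolding B_def by blast
    \<comment> \<open>Each cut block selects a cut in C. Since the blocks are successive, the
      selection g is increasing, and \<open>g k \<le> k\<close> exhibits B as a spread of a subset
      of C.\<close>
    have "B \<in> J"
    proof -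
      have "\<forall>k\<in>B. \<exists>c. c \<in> C \<and> c \<le> k \<and> (\<exists>j. v k j \<noteq> 0 \<and> j < c)" unfolding B_def by blast
      then obtain g where g: "\<And>k. k \<in> B \<Longrightarrow> g k \<in> C \<and> g k \<le> k \<and> (\<exists>j. v k j \<noteq> 0 \<and> j < g k)"
        by metis
      have mono: "g k < g k'" if "k \<in> B" "k' \<in> B" "k < k'" for k k'
      proof -
        obtain j where j: "v k' j \<noteq> 0" "j < g k'" using g[OF \<open>k' \<in> B\<close>] by blast
        then have "Suc k \<le> j" using sep[of k k'] that BV by auto
        then show ?thesis using g[OF \<open>k \<in> B\<close>] j(2) by linarith
      qed
      have inj: "inj_on g B"
        using mono by (intro linorder_inj_onI) (auto simp: neq_iff)
      let ?h = "the_inv_into B g"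
      have h: "?h (g k) = k" if "k \<in> B" for k using the_inv_into_f_f[OF inj that] .
      have "g ` B \<in> J" by (rule hereditaryD[OF J(2) C(2)]) (use g in blast)
      then have "?h ` g ` B \<in> J"
      proof (rule spreadingD[OF J(1)])
        show "strict_mono_on (g ` B) ?h"
        proof (rule strict_mono_onI)
          fix r s assume "r \<in> g ` B" "s \<in> g ` B" "r < s"
          then obtain k k' where "k \<in> B" "k' \<in> B" "r = g k" "s = g k'" by blast
          then show "?h r < ?h s" using h mono[of k' k] \<open>r < s\<close>
            by (cases k k' rule: linorder_cases) auto
        qed
        show "b \<le> ?h b" if "b \<in> g ` B" for b using that g h by auto
      qed
      then show ?thesis using h by (simp add: image_image)
    qed
    then have aB: "sum a B \<le> e" using small(1) BV by blast
    \<comment> \<open>The weight is at most \<open>\<theta> 0\<close> times the product for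
      \<open>ns m\<close>; the group containing the block uses up the product and leaves the factor
      \<open>\<theta> 0\<close>.\<close>
    have good: "\<theta> m * nu A' (v k) \<le> \<theta> 0 * c" if k: "k \<in> V2 - B" for k
    proof -
      have kV: "k \<in> V" using k V2V by blast
      have "prod_list (map \<theta> (ns m)) * nu A' (v k) \<le> T (v k)"
        by (rule nu_comp_le[OF C(3,1) fs[OF kV], of k])
           (use k v(1)[OF kV] in \<open>auto simp: B_def not_less\<close>)
      then have "\<theta> 0 * (prod_list (map \<theta> (ns m)) * nu A' (v k)) \<le> \<theta> 0 * c"
        using theta_pos[of 0] v(2)[OF kV] by simp
      moreover have "\<theta> m * nu A' (v k) \<le> (\<theta> 0 * prod_list (map \<theta> (ns m))) * nu A' (v k)"
        using ns nu_nonneg[OF fs[OF kV]] by (intro mult_right_mono) auto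
      ultimately show ?thesis by (simp add: mult.assoc)
    qed
    have B2: "B \<subseteq> V2" unfolding B_def by blast
    have "(\<Sum>k\<in>V2. a k * (\<theta> m * nu A' (v k)))
        = (\<Sum>k\<in>V2 - B. a k * (\<theta> m * nu A' (v k))) + (\<Sum>k\<in>B. a k * (\<theta> m * nu A' (v k)))"
      using sum.subset_diff[OF B2 fin(2)] .
    also have "\<dots> \<le> (\<Sum>k\<in>V2 - B. a k * (\<theta> 0 * c)) + (\<Sum>k\<in>B. a k * c)"
      using good gen[OF _ A'(1)] a(1) V2V BV by (intro add_mono sum_mono mult_left_mono) auto
    also have "\<dots> = sum a (V2 - B) * (\<theta> 0 * c) + sum a B * c" by (simp add: sum_distrib_right)
    also have "\<dots> \<le> 1 * (\<theta> 0 * c) + e * 1"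
    proof (intro add_mono mult_mono)
      have "sum a (V2 - B) \<le> sum a V" using V V2V a(1) by (intro sum_mono2) auto
      then show "sum a (V2 - B) \<le> 1" using a(2) by simp
    qed (use tc theta_pos[of 0] c e aB a(1) BV in \<open>auto intro: sum_nonneg\<close>)
    finally have "(\<Sum>k\<in>V2. a k * (\<theta> m * nu A' (v k))) \<le> \<theta> 0 * c + e" by simp
    then have "\<theta> m * nu A' ?x2 \<le> \<theta> 0 * c + e" using part_le[OF V2V, of A'] by linarith
    moreover have "\<theta> m * nu A ?x2 \<le> \<theta> m * nu A' ?x2" using A'(3) th by simp
    ultimately show ?thesis by linarith
  qed
  let ?y = "\<lambda>W j. \<Sum>k\<in>W. a k * v k j"
  have f: "fsupp (?y V1)" "fsupp (?y V2)" "fsupp (?y V3)"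
    using part(1) fs by (auto intro!: fsupp_sum)
  have "nu A ?x = nu A (\<lambda>j. (?y V1 j + ?y V2 j) + ?y V3 j)" unfolding split ..
  also have "\<dots> \<le> nu A (\<lambda>j. ?y V1 j + ?y V2 j) + nu A (?y V3)"
    using f by (intro nu_add_le) auto
  also have "nu A (\<lambda>j. ?y V1 j + ?y V2 j) \<le> nu A (?y V1) + nu A (?y V2)"
    using f by (intro nu_add_le) auto
  finally have "\<theta> m * nu A ?x \<le> \<theta> m * (nu A (?y V1) + nu A (?y V2) + nu A (?y V3))"
    using th by simp
  also have "\<dots> \<le> \<theta> 0 * c + 3 * e" using S1 S2 S3 by (simp add: distrib_left)
  finally show "\<theta> m * nu A ?x \<le> \<theta> 0 * c + 3 * e" .
qed

section \<open>The completion and closed spans\<close>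

lemma T_initial_mono: "n \<le> m \<Longrightarrow> T (restr {..<n} x) \<le> T (restr {..<m} x)"
proof -
  assume "n \<le> m"
  then have "restr {..<n} x = restr {..<n} (restr {..<m} x)" by (intro ext) (auto simp: restr_def)
  then show ?thesis using T_restr_le[of "restr {..<m} x" "{..<n}"] by simp
qed

text \<open>The norms of the initial truncations increase and, by the Cauchy condition, are bounded;
  hence the \<open>lim\<close> in \<open>Xnorm\<close> is a genuine limit dominating all of
  them.\<close>

lemma Xnorm_LIMSEQ:
  assumes "x \<in> Xspace \<theta> F"
  shows "(\<lambda>n. T (restr {..<n} x)) \<longlonglongrightarrow> Xnorm \<theta> F x" "T (restr {..<n} x) \<le> Xnorm \<theta> F x"
proof -
  obtain n0 where n0: "\<And>n m. n0 \<le> n \<Longrightarrow> n \<le> m \<Longrightarrow> T (restr {n..<m} x) < 1"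
    using assms unfolding Xspace_def by (force dest: spec[of _ "1::real"])
  have "T (restr {..<m} x) \<le> T (restr {..<n0} x) + 1" for m
  proof (cases "m \<le> n0")
    case True
    then show ?thesis using T_initial_mono[OF True, of x] by simp
  next
    case False
    have "restr {..<m} x = (\<lambda>k. restr {..<n0} x k + restr {n0..<m} x k)"
      using False by (intro ext) (auto simp: restr_def)
    then show ?thesis
      using T_add_le[of "restr {..<n0} x" "restr {n0..<m} x"] n0[of n0 m] False by simp
  qed
  then have bd: "\<forall>m. T (restr {..<m} x) \<le> T (restr {..<n0} x) + 1" by blast
  have inc: "incseq (\<lambda>n. T (restr {..<n} x))"
    using T_initial_mono by (intro incseq_SucI) simp
  obtain L where L: "(\<lambda>n. T (restr {..<n} x)) \<longlonglongrightarrow> L"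
    using incseq_convergent[OF inc bd] by blast
  then have eq: "Xnorm \<theta> F x = L" unfolding Xnorm_def by (rule limI)
  show "(\<lambda>n. T (restr {..<n} x)) \<longlonglongrightarrow> Xnorm \<theta> F x" using L eq by simp
  show "T (restr {..<n} x) \<le> Xnorm \<theta> F x" using incseq_le[OF inc L] eq by simp
qed

lemma Xnorm_leI:
  "x \<in> Xspace \<theta> F \<Longrightarrow> (\<And>n. T (restr {..<n} x) \<le> b) \<Longrightarrow> Xnorm \<theta> F x \<le> b"
  using Xnorm_LIMSEQ(1) LIMSEQ_le_const2 by blast

lemma fsupp_Xspace:
  assumes "fsupp x" shows "x \<in> Xspace \<theta> F"
proof -
  obtain n0 where n0: "\<forall>k\<in>{k. x k \<noteq> 0}. k < n0"
    using assms unfolding fsupp_def finite_nat_set_iff_bounded by blast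
  have "restr {n..<m} x = (\<lambda>k. 0)" if "n0 \<le> n" for n m
    using n0 that by (intro ext) (fastforce simp: restr_def)
  then show ?thesis unfolding Xspace_def by (auto intro!: exI[of _ n0])
qed

lemma fsupp_Xnorm:
  assumes "fsupp x" shows "Xnorm \<theta> F x = T x"
proof -
  obtain n0 where n0: "\<forall>k\<in>{k. x k \<noteq> 0}. k < n0"
    using assms unfolding fsupp_def finite_nat_set_iff_bounded by blast
  have "restr {..<n} x = x" if "n0 \<le> n" for n
    using n0 that by (intro restr_id) auto
  then have "(\<lambda>n. T (restr {..<n} x)) \<longlonglongrightarrow> T x"
    by (intro tendsto_eventually eventually_sequentiallyI[of n0]) simp
  then show ?thesis unfolding Xnorm_def by (rule limI)
qed

lemma Xspace_sum:
  assumes "finite I" "\<And>i. i \<in> I \<Longrightarrow> x i \<in> Xspace \<theta> F"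
  shows "(\<lambda>k. \<Sum>i\<in>I. b i * x i k) \<in> Xspace \<theta> F"
  unfolding Xspace_def
proof (intro CollectI allI impI)
  fix \<epsilon> :: real assume e: "0 < \<epsilon>"
  define \<delta> where "\<delta> = \<epsilon> / (1 + (\<Sum>i\<in>I. \<bar>b i\<bar>))"
  have pos: "0 < 1 + (\<Sum>i\<in>I. \<bar>b i\<bar>)" by (rule add_pos_nonneg) (auto intro: sum_nonneg)
  have d: "0 < \<delta>" unfolding \<delta>_def using e pos by simp
  have "\<exists>n0. \<forall>n m. n0 \<le> n \<longrightarrow> n \<le> m \<longrightarrow> T (restr {n..<m} (x i)) < \<delta>" if "i \<in> I" for i
    using assms(2)[OF that] d unfolding Xspace_def by blast
  then obtain f where f: "\<And>i n m. i \<in> I \<Longrightarrow> f i \<le> n \<Longrightarrow> n \<le> m \<Longrightarrow> T (restr {n..<m} (x i)) < \<delta>"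
    by metis
  have "T (restr {n..<m} (\<lambda>k. \<Sum>i\<in>I. b i * x i k)) < \<epsilon>" if n: "Max (insert 0 (f ` I)) \<le> n" "n \<le> m" for n m
  proof -
    have fi: "f i \<le> n" if "i \<in> I" for i
      using n(1) assms(1) that by (auto intro: order_trans[OF Max_ge])
    have "T (restr {n..<m} (\<lambda>k. \<Sum>i\<in>I. b i * x i k)) \<le> (\<Sum>i\<in>I. \<bar>b i\<bar> * T (restr {n..<m} (x i)))"
      unfolding restr_sum by (rule T_sum_le) simp
    also have "\<dots> \<le> (\<Sum>i\<in>I. \<bar>b i\<bar> * \<delta>)"
      using f[OF _ fi n(2)] by (intro sum_mono mult_left_mono) (auto intro: less_imp_le)
    also have "\<dots> = (\<Sum>i\<in>I. \<bar>b i\<bar>) * \<delta>" by (simp add: sum_distrib_right)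
    also have "\<dots> < (1 + (\<Sum>i\<in>I. \<bar>b i\<bar>)) * \<delta>" using d by (simp add: distrib_right)
    also have "\<dots> = \<epsilon>" unfolding \<delta>_def using pos by simp
    finally show ?thesis .
  qed
  then show "\<exists>n0. \<forall>n m. n0 \<le> n \<longrightarrow> n \<le> m \<longrightarrow> T (restr {n..<m} (\<lambda>k. \<Sum>i\<in>I. b i * x i k)) < \<epsilon>" by blast
qed

lemma Xspace_tail:
  assumes "x \<in> Xspace \<theta> F" "0 < \<eta>"
  shows "\<exists>q\<ge>p. \<forall>n. T (restr {..<n} (\<lambda>k. x k - restr {..<q} x k)) \<le> \<eta>"
proof -
  obtain n0 where n0: "\<And>n m. n0 \<le> n \<Longrightarrow> n \<le> m \<Longrightarrow> T (restr {n..<m} x) < \<eta>"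
    using assms unfolding Xspace_def by blast
  have "T (restr {..<n} (\<lambda>k. x k - restr {..<max n0 p} x k)) \<le> \<eta>" for n
  proof -
    have "restr {..<n} (\<lambda>k. x k - restr {..<max n0 p} x k) = restr {max n0 p..<max n (max n0 p)} x"
      by (intro ext) (auto simp: restr_def)
    then show ?thesis using n0[of "max n0 p" "max n (max n0 p)"] by simp
  qed
  then show ?thesis by (intro exI[of _ "max n0 p"]) simp
qed

lemma espan_Xspace: "x \<in> espan \<theta> F N \<Longrightarrow> x \<in> Xspace \<theta> F"
  unfolding espan_def by blast

text \<open>Coordinates are dominated by the norm, and the approximating vectors vanish off
  N.\<close>

lemma espan_support:
  assumes "x \<in> espan \<theta> F N" shows "{k. x k \<noteq> 0} \<subseteq> N"
proof (rule subsetI, rule ccontr)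
  fix k assume k: "k \<in> {k. x k \<noteq> 0}" "k \<notin> N"
  then obtain z where z: "fsupp z" "{k. z k \<noteq> 0} \<subseteq> N" "Xnorm \<theta> F (\<lambda>j. x j - z j) < \<bar>x k\<bar>"
    using assms unfolding espan_def fsupp_def by force
  \<comment> \<open>The difference is written as a two-term linear combination, so that closure
    under finite sums applies.\<close>
  have "(\<lambda>j. \<Sum>i\<in>{False, True}. (if i then 1 else -1) * (if i then x else z) j) \<in> Xspace \<theta> F"
    using espan_Xspace[OF assms] fsupp_Xspace[OF z(1)] by (intro Xspace_sum) auto
  then have X: "(\<lambda>j. x j - z j) \<in> Xspace \<theta> F" by simp
  have "\<bar>restr {..<Suc k} (\<lambda>j. x j - z j) k\<bar> \<le> T (restr {..<Suc k} (\<lambda>j. x j - z j))"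
    by (rule abs_le_T) simp
  also have "\<dots> \<le> Xnorm \<theta> F (\<lambda>j. x j - z j)" by (rule Xnorm_LIMSEQ(2)[OF X])
  finally have "\<bar>x k - z k\<bar> \<le> Xnorm \<theta> F (\<lambda>j. x j - z j)" by (simp add: restr_def)
  moreover have "z k = 0" using z(2) k(2) by blast
  ultimately show False using z(3) by simp
qed

section \<open>Unit vectors\<close>

definition unit :: "nat \<Rightarrow> nat \<Rightarrow> real" where
  "unit k = (\<lambda>j. if j = k then 1 else 0)"

lemma fsupp_unit [simp]: "fsupp (unit k)"
  by (simp add: fsupp_def unit_def)

lemma unit_support: "{j. unit k j \<noteq> 0} = {k}"
  by (auto simp: unit_def)

lemma unit_espan:
  assumes "k \<in> N" shows "unit k \<in> espan \<theta> F N"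
  unfolding espan_def
proof (intro CollectI conjI allI impI)
  show "unit k \<in> Xspace \<theta> F" by (simp add: fsupp_Xspace)
  fix \<epsilon> :: real assume "0 < \<epsilon>"
  then show "\<exists>z. finite {j. z j \<noteq> 0} \<and> {j. z j \<noteq> 0} \<subseteq> N \<and> Xnorm \<theta> F (\<lambda>j. unit k j - z j) < \<epsilon>"
    using assms fsupp_Xnorm[of "\<lambda>j. 0"] by (intro exI[of _ "unit k"]) (simp add: unit_support)
qed

lemma Xnorm_unit: "Xnorm \<theta> F (unit k) = 1"
proof -
  have "l1n (unit k) = 1" unfolding l1n_def unit_support by (simp add: unit_def)
  then have "T (unit k) \<le> 1" using T_le_l1n[of "unit k"] by simp
  moreover have "1 \<le> T (unit k)" using abs_le_T[OF fsupp_unit, of k k] by (simp add: unit_def)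
  ultimately show ?thesis by (simp add: fsupp_Xnorm)
qed

text \<open>A serves as its own set of minima: the segment starting at k contains the coordinate k,
  so each piece contributes at least its coefficient in absolute value.\<close>

lemma unit_lower:
  assumes "A \<in> F n"
  shows "\<theta> n * (\<Sum>k\<in>A. \<bar>b k\<bar>) \<le> Xnorm \<theta> F (\<lambda>j. \<Sum>k\<in>A. b k * unit k j)"
proof -
  let ?x = "\<lambda>j. \<Sum>k\<in>A. b k * unit k j"
  have fin: "finite A" using finite_F[OF assms] .
  have x: "?x j = (if j \<in> A then b j else 0)" for j
    using fin by (simp add: unit_def if_distrib[of "\<lambda>t. _ * t"] sum.delta' cong: if_cong)
  have "(\<Sum>k\<in>A. \<bar>b k\<bar>) \<le> nu A ?x"
    unfolding nu_def
  proof (rule sum_mono)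
    fix k assume k: "k \<in> A"
    have "\<bar>restr (seg A k) ?x k\<bar> \<le> T (restr (seg A k) ?x)" by (rule abs_le_T) simp
    then show "\<bar>b k\<bar> \<le> T (restr (seg A k) ?x)" using k x[of k] by (simp add: restr_def seg_def)
  qed
  then have "\<theta> n * (\<Sum>k\<in>A. \<bar>b k\<bar>) \<le> \<theta> n * nu A ?x" using theta_pos[of n] by simp
  also have "\<dots> \<le> T ?x" by (rule T_lower[OF _ assms]) simp
  finally show ?thesis by (simp add: fsupp_Xnorm)
qed

end

section \<open>Derived trees and small convex combinations\<close>

lemma tree_deriv_anti_aux:
  "ord_le x y \<Longrightarrow> tree_deriv D y \<subseteq> tree_deriv D x"
  "ord_lt x y \<Longrightarrow> tree_deriv D y \<subseteq> tree_deriv D (BS x)"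
proof -
  have "tree_deriv D b \<subseteq> D" for b by (induction b) auto
  then show "ord_le x y \<Longrightarrow> tree_deriv D y \<subseteq> tree_deriv D x"
    "ord_lt x y \<Longrightarrow> tree_deriv D y \<subseteq> tree_deriv D (BS x)"
    by (induction rule: ord_le_ord_lt.inducts) auto
qed

lemma tree_deriv_anti: "ord_le x y \<Longrightarrow> s \<in> tree_deriv D y \<Longrightarrow> s \<in> tree_deriv D x"
  using tree_deriv_anti_aux(1) by blast

lemma tree_deriv_subset: "tree_deriv D b \<subseteq> D"
  by (induction b) auto

lemma tree_deriv_oadd: "tree_deriv (tree_deriv D a) b = tree_deriv D (oadd a b)"
  by (induction b) auto

lemma tree_deriv_natord:
  "s \<in> tree_deriv D (natord n) \<Longrightarrow> \<exists>r. length r = n \<and> s @ r \<in> D"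
proof (induction n arbitrary: s)
  case (Suc n)
  then obtain x where "s @ [x] \<in> tree_deriv D (natord n)" by auto
  from Suc.IH[OF this] obtain r where "length r = n" "(s @ [x]) @ r \<in> D" by blast
  then show ?case by (intro exI[of _ "x # r"]) simp
qed auto

text \<open>Adding a later point to a set appends one vector to the list, so ranks in the family
  pass to the tree. Nonempty sets are used because \<open>l1_tree\<close> contains no empty
  list.\<close>

lemma tree_deriv_of_fderiv:
  assumes "\<And>A. A \<in> H \<Longrightarrow> A \<noteq> {} \<Longrightarrow> finite A \<and> map x (sorted_list_of_set A) \<in> D"
    and "A \<in> fderiv H b" "A \<noteq> {}"
  shows "map x (sorted_list_of_set A) \<in> tree_deriv D b"
  using assms(2,3)
proof (induction b arbitrary: A)
  case BZ
  then show ?case using assms(1) by simp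
next
  case (BS b)
  then obtain k where k: "\<forall>a\<in>A. a < k" "insert k A \<in> fderiv H b" by auto
  have "A \<in> H" using BS.prems(1) fderiv_subset by blast
  then have "finite A" using assms(1) BS.prems(2) by blast
  then have "sorted_list_of_set (insert k A) = sorted_list_of_set A @ [k]"
    using k(1) by (intro sorted_list_of_set_unique[THEN iffD1]) (auto simp: sorted_wrt_append)
  then have "map x (sorted_list_of_set A) @ [x k] \<in> tree_deriv D b"
    using BS.IH[OF k(2)] by simp
  then show ?case using BS by auto
qed auto

lemma l1_treeI:
  assumes A: "finite A" "A \<noteq> {}" "\<And>k. k \<in> A \<Longrightarrow> x k \<in> Y \<and> nm (x k) = 1"
    and low: "\<And>b :: nat \<Rightarrow> real. (\<Sum>k\<in>A. \<bar>b k\<bar>) / K \<le> nm (\<lambda>j. \<Sum>k\<in>A. b k * x k j)"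
  shows "map x (sorted_list_of_set A) \<in> l1_tree Y nm K"
proof -
  let ?l = "sorted_list_of_set A"
  have bij: "bij_betw ((!) ?l) {..<card A} A"
    using A(1) by (intro bij_betw_nth) auto
  have "(\<Sum>i<card A. \<bar>a i\<bar>) / K \<le> nm (\<lambda>j. \<Sum>i<card A. a i * x (?l ! i) j)" for a :: "nat \<Rightarrow> real"
  proof -
    define b where "b = a \<circ> the_inv_into {..<card A} ((!) ?l)"
    have b: "b (?l ! i) = a i" if "i < card A" for i
      using that the_inv_into_f_f[OF bij_betw_imp_inj_on[OF bij]] by (simp add: b_def)
    have "(\<Sum>i<card A. \<bar>a i\<bar>) = (\<Sum>k\<in>A. \<bar>b k\<bar>)"
      unfolding sum.reindex_bij_betw[OF bij, symmetric] using b by (intro sum.cong) auto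
    moreover have "(\<Sum>i<card A. a i * x (?l ! i) j) = (\<Sum>k\<in>A. b k * x k j)" for j
      unfolding sum.reindex_bij_betw[OF bij, symmetric] using b by (intro sum.cong) auto
    ultimately show ?thesis using low[of b] by simp
  qed
  then show ?thesis using A unfolding l1_tree_def by auto
qed

text \<open>Coefficients are kept as a list parallel to the vectors, so that concatenating branches
  adds the masses t.\<close>

definition comb :: "real \<Rightarrow> (nat \<Rightarrow> real) list \<Rightarrow> (nat \<Rightarrow> real) \<Rightarrow> bool" where
  "comb t xs y \<longleftrightarrow> (\<exists>bs. length bs = length xs \<and>
     y = (\<lambda>k. \<Sum>(b, x)\<leftarrow>zip bs xs. b * x k) \<and> (\<Sum>b\<leftarrow>bs. \<bar>b\<bar>) = t)"

lemma comb_Nil: "comb 0 [] (\<lambda>k. 0)"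
  by (simp add: comb_def)

lemma comb_append:
  assumes "comb t xs y" "comb u zs w"
  shows "comb (t + u) (xs @ zs) (\<lambda>k. y k + w k)"
proof -
  obtain bs cs where "length bs = length xs" "y = (\<lambda>k. \<Sum>(b, x)\<leftarrow>zip bs xs. b * x k)" "(\<Sum>b\<leftarrow>bs. \<bar>b\<bar>) = t"
    "length cs = length zs" "w = (\<lambda>k. \<Sum>(b, x)\<leftarrow>zip cs zs. b * x k)" "(\<Sum>b\<leftarrow>cs. \<bar>b\<bar>) = u"
    using assms unfolding comb_def by blast
  then show ?thesis unfolding comb_def by (intro exI[of _ "bs @ cs"]) simp
qed

lemma comb_scale:
  assumes "comb t xs y" shows "comb (\<bar>u\<bar> * t) xs (\<lambda>k. u * y k)"
proof -
  obtain bs where bs: "length bs = length xs" "y = (\<lambda>k. \<Sum>(b, x)\<leftarrow>zip bs xs. b * x k)" "(\<Sum>b\<leftarrow>bs. \<bar>b\<bar>) = t"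
    using assms unfolding comb_def by blast
  have "(\<Sum>(b, x)\<leftarrow>zip (map ((*) u) bs) xs. b * x k) = u * (\<Sum>(b, x)\<leftarrow>zip bs xs. b * x k)" for k
    using bs(1) by (induction bs xs rule: list_induct2) (auto simp: algebra_simps)
  moreover have "(\<Sum>b\<leftarrow>map ((*) u) bs. \<bar>b\<bar>) = \<bar>u\<bar> * (\<Sum>b\<leftarrow>bs. \<bar>b\<bar>)"
    by (induction bs) (auto simp: abs_mult algebra_simps)
  ultimately show ?thesis unfolding comb_def using bs by (intro exI[of _ "map ((*) u) bs"]) simp
qed

lemma comb_zero: "comb 0 s (\<lambda>k. 0)"
proof -
  have "(\<Sum>(b, x)\<leftarrow>zip (replicate (length s) 0) s. b * x k) = 0" for k :: nat
    by (induction s) auto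
  then show ?thesis
    unfolding comb_def by (intro exI[of _ "replicate (length s) 0"]) (simp add: sum_list_replicate)
qed

lemma comb_sum:
  assumes "comb t xs y"
  obtains b where "\<forall>k. y k = (\<Sum>i<length xs. b i * (xs ! i) k)" "(\<Sum>i<length xs. \<bar>b i\<bar>) = t"
proof -
  obtain bs where bs: "length bs = length xs" "y = (\<lambda>k. \<Sum>(b, x)\<leftarrow>zip bs xs. b * x k)" "(\<Sum>b\<leftarrow>bs. \<bar>b\<bar>) = t"
    using assms unfolding comb_def by blast
  then show ?thesis
    by (intro that[of "(!) bs"]) (auto simp: sum_list_sum_nth atLeast0LessThan)
qed

lemma comb_of_sum: "comb (\<Sum>i<length xs. \<bar>b i\<bar>) xs (\<lambda>k. \<Sum>i<length xs. b i * (xs ! i) k)"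
  unfolding comb_def
  by (intro exI[of _ "map b [0..<length xs]"]) (auto simp: sum_list_sum_nth atLeast0LessThan)

text \<open>Gaussian elimination, one coordinate at a time: a vector not vanishing at p clears this
  coordinate from all the others.\<close>

lemma linear_dependence:
  fixes f :: "'a \<Rightarrow> nat \<Rightarrow> real"
  assumes "finite I" "p < card I"
  shows "\<exists>b. (\<exists>i\<in>I. b i \<noteq> 0) \<and> (\<forall>k<p. (\<Sum>i\<in>I. b i * f i k) = 0)"
  using assms
proof (induction p arbitrary: I f)
  case 0
  then have "I \<noteq> {}" by auto
  then show ?case by (intro exI[of _ "\<lambda>_. 1"]) auto
next
  case (Suc p)
  show ?case
  proof (cases "\<forall>i\<in>I. f i p = 0")
    case True
    obtain b where "\<exists>i\<in>I. b i \<noteq> 0" "\<forall>k<p. (\<Sum>i\<in>I. b i * f i k) = 0"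
      using Suc.IH[of I f] Suc.prems by auto
    moreover have "(\<Sum>i\<in>I. b i * f i p) = 0" using True by simp
    ultimately show ?thesis by (intro exI[of _ b]) (auto simp: less_Suc_eq)
  next
    case False
    then obtain i0 where i0: "i0 \<in> I" "f i0 p \<noteq> 0" by blast
    let ?I = "I - {i0}"
    let ?t = "\<lambda>i. f i p / f i0 p"
    have "p < card ?I" using Suc.prems i0(1) by simp
    then obtain b where b: "\<exists>i\<in>?I. b i \<noteq> 0" "\<forall>k<p. (\<Sum>i\<in>?I. b i * (f i k - ?t i * f i0 k)) = 0"
      using Suc.IH[of ?I "\<lambda>i k. f i k - ?t i * f i0 k"] Suc.prems(1) by auto
    define c where "c i = (if i = i0 then - (\<Sum>i\<in>?I. b i * ?t i) else b i)" for i
    have "(\<Sum>i\<in>I. c i * f i k) = (\<Sum>i\<in>?I. b i * (f i k - ?t i * f i0 k))" for k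
    proof -
      have "(\<Sum>i\<in>I. c i * f i k) = c i0 * f i0 k + (\<Sum>i\<in>?I. c i * f i k)"
        using Suc.prems(1) i0(1) by (simp add: sum.remove)
      also have "(\<Sum>i\<in>?I. c i * f i k) = (\<Sum>i\<in>?I. b i * f i k)"
        by (intro sum.cong) (auto simp: c_def)
      also have "c i0 * f i0 k = - (\<Sum>i\<in>?I. b i * (?t i * f i0 k))"
        by (simp add: c_def sum_distrib_right mult.assoc)
      finally show ?thesis by (simp add: right_diff_distrib sum_subtractf)
    qed
    moreover have "(\<Sum>i\<in>?I. b i * (f i p - ?t i * f i0 p)) = 0" using i0(2) by simp
    moreover have "\<exists>i\<in>I. c i \<noteq> 0" using b(1) by (auto simp: c_def)
    ultimately show ?thesis using b(2) by (intro exI[of _ c]) (auto simp: less_Suc_eq)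
  qed
qed

text \<open>A rank in the family of continuations of B beyond p is a rank for B itself. Read
  backwards, failure of B to survive shows that its continuations form a family of small
  rank.\<close>

lemma fderiv_shift:
  assumes "B \<subseteq> {..<p}" "C \<in> fderiv {C. C \<subseteq> {p..} \<and> B \<union> C \<in> X} b"
  shows "B \<union> C \<in> fderiv X b"
  using assms(2)
proof (induction b arbitrary: C)
  case (BS b)
  let ?H = "{C. C \<subseteq> {p..} \<and> B \<union> C \<in> X}"
  obtain k where k: "\<forall>a\<in>C. a < k" "insert k C \<in> fderiv ?H b" using BS.prems by auto
  then have "insert k C \<in> ?H" using fderiv_subset by blast
  then have "p \<le> k" by simp
  then have "\<forall>a\<in>B \<union> C. a < k" using k(1) assms(1) by fastforce
  moreover have "insert k (B \<union> C) \<in> fderiv X b" using BS.IH[OF k(2)] by simp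
  ultimately show ?case using BS by auto
qed auto

lemma fderiv_card_le1: "{} \<notin> fderiv {A. finite A \<and> card A \<le> 1} (natord 2)"
proof
  assume "{} \<in> fderiv {A. finite A \<and> card A \<le> 1} (natord 2)"
  then obtain k l :: nat where "k < l" "card {l, k} \<le> 1"
    by (auto simp: numeral_2_eq_2)
  moreover have "l \<noteq> k" using \<open>k < l\<close> by simp
  then have "card {l, k} = 2" by simp
  ultimately show False by simp
qed

section \<open>Combinations found along branches\<close>

context mixed_tsirelson
begin

text \<open>Closeness is tested on initial truncations, uniformly, so that the norm of finitely
  supported vectors suffices to express it.\<close>

definition near :: "real \<Rightarrow> (nat \<Rightarrow> real) \<Rightarrow> (nat \<Rightarrow> real) \<Rightarrow> bool" where
  "near \<eta> y v \<longleftrightarrow> (\<forall>n. T (restr {..<n} (\<lambda>k. y k - v k)) \<le> \<eta>)"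

lemma near_add:
  assumes "near \<eta> y v" "near \<eta>' y' v'"
  shows "near (\<eta> + \<eta>') (\<lambda>k. y k + y' k) (\<lambda>k. v k + v' k)"
  unfolding near_def
proof
  fix n
  have "restr {..<n} (\<lambda>k. (y k + y' k) - (v k + v' k)) =
    (\<lambda>k. restr {..<n} (\<lambda>k. y k - v k) k + restr {..<n} (\<lambda>k. y' k - v' k) k)"
    by (auto simp: restr_def)
  then show "T (restr {..<n} (\<lambda>k. (y k + y' k) - (v k + v' k))) \<le> \<eta> + \<eta>'"
    using T_add_le[of "restr {..<n} (\<lambda>k. y k - v k)" "restr {..<n} (\<lambda>k. y' k - v' k)"]
      spec[OF assms(1)[unfolded near_def], of n] spec[OF assms(2)[unfolded near_def], of n] by simp
qed

lemma near_scale: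
  assumes "near \<eta> y v"
  shows "near (\<bar>u\<bar> * \<eta>) (\<lambda>k. u * y k) (\<lambda>k. u * v k)"
  unfolding near_def
proof
  fix n
  have "restr {..<n} (\<lambda>k. u * y k - u * v k) = (\<lambda>k. u * restr {..<n} (\<lambda>k. y k - v k) k)"
    by (auto simp: restr_def algebra_simps)
  then have "T (restr {..<n} (\<lambda>k. u * y k - u * v k)) \<le> \<bar>u\<bar> * T (restr {..<n} (\<lambda>k. y k - v k))"
    using T_scale_le[of "restr {..<n} (\<lambda>k. y k - v k)" u] by simp
  also have "\<dots> \<le> \<bar>u\<bar> * \<eta>" using assms unfolding near_def by (simp add: mult_left_mono)
  finally show "T (restr {..<n} (\<lambda>k. u * y k - u * v k)) \<le> \<bar>u\<bar> * \<eta>" .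
qed

definition unit_lists :: "nat set \<Rightarrow> (nat \<Rightarrow> real) list set" where
  "unit_lists N = {xs. \<forall>x\<in>set xs. x \<in> Xspace \<theta> F \<and> {k. x k \<noteq> 0} \<subseteq> N \<and> Xnorm \<theta> F x \<le> 1}"

text \<open>Quantifying over D and s is what permits repetition: an average of many blocks arises by
  applying the property to derived trees of D at nodes already extended. The iteration lowers c at
  the price of a larger \<tau>.\<close>

definition reaches :: "nat set \<Rightarrow> bord \<Rightarrow> real \<Rightarrow> bool" where
  "reaches N \<tau> c \<longleftrightarrow> (\<forall>D s p \<eta>. D \<subseteq> unit_lists N \<longrightarrow> s \<in> tree_deriv D \<tau> \<longrightarrow> 0 < \<eta> \<longrightarrow>
     (\<exists>r y v. s @ r \<in> D \<and> comb 1 r y \<and> fsupp v \<and> {k. v k \<noteq> 0} \<subseteq> N \<inter> {p..} \<and> T v \<le> c \<and> near \<eta> y v))"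

text \<open>Among p + 1 vectors there is a nontrivial combination vanishing on the first p
  coordinates, which replaces the passage to block sequences. Normalised coefficients keep its norm
  at most 1, and a long truncation makes it finitely supported.\<close>

lemma reaches_omega: "reaches N omega 1"
  unfolding reaches_def
proof (intro allI impI)
  fix D s p and \<eta> :: real
  assume D: "D \<subseteq> unit_lists N" and s: "s \<in> tree_deriv D omega" and \<eta>: "0 < \<eta>"
  have "s \<in> tree_deriv D (natord (Suc p))" using s unfolding omega_def tree_deriv.simps by blast
  then obtain r where r: "length r = Suc p" "s @ r \<in> D" using tree_deriv_natord by blast
  let ?I = "{..<length r}"
  have rX: "r ! i \<in> Xspace \<theta> F" "{k. (r ! i) k \<noteq> 0} \<subseteq> N" "Xnorm \<theta> F (r ! i) \<le> 1" if "i \<in> ?I" for i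
  proof -
    have "r ! i \<in> set (s @ r)" using that by simp
    then show "r ! i \<in> Xspace \<theta> F" "{k. (r ! i) k \<noteq> 0} \<subseteq> N" "Xnorm \<theta> F (r ! i) \<le> 1"
      using r(2) D unfolding unit_lists_def by blast+
  qed
  obtain b where b: "\<exists>i\<in>?I. b i \<noteq> 0" "\<forall>k<p. (\<Sum>i\<in>?I. b i * (r ! i) k) = 0"
    using linear_dependence[of ?I p "\<lambda>i. r ! i"] r(1) by auto
  define S where "S = (\<Sum>i\<in>?I. \<bar>b i\<bar>)"
  have S: "0 < S"
  proof -
    obtain i where "i \<in> ?I" "b i \<noteq> 0" using b(1) by blast
    then show ?thesis unfolding S_def by (intro sum_pos2[of _ i]) auto
  qed
  define c where "c i = b i / S" for i
  define y where "y = (\<lambda>k. \<Sum>i\<in>?I. c i * (r ! i) k)"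
  have c1: "(\<Sum>i\<in>?I. \<bar>c i\<bar>) = 1"
    unfolding c_def using S by (simp add: sum_divide_distrib[symmetric]) (simp add: S_def)
  have y: "comb 1 r y" using comb_of_sum[of c r] c1 unfolding y_def by simp
  have y0: "y k = 0" if "k < p" for k
  proof -
    have "y k = (\<Sum>i\<in>?I. b i * (r ! i) k) / S" unfolding y_def c_def by (simp add: sum_divide_distrib)
    then show ?thesis using b(2) that by simp
  qed
  have yN: "k \<in> N" if "y k \<noteq> 0" for k
  proof -
    have "\<not> (\<forall>i\<in>?I. c i * (r ! i) k = 0)"
    proof
      assume "\<forall>i\<in>?I. c i * (r ! i) k = 0"
      from sum.neutral[OF this] show False using that unfolding y_def by contradiction
    qed
    then obtain i where "i \<in> ?I" "(r ! i) k \<noteq> 0" by auto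
    then show ?thesis using rX(2)[OF \<open>i \<in> ?I\<close>] by blast
  qed
  have yX: "y \<in> Xspace \<theta> F" unfolding y_def using rX(1) by (intro Xspace_sum) auto
  obtain q where q: "\<forall>n. T (restr {..<n} (\<lambda>k. y k - restr {..<q} y k)) \<le> \<eta>"
    using Xspace_tail[OF yX \<eta>] by blast
  have "T (restr {..<q} y) \<le> (\<Sum>i\<in>?I. \<bar>c i\<bar> * T (restr {..<q} (r ! i)))"
    unfolding y_def restr_sum by (rule T_sum_le) simp
  also have "\<dots> \<le> (\<Sum>i\<in>?I. \<bar>c i\<bar> * 1)"
    using Xnorm_LIMSEQ(2)[OF rX(1)] rX(3) by (intro sum_mono mult_left_mono) (auto intro: order_trans)
  finally have "T (restr {..<q} y) \<le> 1" using c1 by simp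
  moreover have "{k. restr {..<q} y k \<noteq> 0} \<subseteq> N \<inter> {p..}"
    using y0 yN by (auto simp: restr_def not_less[symmetric])
  ultimately show "\<exists>r y v. s @ r \<in> D \<and> comb 1 r y \<and> fsupp v \<and> {k. v k \<noteq> 0} \<subseteq> N \<inter> {p..} \<and> T v \<le> 1 \<and> near \<eta> y v"
    using r(2) y q unfolding near_def
    by (intro exI[of _ r] exI[of _ y] exI[of _ "restr {..<q} y"]) simp
qed

text \<open>The value of g at a block tells how far out its successors must start. As g depends on
  the block, the required speed can be read off from vectors already constructed.\<close>

definition blocks :: "nat set \<Rightarrow> ((nat \<Rightarrow> real) \<Rightarrow> nat) \<Rightarrow> real \<Rightarrow> nat \<Rightarrow> nat set \<Rightarrow> (nat \<Rightarrow> nat \<Rightarrow> real) \<Rightarrow> bool" where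
  "blocks N g c p V v \<longleftrightarrow> finite V \<and> V \<subseteq> {p..} \<and>
     (\<forall>k\<in>V. {j. v k j \<noteq> 0} \<subseteq> N \<inter> {p..k} \<and> T (v k) \<le> c) \<and>
     (\<forall>k\<in>V. \<forall>k'\<in>V. k < k' \<longrightarrow> {j. v k' j \<noteq> 0} \<subseteq> {Suc k..} \<inter> {g (v k)..})"

text \<open>Blocks are indexed by labels bounding their supports from above; \<open>a\<close> is the vector of weights,
of total mass \<open>t\<close>.\<close>
definition averages ::
  "nat set \<Rightarrow> ((nat \<Rightarrow> real) \<Rightarrow> nat) \<Rightarrow> real \<Rightarrow> real \<Rightarrow> (nat \<Rightarrow> real) list set \<Rightarrow> (nat \<Rightarrow> real) list \<Rightarrow> nat \<Rightarrow> real \<Rightarrow>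
   (nat set \<Rightarrow> (nat \<Rightarrow> real) \<Rightarrow> bool) \<Rightarrow> bool" where
  "averages N g c t D s p \<eta> P \<longleftrightarrow> (\<exists>r y V v a. s @ r \<in> D \<and> comb t r y \<and> blocks N g c p V v \<and>
     (\<forall>k\<in>V. 0 \<le> a k) \<and> sum a V = t \<and> near \<eta> y (\<lambda>j. \<Sum>k\<in>V. a k * v k j) \<and> P V a)"

text \<open>The second average starts beyond q, which bounds all labels of the first one and all
  growth requirements it imposes. Its postcondition quantifies over weights agreeing with both
  parts, so that the glued weights can be supplied afterwards.\<close>

lemma averages_extend:
  assumes fst: "averages N g c t D1 s p \<eta> P"
    and snd: "\<And>V a s' q. P V a \<Longrightarrow> finite V \<Longrightarrow> V \<subseteq> {..<q} \<Longrightarrow> (\<forall>k\<in>V. 0 \<le> a k) \<Longrightarrow> s' \<in> D1 \<Longrightarrow>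
      averages N g c u D2 s' q \<eta>' (\<lambda>V' a'. \<forall>a''. (\<forall>k\<in>V. a'' k = a k) \<longrightarrow> (\<forall>k\<in>V'. a'' k = a' k) \<longrightarrow> Q (V \<union> V') a'')"
  shows "averages N g c (t + u) D2 s p (\<eta> + \<eta>') Q"
proof -
  obtain r y V v a where 1: "s @ r \<in> D1" "comb t r y" "blocks N g c p V v" "\<forall>k\<in>V. 0 \<le> a k"
    "sum a V = t" "near \<eta> y (\<lambda>j. \<Sum>k\<in>V. a k * v k j)" "P V a"
    using fst unfolding averages_def by blast
  have finV: "finite V" using 1(3) unfolding blocks_def by blast
  define q where "q = p + (\<Sum>k\<in>V. Suc k + g (v k))"
  have q: "Suc k \<le> q" "g (v k) \<le> q" if "k \<in> V" for k
    using member_le_sum[of k V "\<lambda>k. Suc k + g (v k)"] that finV unfolding q_def by auto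
  have Vq: "V \<subseteq> {..<q}" using q(1) by (auto simp: Suc_le_eq)
  obtain r' y' V' v' a' where 2: "(s @ r) @ r' \<in> D2" "comb u r' y'" "blocks N g c q V' v'"
    "\<forall>k\<in>V'. 0 \<le> a' k" "sum a' V' = u" "near \<eta>' y' (\<lambda>j. \<Sum>k\<in>V'. a' k * v' k j)"
    "\<forall>a''. (\<forall>k\<in>V. a'' k = a k) \<longrightarrow> (\<forall>k\<in>V'. a'' k = a' k) \<longrightarrow> Q (V \<union> V') a''"
    using snd[OF 1(7) finV Vq 1(4,1)] unfolding averages_def by blast
  have finV': "finite V'" "V' \<subseteq> {q..}" using 2(3) unfolding blocks_def by blast+
  have disj: "V \<inter> V' = {}" using Vq finV'(2) by fastforce
  define w where "w k = (if k \<in> V then v k else v' k)" for k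
  define b where "b k = (if k \<in> V then a k else a' k)" for k
  have w: "w k = v k" "b k = a k" if "k \<in> V" for k using that by (simp_all add: w_def b_def)
  have w': "w k = v' k" "b k = a' k" if "k \<in> V'" for k using that disj by (auto simp: w_def b_def)
  have sumV: "sum f (V \<union> V') = sum f V + sum f V'" for f :: "nat \<Rightarrow> real"
    using finV finV' disj by (simp add: sum.union_disjoint)
  have bl: "blocks N g c p (V \<union> V') w"
    unfolding blocks_def
  proof (intro conjI ballI impI)
    show "finite (V \<union> V')" using finV finV' by simp
    show "V \<union> V' \<subseteq> {p..}" using 1(3) finV'(2) unfolding blocks_def q_def by auto
  next
    fix k assume "k \<in> V \<union> V'"
    then consider "k \<in> V" | "k \<in> V'" by blast
    then show "{j. w k j \<noteq> 0} \<subseteq> N \<inter> {p..k}"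
    proof cases
      case 1
      then show ?thesis using \<open>blocks N g c p V v\<close> w unfolding blocks_def by simp
    next
      case 2
      then have "{j. w k j \<noteq> 0} \<subseteq> N \<inter> {q..k}" using \<open>blocks N g c q V' v'\<close> w' unfolding blocks_def by simp
      then show ?thesis unfolding q_def by auto
    qed
    show "T (w k) \<le> c" using \<open>k \<in> V \<union> V'\<close> 1(3) 2(3) w w' unfolding blocks_def by auto
  next
    fix k k' assume k: "k \<in> V \<union> V'" "k' \<in> V \<union> V'" "k < k'"
    consider "k \<in> V" "k' \<in> V" | "k \<in> V" "k' \<in> V'" | "k \<in> V'" "k' \<in> V'"
      using k Vq finV'(2) by fastforce
    then show "{j. w k' j \<noteq> 0} \<subseteq> {Suc k..} \<inter> {g (w k)..}"
    proof cases
      case 1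
      then show ?thesis using \<open>blocks N g c p V v\<close> w k(3) unfolding blocks_def by simp
    next
      case 2
      have "{j. v' k' j \<noteq> 0} \<subseteq> N \<inter> {q..k'}" using \<open>blocks N g c q V' v'\<close> 2(2) unfolding blocks_def by blast
      then have "{j. w k' j \<noteq> 0} \<subseteq> {q..}" using w'(1)[OF 2(2)] by auto
      then show ?thesis using q[OF 2(1)] w[OF 2(1)] by auto
    next
      case 3
      then show ?thesis using \<open>blocks N g c q V' v'\<close> w' k(3) unfolding blocks_def by simp
    qed
  qed
  have sV: "sum b V = t" "sum b V' = u" using 1(5) 2(5) w w' by (auto cong: sum.cong)
  have yV: "(\<Sum>k\<in>V. b k * w k j) = (\<Sum>k\<in>V. a k * v k j)" "(\<Sum>k\<in>V'. b k * w k j) = (\<Sum>k\<in>V'. a' k * v' k j)" for j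
    using w w' by (auto intro: sum.cong)
  have "near (\<eta> + \<eta>') (\<lambda>k. y k + y' k) (\<lambda>j. \<Sum>k\<in>V \<union> V'. b k * w k j)"
    unfolding sumV yV by (rule near_add[OF 1(6) 2(6)])
  moreover have "Q (V \<union> V') b" using 2(7) w w' by blast
  moreover have "comb (t + u) (r @ r') (\<lambda>k. y k + y' k)" by (rule comb_append[OF 1(2) 2(2)])
  moreover have "\<forall>k\<in>V \<union> V'. 0 \<le> b k" using 1(4) 2(4) w w' by auto
  moreover have "s @ (r @ r') \<in> D2" using 2(1) by simp
  moreover have "sum b (V \<union> V') = t + u" using sumV sV by simp
  ultimately show ?thesis using bl unfolding averages_def by blast
qed

lemma averages_scale:
  assumes "averages N g c t D s p \<eta> P" "0 < u" "\<And>V a. P V a \<Longrightarrow> Q V (\<lambda>k. u * a k)"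
  shows "averages N g c (u * t) D s p (u * \<eta>) Q"
proof -
  obtain r y V v a where 1: "s @ r \<in> D" "comb t r y" "blocks N g c p V v" "\<forall>k\<in>V. 0 \<le> a k"
    "sum a V = t" "near \<eta> y (\<lambda>j. \<Sum>k\<in>V. a k * v k j)" "P V a"
    using assms(1) unfolding averages_def by blast
  have "near (u * \<eta>) (\<lambda>k. u * y k) (\<lambda>j. \<Sum>k\<in>V. u * a k * v k j)"
    using near_scale[OF 1(6), of u] assms(2) by (simp add: sum_distrib_left mult.assoc)
  moreover have "comb (u * t) r (\<lambda>k. u * y k)" using comb_scale[OF 1(2), of u] assms(2) by simp
  moreover have "\<forall>k\<in>V. 0 \<le> u * a k" using 1(4) assms(2) by simp
  moreover have "(\<Sum>k\<in>V. u * a k) = u * t" using 1(5) by (simp add: sum_distrib_left[symmetric])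
  ultimately show ?thesis
    using 1(1,3) assms(3)[OF 1(7)] unfolding averages_def
    by (intro exI[of _ r] exI[of _ "\<lambda>k. u * y k"] exI[of _ V] exI[of _ v] exI[of _ "\<lambda>k. u * a k"]) blast
qed

text \<open>Induction on \<rho>. For \<rho> = 0 the families have no nonempty members and one block
  of weight 1 works; at a successor, n averages of mass 1 are strung together and divided by n.
  Finitely many families are treated at once because a successor step creates a family of
  continuations for each H, each old set B and each level l.\<close>

lemma averages_small:
  assumes W: "reaches N \<tau> c"
    and "D \<subseteq> unit_lists N" "s \<in> tree_deriv D (omul \<tau> (oexp omega \<rho>))" "0 < \<eta>" "0 < e" "finite \<H>"
    and "\<And>H. H \<in> \<H> \<Longrightarrow> hereditary H \<and> {} \<notin> fderiv H (oexp omega \<rho>)"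
  shows "averages N g c 1 D s p \<eta> (\<lambda>V a. \<forall>H\<in>\<H>. \<forall>B\<in>H. B \<subseteq> V \<longrightarrow> sum a B \<le> e)"
  using assms(2-)
proof (induction \<rho> arbitrary: D s p e \<H> \<eta>)
  case BZ
  then obtain r y v where r: "s @ r \<in> D" "comb 1 r y" "fsupp v" "{k. v k \<noteq> 0} \<subseteq> N \<inter> {p..}" "T v \<le> c" "near \<eta> y v"
    using W unfolding reaches_def by (metis oadd_BZ_left oexp.simps(1) omul.simps(1,2))
  obtain k0 where "\<forall>j\<in>{k. v k \<noteq> 0}. j \<le> k0"
    using r(3) unfolding fsupp_def finite_nat_set_iff_bounded_le by blast
  then have k: "{j. v j \<noteq> 0} \<subseteq> {..max p k0}" by force
  let ?k = "max p k0"
  have "blocks N g c p {?k} (\<lambda>_. v)"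
    unfolding blocks_def using k r(4,5) by auto
  moreover have "\<forall>H\<in>\<H>. \<forall>B\<in>H. B \<subseteq> {?k} \<longrightarrow> sum (\<lambda>_. 1) B \<le> e"
  proof (intro ballI impI)
    fix H B assume H: "H \<in> \<H>" "B \<in> H" "B \<subseteq> {?k}"
    have h: "hereditary H" "{} \<notin> fderiv H (BS BZ)" using BZ.prems(6)[OF H(1)] by simp_all
    have "{?k} \<notin> H"
    proof
      assume k: "{?k} \<in> H"
      then have "{} \<in> H" using hereditaryD[OF h(1)] by blast
      then show False using h(2) k by auto
    qed
    then have "B = {}" using H(2,3) by (auto simp: subset_singleton_iff)
    then show "sum (\<lambda>_. 1) B \<le> e" using \<open>0 < e\<close> by simp
  qed
  ultimately show ?case
    unfolding averages_def using r
    by (intro exI[of _ r] exI[of _ y] exI[of _ "{?k}"] exI[of _ "\<lambda>_. v"] exI[of _ "\<lambda>_. 1"]) simp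
next
  case (BL h)
  have "\<exists>n. {} \<notin> fderiv H (oexp omega (h n))" if "H \<in> \<H>" for H
    using BL.prems(6)[OF that] by simp
  then obtain f where f: "\<And>H. H \<in> \<H> \<Longrightarrow> {} \<notin> fderiv H (oexp omega (h (f H)))" by metis
  \<comment> \<open>Finitely many families involve finitely many terms of the fundamental sequence,
    and the largest of these serves them all.\<close>
  obtain n where n: "\<And>H. H \<in> \<H> \<Longrightarrow> ord_le (h (f H)) (h n)"
  proof (cases "\<H> = {}")
    case False
    then have "\<exists>x\<in>(\<lambda>H. h (f H)) ` \<H>. \<forall>y\<in>(\<lambda>H. h (f H)) ` \<H>. ord_le y x"
      using BL.prems(5) by (intro finite_ord_max) auto
    then show ?thesis using that by blast
  qed (use that in blast)
  show ?case
  proof (rule BL.IH[OF rangeI, of D s n])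
    show "D \<subseteq> unit_lists N" "0 < \<eta>" "0 < e" "finite \<H>" using BL.prems by blast+
    show "s \<in> tree_deriv D (omul \<tau> (oexp omega (h n)))" using BL.prems(2) by simp
    fix H assume H: "H \<in> \<H>"
    then show "hereditary H \<and> {} \<notin> fderiv H (oexp omega (h n))"
      using BL.prems(6)[OF H] f[OF H] fderiv_anti[OF oexp_mono[OF n[OF H]]] by blast
  qed
next
  case (BS \<rho>)
  let ?w = "\<lambda>l. omul (oexp omega \<rho>) (natord l)"
  have "\<exists>n. {} \<notin> fderiv H (?w n)" if "H \<in> \<H>" for H
    using BS.prems(6)[OF that] by (simp add: omega_def)
  then obtain f where f: "\<And>H. H \<in> \<H> \<Longrightarrow> {} \<notin> fderiv H (?w (f H))" by metis
  \<comment> \<open>No set survives \<omega>^\<rho> n0 in any of the families, so n0 bounds the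
    number of levels that can be used up.\<close>
  define n0 where "n0 = Max (insert 0 (f ` \<H>))"
  have lev: "l < n0" if H: "H \<in> \<H>" and B: "B \<in> fderiv H (?w l)" for H B l
  proof (rule ccontr)
    assume "\<not> l < n0"
    moreover have "f H \<le> n0" unfolding n0_def using BS.prems(5) H by (intro Max_ge) auto
    ultimately have le: "ord_le (?w (f H)) (?w l)" by (intro omul_mono_right natord_mono) simp
    have "hereditary (fderiv H (?w l))" using BS.prems(6)[OF H] hereditary_fderiv by blast
    then have "{} \<in> fderiv H (?w l)" using hereditaryD[OF _ B] by blast
    then show False using fderiv_anti[OF le] f[OF H] by blast
  qed
  \<comment> \<open>With this many parts the loss n0 is at most half of the permitted n e; the other
    half is made of n losses of e / 2.\<close>
  obtain n :: nat where n: "2 * real n0 / e < real n" using reals_Archimedean2 by blast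
  have "0 \<le> 2 * real n0 / e" using \<open>0 < e\<close> by simp
  then have n_pos: "0 < real n" using n by linarith
  have n_e: "real n0 \<le> real n * (e / 2)" using n \<open>0 < e\<close> by (simp add: field_simps)
  \<comment> \<open>Invariant after i parts, with n0 as a budget: a set surviving \<omega>^\<rho> l
    still has l units to spend. A new part of mass 1 either adds at most e / 2 or is paid for by one
    unit.\<close>
  define P where "P i V a \<longleftrightarrow> (\<forall>H\<in>\<H>. \<forall>B l. B \<subseteq> V \<longrightarrow> B \<in> fderiv H (?w l) \<longrightarrow>
    sum a B + real l \<le> real i * (e / 2) + real n0)" for i :: nat and V :: "nat set" and a :: "nat \<Rightarrow> real"
  \<comment> \<open>Each part consumes one factor \<tau> \<omega>^\<rho> of the order of the tree,
    so after i parts n - i of them remain.\<close>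
  have *: "averages N g c (real i) (tree_deriv D (omul \<tau> (?w (n - i)))) s p (real i * \<eta>) (P i)" if "i \<le> n" for i
    using that
  proof (induction i)
    case 0
    have "oexp omega (BS \<rho>) = BL ?w" by (simp add: omega_def)
    then have s: "s \<in> tree_deriv D (omul \<tau> (?w n))" using BS.prems(2) by simp
    have "P 0 {} (\<lambda>_. 0)" unfolding P_def using lev by (auto intro: less_imp_le)
    then show ?case
      unfolding averages_def using s comb_Nil
      by (intro exI[of _ "[]"] exI[of _ "\<lambda>_. 0"] exI[of _ "{}"] exI[of _ "\<lambda>_ _. 0"] exI[of _ "\<lambda>_. 0"])
         (simp add: blocks_def near_def restr_def)
  next
    case (Suc i)
    have ni: "n - i = Suc (n - Suc i)" using Suc.prems by simp
    let ?D1 = "tree_deriv D (omul \<tau> (?w (n - i)))" and ?D2 = "tree_deriv D (omul \<tau> (?w (n - Suc i)))"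
    have D1: "?D1 = tree_deriv ?D2 (omul \<tau> (oexp omega \<rho>))"
      unfolding ni by (simp add: tree_deriv_oadd omul_oadd)
    have "averages N g c (real i + 1) ?D2 s p (real i * \<eta> + \<eta>) (P (Suc i))"
    proof (rule averages_extend)
      show "averages N g c (real i) ?D1 s p (real i * \<eta>) (P i)" using Suc by simp
    next
      fix V a s' q
      assume PV: "P i V a" and V: "finite V" "V \<subseteq> {..<q}" "\<forall>k\<in>V. 0 \<le> a k" and s': "s' \<in> ?D1"
      \<comment> \<open>The continuations beyond q of an old set B that stay at level l. If B does
        not survive level l + 1, they form a family of rank below \<omega>^\<rho>, to which the
        induction hypothesis applies.\<close>
      define K where "K = (\<lambda>(H, B, l). {C. C \<subseteq> {q..} \<and> B \<union> C \<in> fderiv H (?w l)})"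
      define \<K> where "\<K> = K ` {(H, B, l) \<in> \<H> \<times> Pow V \<times> {..n0}. B \<notin> fderiv H (?w (Suc l))}"
      have "averages N g c 1 ?D2 s' q \<eta> (\<lambda>V a. \<forall>H\<in>\<K>. \<forall>B\<in>H. B \<subseteq> V \<longrightarrow> sum a B \<le> e / 2)"
      proof (rule BS.IH)
        show "?D2 \<subseteq> unit_lists N" using tree_deriv_subset BS.prems(1) by blast
        show "s' \<in> tree_deriv ?D2 (omul \<tau> (oexp omega \<rho>))" using s' D1 by simp
        show "0 < \<eta>" "0 < e / 2" using BS.prems by simp_all
        have "finite {(H, B, l) \<in> \<H> \<times> Pow V \<times> {..n0}. B \<notin> fderiv H (?w (Suc l))}"
          using V(1) BS.prems(5) by (intro finite_subset[OF _ finite_cartesian_product[OF BS.prems(5)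
            finite_cartesian_product[OF finite_Pow_iff[THEN iffD2, OF V(1)] finite_atMost[of n0]]]]) blast
        then show "finite \<K>" unfolding \<K>_def by simp
        fix X assume "X \<in> \<K>"
        then obtain H B l where 2: "H \<in> \<H>" "B \<subseteq> V" "B \<notin> fderiv H (?w (Suc l))"
          "X = {C. C \<subseteq> {q..} \<and> B \<union> C \<in> fderiv H (?w l)}"
          unfolding \<K>_def K_def by auto
        show "hereditary X \<and> {} \<notin> fderiv X (oexp omega \<rho>)"
        proof -
          have h: "hereditary (fderiv H (?w l))" using BS.prems(6)[OF 2(1)] hereditary_fderiv by blast
          have "hereditary X"
            unfolding hereditary_def 2(4)
          proof (intro ballI allI impI)
            fix C C' assume C: "C \<in> {C. C \<subseteq> {q..} \<and> B \<union> C \<in> fderiv H (?w l)}" "C' \<subseteq> C"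
            then have "B \<union> C \<in> fderiv H (?w l)" by simp
            then have "B \<union> C' \<in> fderiv H (?w l)" by (rule hereditaryD[OF h]) (use C(2) in blast)
            then show "C' \<in> {C. C \<subseteq> {q..} \<and> B \<union> C \<in> fderiv H (?w l)}" using C by auto
          qed
          moreover have "{} \<notin> fderiv X (oexp omega \<rho>)"
          proof
            assume "{} \<in> fderiv X (oexp omega \<rho>)"
            then have "B \<union> {} \<in> fderiv (fderiv H (?w l)) (oexp omega \<rho>)"
              unfolding 2(4) using 2(2) V(2) by (intro fderiv_shift[of B q]) auto
            then show False using 2(3) by (simp add: fderiv_oadd)
          qed
          ultimately show ?thesis by blast
        qed
      qed
      then obtain r y V' v a' where 2: "s' @ r \<in> ?D2" "comb 1 r y" "blocks N g c q V' v" "\<forall>k\<in>V'. 0 \<le> a' k"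
        "sum a' V' = 1" "near \<eta> y (\<lambda>j. \<Sum>k\<in>V'. a' k * v k j)"
        "\<forall>X\<in>\<K>. \<forall>C\<in>X. C \<subseteq> V' \<longrightarrow> sum a' C \<le> e / 2"
        unfolding averages_def by (elim exE conjE) (rule that; assumption)
      have V': "finite V'" "V' \<subseteq> {q..}" using 2(3) unfolding blocks_def by blast+
      have Q: "P (Suc i) (V \<union> V') b" if b: "\<forall>k\<in>V. b k = a k" "\<forall>k\<in>V'. b k = a' k" for b
        unfolding P_def
      proof (intro ballI allI impI)
        fix H B l assume H: "H \<in> \<H>" and B: "B \<subseteq> V \<union> V'" "B \<in> fderiv H (?w l)"
        let ?B = "B \<inter> V" and ?C = "B \<inter> V'"
        have BC: "B = ?B \<union> ?C" using B(1) by blast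
        have "?B \<inter> ?C = {}" using V(2) V'(2) by fastforce
        then have sum: "sum b B = sum b ?B + sum b ?C"
          using BC V(1) V'(1) by (metis finite_Int sum.union_disjoint)
        have sB: "sum b ?B = sum a ?B" "sum b ?C = sum a' ?C" using b by (auto intro: sum.cong)
        have h: "hereditary (fderiv H (?w l))" using BS.prems(6)[OF H] hereditary_fderiv by blast
        have Bl: "?B \<in> fderiv H (?w l)" by (rule hereditaryD[OF h B(2)]) simp
        have PB: "sum a ?B + real l \<le> real i * (e / 2) + real n0"
          using PV H Bl unfolding P_def by blast
        show "sum b B + real l \<le> real (Suc i) * (e / 2) + real n0"
        \<comment> \<open>If the old part survives one more level, the invariant for it leaves a
          spare unit, which covers the whole mass of the new part.\<close>
        proof (cases "?B \<in> fderiv H (?w (Suc l))")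
          case True
          then have "sum a ?B + real (Suc l) \<le> real i * (e / 2) + real n0"
            using PV H unfolding P_def by blast
          moreover have "sum a' ?C \<le> sum a' V'" using V'(1) 2(4) by (intro sum_mono2) auto
          ultimately show ?thesis using sum sB 2(5) \<open>0 < e\<close> by (simp add: algebra_simps add_divide_distrib)
        next
          case False
          have "K (H, ?B, l) \<in> \<K>" unfolding \<K>_def using False H lev[OF H Bl] by auto
          moreover have "?C \<in> K (H, ?B, l)" unfolding K_def using V'(2) B(2) BC[symmetric] by auto
          ultimately have "sum a' ?C \<le> e / 2" using bspec[OF bspec[OF 2(7)]] by blast
          then show ?thesis using PB sum sB by (simp add: algebra_simps add_divide_distrib)
        qed
      qed
      show "averages N g c 1 ?D2 s' q \<eta>
        (\<lambda>V' a'. \<forall>a''. (\<forall>k\<in>V. a'' k = a k) \<longrightarrow> (\<forall>k\<in>V'. a'' k = a' k) \<longrightarrow> P (Suc i) (V \<union> V') a'')"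
        unfolding averages_def
        by (rule exI[of _ r], rule exI[of _ y], rule exI[of _ V'], rule exI[of _ v], rule exI[of _ a'])
           (intro conjI allI impI 2(1-6) Q)
    qed
    then show ?case by (simp add: algebra_simps)
  qed
  have "averages N g c (real n) D s p (real n * \<eta>) (P n)" using *[of n] by simp
  then have "averages N g c (1 / real n * real n) D s p (1 / real n * (real n * \<eta>))
      (\<lambda>V a. \<forall>H\<in>\<H>. \<forall>B\<in>H. B \<subseteq> V \<longrightarrow> sum a B \<le> e)"
  proof (rule averages_scale)
    show "0 < 1 / real n" using n_pos by simp
    fix V a assume PV: "P n V a"
    show "\<forall>H\<in>\<H>. \<forall>B\<in>H. B \<subseteq> V \<longrightarrow> (\<Sum>k\<in>B. 1 / real n * a k) \<le> e"
    proof (intro ballI impI)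
      fix H B assume H: "H \<in> \<H>" "B \<in> H" "B \<subseteq> V"
      have "B \<in> fderiv H (?w 0)" using H(2) by simp
      then have "sum a B + real 0 \<le> real n * (e / 2) + real n0" using PV H unfolding P_def by blast
      then have "sum a B \<le> real n * e" using n_e by simp
      then have "1 / real n * sum a B \<le> e" using n_pos by (simp add: field_simps)
      then show "(\<Sum>k\<in>B. 1 / real n * a k) \<le> e" by (simp add: sum_distrib_left)
    qed
  qed
  then show ?case using n_pos by simp
qed

end

lemma ordmax_in: "finite S \<Longrightarrow> S \<noteq> {} \<Longrightarrow> ordmax S \<in> S"
  unfolding ordmax_def using someI_ex[of "\<lambda>g. g \<in> S \<and> (\<forall>h\<in>S. ord_le h g)"] finite_ord_max[of S]
  by auto

text \<open>One derivative is spent on passing from the empty set to a singleton, since the tree may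
  lack the empty list.\<close>

lemma tree_deriv_nonempty:
  assumes "\<And>A. A \<in> H \<Longrightarrow> A \<noteq> {} \<Longrightarrow> finite A \<and> map x (sorted_list_of_set A) \<in> D"
    and "{} \<in> fderiv H (BS b)"
  shows "tree_deriv D b \<noteq> {}"
proof -
  obtain k where "{k} \<in> fderiv H b" using assms(2) by auto
  then have "map x (sorted_list_of_set {k}) \<in> tree_deriv D b"
    using assms(1) by (intro tree_deriv_of_fderiv[of H]) auto
  then show ?thesis by blast
qed

lemma least_empty_deriv:
  assumes "tree_deriv D c = {}"
  obtains b where "tree_deriv D b = {}" "\<And>g. ord_lt g b \<Longrightarrow> tree_deriv D g \<noteq> {}" "ord_le b c"
proof -
  have "\<exists>b. tree_deriv D b = {} \<and> (\<forall>g. ord_lt g b \<longrightarrow> tree_deriv D g \<noteq> {})"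
    using assms by (induction c rule: ord_less_induct) blast
  then obtain b where b: "tree_deriv D b = {}" "\<And>g. ord_lt g b \<Longrightarrow> tree_deriv D g \<noteq> {}" by blast
  moreover have "ord_le b c" using b(2) assms not_ord_lt_iff by blast
  ultimately show ?thesis using that by blast
qed

section \<open>Iterated contraction of the norm\<close>

context mixed_tsirelson
begin

lemma reaches_step:
  assumes W: "reaches N \<tau> c" and c: "0 \<le> c" "c \<le> 1" and e: "0 < e" and null: "\<theta> \<longlonglongrightarrow> 0"
    and J: "spreading J" "hereditary J" "{} \<notin> fderiv J (oexp omega \<rho>)" and \<rho>: "ord_lt BZ \<rho>"
    and dom: "\<And>m A. A \<in> F m \<Longrightarrow> A \<subseteq> N \<inter> {q m..} \<Longrightarrow> A \<in> family_comp J (fam F (ns m))"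
    and ns: "\<And>m. \<theta> m \<le> \<theta> 0 * prod_list (map \<theta> (ns m))"
  shows "reaches N (omul \<tau> (oexp omega \<rho>)) (\<theta> 0 * c + 3 * e)"
  unfolding reaches_def
proof (intro allI impI)
  fix D s p and \<eta> :: real
  assume D: "D \<subseteq> unit_lists N" "s \<in> tree_deriv D (omul \<tau> (oexp omega \<rho>))" and \<eta>: "0 < \<eta>"
  \<comment> \<open>Beyond \<open>g x\<close> all conditions for indices m at which x is not
    negligible are in force; there are finitely many such m because \<theta> tends to zero.\<close>
  define g where "g x = Max (insert 0 (q ` {m. e < \<theta> m * l1n x}))" for x
  have g: "q m \<le> g x" if "e < \<theta> m * l1n x" for m x
  proof -
    have "(\<lambda>m. \<theta> m * l1n x) \<longlonglongrightarrow> 0" using tendsto_mult_left_zero[OF null] .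
    then have "eventually (\<lambda>m. \<theta> m * l1n x < e) sequentially" using e by (rule order_tendstoD)
    then obtain m0 where "\<And>m. m0 \<le> m \<Longrightarrow> \<theta> m * l1n x < e" unfolding eventually_sequentially by blast
    then have "{m. e < \<theta> m * l1n x} \<subseteq> {..<m0}" by (force simp: not_le[symmetric])
    then have "finite {m. e < \<theta> m * l1n x}" using finite_subset by blast
    then show ?thesis unfolding g_def using that by (intro Max_ge) auto
  qed
  \<comment> \<open>Next to J, the sets with at most one point are included to bound the individual
    weights by e. The empty set does not survive two derivatives there, and 2 < \<omega>^\<rho>
    since \<rho> > 0.\<close>
  let ?S = "{A :: nat set. finite A \<and> card A \<le> 1}"
  have "hereditary ?S" unfolding hereditary_def by (auto intro: finite_subset order_trans[OF card_mono])
  moreover have "{} \<notin> fderiv ?S (oexp omega \<rho>)"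
    using fderiv_card_le1 fderiv_anti[OF ord_lt_imp_le[OF natord_lt_oexp[OF \<rho>]]] by blast
  ultimately have "averages N g c 1 D s p \<eta> (\<lambda>V a. \<forall>H\<in>{J, ?S}. \<forall>B\<in>H. B \<subseteq> V \<longrightarrow> sum a B \<le> e)"
    using J(2,3) by (intro averages_small[OF W D \<eta> e]) auto
  then obtain r y V v a where 1: "s @ r \<in> D" "comb 1 r y" "blocks N g c p V v" "\<forall>k\<in>V. 0 \<le> a k"
    "sum a V = 1" "near \<eta> y (\<lambda>j. \<Sum>k\<in>V. a k * v k j)"
    "\<forall>H\<in>{J, ?S}. \<forall>B\<in>H. B \<subseteq> V \<longrightarrow> sum a B \<le> e"
    unfolding averages_def by (elim exE conjE) (rule that; assumption)
  let ?v = "\<lambda>j. \<Sum>k\<in>V. a k * v k j"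
  have V: "finite V" "\<And>k. k \<in> V \<Longrightarrow> {j. v k j \<noteq> 0} \<subseteq> N \<inter> {p..k}" "\<And>k. k \<in> V \<Longrightarrow> T (v k) \<le> c"
    "\<And>k k'. k \<in> V \<Longrightarrow> k' \<in> V \<Longrightarrow> k < k' \<Longrightarrow> {j. v k' j \<noteq> 0} \<subseteq> {Suc k..} \<inter> {g (v k)..}"
    using 1(3) unfolding blocks_def by blast+
  have fs: "fsupp (v k)" if "k \<in> V" for k
    unfolding fsupp_def by (rule finite_subset[OF V(2)[OF that]]) simp
  have "T ?v \<le> \<theta> 0 * c + 3 * e"
  proof (rule average_bound[where J = J and N = N and q = q and ns = ns])
    show "A \<in> family_comp J (fam F (ns m))" if "A \<in> F m" "A \<subseteq> N \<inter> {q m..}" for A m by (rule dom[OF that])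
    show "\<theta> m \<le> \<theta> 0 * prod_list (map \<theta> (ns m))" for m by (rule ns)
    show "T (v k) \<le> c" if "k \<in> V" for k by (rule V(3)[OF that])
    show "0 \<le> e" using e by simp
    show "0 \<le> a k" if "k \<in> V" for k using 1(4) that by blast
    show "{j. v k j \<noteq> 0} \<subseteq> N \<inter> {..k}" if "k \<in> V" for k using V(2)[OF that] by auto
    show "{j. v k' j \<noteq> 0} \<subseteq> {Suc k..}" if "k \<in> V" "k' \<in> V" "k < k'" for k k'
      using V(4)[OF that] by blast
    show "{j. v k' j \<noteq> 0} \<subseteq> {q m..}" if "k \<in> V" "k' \<in> V" "k < k'" "e < \<theta> m * l1n (v k)" for k k' m
      using V(4)[OF that(1-3)] g[OF that(4)] by auto
    show "sum a B \<le> e" if "B \<in> J" "B \<subseteq> V" for B using 1(7) that by blast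
    show "a k \<le> e" if "k \<in> V" for k
    proof -
      have S: "\<forall>B\<in>?S. B \<subseteq> V \<longrightarrow> sum a B \<le> e" by (rule bspec[OF 1(7)]) simp
      have "{k} \<subseteq> V \<longrightarrow> sum a {k} \<le> e" by (rule bspec[OF S]) simp
      then have "sum a {k} \<le> e" using that by blast
      then show ?thesis by simp
    qed
  qed (fact J V(1) 1(5) c)+
  moreover have "{j. ?v j \<noteq> 0} \<subseteq> N \<inter> {p..}"
  proof
    fix j assume "j \<in> {j. ?v j \<noteq> 0}"
    then have "\<not> (\<forall>k\<in>V. a k * v k j = 0)" using sum.neutral[of V "\<lambda>k. a k * v k j"] by blast
    then obtain k where "k \<in> V" "v k j \<noteq> 0" by auto
    then show "j \<in> N \<inter> {p..}" using V(2)[of k] by auto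
  qed
  moreover have "fsupp ?v" using fs by simp
  ultimately show "\<exists>r y v. s @ r \<in> D \<and> comb 1 r y \<and> fsupp v \<and> {k. v k \<noteq> 0} \<subseteq> N \<inter> {p..} \<and>
      T v \<le> \<theta> 0 * c + 3 * e \<and> near \<eta> y v"
    using 1(1,2,6) by (intro exI[of _ r] exI[of _ y] exI[of _ ?v]) simp
qed

text \<open>The map sending c to \<open>\<theta> 0 * c + 3 * e\<close> has the fixed point 3 e / (1
  - \<theta> 0). Starting from 1, the excess over it after d applications is at most the d-th power
  of \<open>\<theta> 0\<close>. The initial \<open>one\<close> in the exponent is the cost of a
  first block.\<close>

lemma reaches_iterate:
  assumes e: "0 < e" "3 * e \<le> 1 - \<theta> 0" and null: "\<theta> \<longlonglongrightarrow> 0"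
    and J: "spreading J" "hereditary J" "{} \<notin> fderiv J (oexp omega \<rho>)" and \<rho>: "ord_lt BZ \<rho>"
    and dom: "\<And>m A. A \<in> F m \<Longrightarrow> A \<subseteq> N \<inter> {q m..} \<Longrightarrow> A \<in> family_comp J (fam F (ns m))"
    and ns: "\<And>m. \<theta> m \<le> \<theta> 0 * prod_list (map \<theta> (ns m))"
  shows "reaches N (oexp omega (oadd one (omul \<rho> (natord d)))) (\<theta> 0 ^ d + 3 * e / (1 - \<theta> 0))"
proof -
  let ?X = "3 * e / (1 - \<theta> 0)"
  have X: "0 \<le> ?X" "?X \<le> 1" "\<theta> 0 * ?X + 3 * e = ?X"
    using e theta_lt1[of 0] theta_pos[of 0] by (auto simp: field_simps)
  define c where "c d = \<theta> 0 ^ d * (1 - ?X) + ?X" for d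
  have pw: "0 \<le> \<theta> 0 ^ d" "\<theta> 0 ^ d \<le> 1" for d
    using theta_lt1[of 0] theta_pos[of 0] by (simp_all add: power_le_one)
  have c_le: "c d \<le> \<theta> 0 ^ d + ?X" for d
    unfolding c_def using mult_left_mono[of "1 - ?X" 1 "\<theta> 0 ^ d"] pw[of d] X(1) by simp
  have c01: "0 \<le> c d" "c d \<le> 1" for d
  proof -
    show "0 \<le> c d" unfolding c_def using pw X(1,2) by simp
    have "\<theta> 0 ^ d * (1 - ?X) \<le> 1 * (1 - ?X)" using pw X(2) by (intro mult_right_mono) auto
    then show "c d \<le> 1" unfolding c_def by simp
  qed
  have "reaches N (oexp omega (oadd one (omul \<rho> (natord d)))) (c d)"
  proof (induction d)
    case 0
    have "oexp omega one = omega" by (simp add: one_def)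
    then show ?case using reaches_omega[of N] by (simp add: c_def)
  next
    case (Suc d)
    have "reaches N (omul (oexp omega (oadd one (omul \<rho> (natord d)))) (oexp omega \<rho>)) (\<theta> 0 * c d + 3 * e)"
      by (rule reaches_step[OF Suc c01 e(1) null J \<rho> dom ns])
    moreover have "\<theta> 0 * c d + 3 * e = c (Suc d)"
      using X(3) unfolding c_def by (simp add: distrib_left mult.assoc)
    ultimately show ?case by (simp add: oexp_oadd[symmetric] oadd_assoc)
  qed
  then show ?thesis unfolding reaches_def using c_le[of d] by (meson order_trans)
qed

lemma l1_tree_unit_lists: "l1_tree (espan \<theta> F N) (Xnorm \<theta> F) K \<subseteq> unit_lists N"
  unfolding l1_tree_def unit_lists_def using espan_Xspace espan_support by fastforce

text \<open>A surviving node would extend to a member of the tree carrying a combination of mass 1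
  and norm below 1 / K, in which the vectors of the node itself get coefficient 0.\<close>

lemma l1_tree_deriv_empty:
  assumes K: "0 < K" and W: "reaches N \<tau> c" "c < 1 / K"
  shows "tree_deriv (l1_tree (espan \<theta> F N) (Xnorm \<theta> F) K) \<tau> = {}"
proof (rule ccontr)
  let ?D = "l1_tree (espan \<theta> F N) (Xnorm \<theta> F) K"
  assume "tree_deriv ?D \<tau> \<noteq> {}"
  then obtain s where s: "s \<in> tree_deriv ?D \<tau>" by blast
  define \<eta> where "\<eta> = (1 / K - c) / 2"
  have \<eta>: "0 < \<eta>" "c + \<eta> < 1 / K" unfolding \<eta>_def using W(2) by (auto simp: field_simps)
  obtain r y v where 1: "s @ r \<in> ?D" "comb 1 r y" "fsupp v" "T v \<le> c" "near \<eta> y v"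
    using W(1) l1_tree_unit_lists[of N K] s \<eta>(1) unfolding reaches_def by metis
  let ?l = "s @ r"
  have "comb 1 ?l y" using comb_append[OF comb_zero 1(2), of s] by simp
  then obtain b where b: "\<forall>k. y k = (\<Sum>i<length ?l. b i * (?l ! i) k)" "(\<Sum>i<length ?l. \<bar>b i\<bar>) = 1"
    by (rule comb_sum)
  have y: "y = (\<lambda>k. \<Sum>i<length ?l. b i * (?l ! i) k)" using b(1) by blast
  have mem: "?l ! i \<in> Xspace \<theta> F" if "i < length ?l" for i
    using 1(1) nth_mem[OF that] espan_Xspace unfolding l1_tree_def by blast
  have "1 / K \<le> Xnorm \<theta> F y"
  proof -
    have "(\<Sum>i<length ?l. \<bar>b i\<bar>) / K \<le> Xnorm \<theta> F (\<lambda>k. \<Sum>i<length ?l. b i * (?l ! i) k)"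
      using 1(1) unfolding l1_tree_def by blast
    then show ?thesis unfolding y[symmetric] b(2) .
  qed
  also have "Xnorm \<theta> F y \<le> c + \<eta>"
  proof (rule Xnorm_leI)
    show "y \<in> Xspace \<theta> F" unfolding y using mem by (intro Xspace_sum) auto
    fix n
    have "restr {..<n} y = (\<lambda>k. restr {..<n} v k + restr {..<n} (\<lambda>k. y k - v k) k)"
      by (auto simp: restr_def)
    then have "T (restr {..<n} y) \<le> T (restr {..<n} v) + T (restr {..<n} (\<lambda>k. y k - v k))"
      using T_add_le[of "restr {..<n} v" "restr {..<n} (\<lambda>k. y k - v k)"] by simp
    then show "T (restr {..<n} y) \<le> c + \<eta>"
      using T_restr_le[OF 1(3), of "{..<n}"] 1(4) spec[OF 1(5)[unfolded near_def], of n] by linarith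
  qed
  finally show False using \<eta>(2) by simp
qed

section \<open>The maximum defining \<gamma>\<close>

lemma prod_theta_bounds:
  "0 < prod_list (map \<theta> ns)" "prod_list (map \<theta> ns) \<le> \<theta> 0 ^ length ns"
  "n \<in> set ns \<Longrightarrow> prod_list (map \<theta> ns) \<le> \<theta> n"
proof -
  have th0: "\<theta> n \<le> \<theta> 0" for n using theta_decseq unfolding decseq_def by simp
  show pos: "0 < prod_list (map \<theta> ns)" for ns using theta_pos by (induction ns) auto
  have le1: "prod_list (map \<theta> ns) \<le> 1" for ns
  proof (induction ns)
    case (Cons n ns)
    then show ?case
      using mult_le_one[of "\<theta> n" "prod_list (map \<theta> ns)"] pos[of ns] theta_lt1[of n] by simp
  qed simp
  show "prod_list (map \<theta> ns) \<le> \<theta> 0 ^ length ns"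
  proof (induction ns)
    case (Cons n ns)
    then show ?case
      using mult_mono[OF th0[of n] Cons.IH] theta_pos[of 0] pos[of ns] by simp
  qed simp
  show "n \<in> set ns \<Longrightarrow> prod_list (map \<theta> ns) \<le> \<theta> n"
  proof (induction ns)
    case (Cons m ns)
    show ?case
    proof (cases "n = m")
      case True
      then show ?thesis using mult_left_le[OF le1[of ns], of "\<theta> n"] theta_pos[of n] by simp
    next
      case False
      then have "prod_list (map \<theta> ns) \<le> \<theta> n" using Cons by simp
      moreover have "\<theta> m * prod_list (map \<theta> ns) \<le> prod_list (map \<theta> ns)"
        using mult_left_le_one_le[of "prod_list (map \<theta> ns)" "\<theta> m"] pos[of ns] theta_pos[of m] theta_lt1[of m] by simp
      ultimately show ?thesis by simp
    qed
  qed simp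
qed

text \<open>Every factor of a product exceeding \<theta> m exceeds \<theta> m itself, so its index
  is below m; the length is bounded since \<theta> 0 < 1. Hence the maximum in \<open>gam\<close> is
  attained.\<close>

lemma finite_large_products: "finite {ns. ns \<noteq> [] \<and> \<theta> m < \<theta> 0 * prod_list (map \<theta> ns)}"
proof -
  obtain L where L: "\<theta> 0 ^ L < \<theta> m"
    using real_arch_pow_inv[OF theta_pos[of m] theta_lt1[of 0]] by blast
  have "{ns. ns \<noteq> [] \<and> \<theta> m < \<theta> 0 * prod_list (map \<theta> ns)} \<subseteq> {ns. set ns \<subseteq> {..<m} \<and> length ns \<le> L}"
  proof (clarify, intro conjI subsetI)
    fix ns assume "\<theta> m < \<theta> 0 * prod_list (map \<theta> ns)"
    moreover have "\<theta> 0 * prod_list (map \<theta> ns) < prod_list (map \<theta> ns)"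
      using theta_lt1[of 0] prod_theta_bounds(1)[of ns] by simp
    ultimately have lt: "\<theta> m < prod_list (map \<theta> ns)" by linarith
    show "n \<in> {..<m}" if "n \<in> set ns" for n
    proof (rule ccontr)
      assume "n \<notin> {..<m}"
      then have "\<theta> n \<le> \<theta> m" using theta_decseq unfolding decseq_def by simp
      then show False using lt prod_theta_bounds(3)[OF that] by linarith
    qed
    show "length ns \<le> L"
    proof (rule ccontr)
      assume "\<not> length ns \<le> L"
      then have "\<theta> 0 ^ length ns \<le> \<theta> 0 ^ L"
        using theta_pos[of 0] theta_lt1[of 0] by (intro power_decreasing) auto
      then show False using L lt prod_theta_bounds(2)[of ns] by linarith
    qed
  qed
  then show ?thesis using finite_lists_length_le[of "{..<m}" L] finite_subset by blast
qed

text \<open>If no product qualifies, \<open>ordmax\<close> returns zero and the empty list serves: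
  its product is 1 and \<theta> m \<le> \<theta> 0. Otherwise a maximising list does.\<close>

lemma gam_witness:
  assumes \<alpha>: "\<And>n. ord_lt BZ (\<alpha> n)"
  obtains ns where "\<theta> m \<le> \<theta> 0 * prod_list (map \<theta> ns)"
    "ord_le (gam \<theta> \<alpha> (\<theta> 0) m) (osum (\<lambda>n. lead (\<alpha> n)) ns)"
proof -
  let ?S = "{lead (prod_ord \<alpha> ns) | ns. ns \<noteq> [] \<and> \<theta> m < \<theta> 0 * prod_list (map \<theta> ns)}"
  have gam: "gam \<theta> \<alpha> (\<theta> 0) m = ordmax ?S" unfolding gam_def ..
  show ?thesis
  proof (cases "?S = {}")
    case True
    then have "gam \<theta> \<alpha> (\<theta> 0) m = BZ" unfolding gam ordmax_def by simp
    moreover have "\<theta> m \<le> \<theta> 0" using theta_decseq unfolding decseq_def by simp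
    ultimately show ?thesis by (intro that[of "[]"]) auto
  next
    case False
    have "?S = (\<lambda>ns. lead (prod_ord \<alpha> ns)) ` {ns. ns \<noteq> [] \<and> \<theta> m < \<theta> 0 * prod_list (map \<theta> ns)}"
      by blast
    then have "finite ?S" using finite_large_products[of m] by simp
    then have "ordmax ?S \<in> ?S" using False by (rule ordmax_in)
    then obtain ns where "\<theta> m < \<theta> 0 * prod_list (map \<theta> ns)" "ordmax ?S = lead (prod_ord \<alpha> ns)" by blast
    then show ?thesis using lead_prod_ord_le[of \<alpha>, OF \<alpha>] gam by (intro that[of ns]) auto
  qed
qed

end

theorem theorem12:
  fixes \<theta> :: "nat \<Rightarrow> real" and F :: "nat \<Rightarrow> nat set set"
    and \<alpha> :: "nat \<Rightarrow> bord" and \<xi> :: bord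
  assumes theta_range: "\<forall>n. 0 < \<theta> n \<and> \<theta> n < 1"
    and theta_noninc: "decseq \<theta>"
    and theta_null: "\<theta> \<longlonglongrightarrow> 0"
    and regular: "\<forall>n. regular_family (F n)"
    and cb: "\<forall>n. cb_index (F n) (\<alpha> n)"
    and alpha_gt1: "\<forall>n. ord_lt one (\<alpha> n)"
    and xi_pos: "ord_lt BZ \<xi>"
    and alpha_sup: "is_ord_sup \<alpha> (oexp omega (oexp omega \<xi>))"
    and alpha_ne: "\<forall>n. \<not> ord_eq (\<alpha> n) (oexp omega (oexp omega \<xi>))"
    and not_dagger: "\<not> dagger \<theta> \<alpha> \<xi>"
  shows "\<forall>M :: nat set. infinite M \<longrightarrow>
           (\<exists>N \<subseteq> M. infinite N \<and>
              l1_index_is (espan \<theta> F N) (Xnorm \<theta> F) (oexp omega (oexp omega \<xi>)) \<and>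
              (\<forall>S. schreier_system S \<longrightarrow>
                 \<not> (\<exists>x. (\<forall>n. x n \<in> espan \<theta> F N) \<and>
                        l1_spreading_model (S (oexp omega \<xi>)) (Xnorm \<theta> F) x)))"
proof (intro allI impI)
  fix M :: "nat set" assume M: "infinite M"
  let ?\<kappa> = "oexp omega \<xi>"
  let ?\<Omega> = "oexp omega ?\<kappa>"
  have spr: "spreading (F n)" for n using regular regular_spreading by blast
  have her: "hereditary (F n)" for n using regular regular_hereditary by blast
  have pos: "ord_lt BZ (\<alpha> n)" for n
    using alpha_gt1 unfolding one_def by (blast intro: ord_lt_trans[of BZ "BS BZ"] lt_S le_Z)
  have below: "{} \<in> fderiv (F n) b" if "ord_lt b (\<alpha> n)" for n b
    using cb_index_fderiv(2)[of "F n" "\<alpha> n" b] regular cb that by blast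
  have top: "{} \<notin> fderiv (F n) (\<alpha> n)" for n
    using cb_index_fderiv(1)[of "F n" "\<alpha> n"] regular cb by blast
  interpret mixed_tsirelson \<theta> F
    using theta_range theta_noninc spr her below[OF pos] by unfold_locales auto
  have lt\<kappa>: "ord_lt (natord n) ?\<kappa>" for n using natord_lt_oexp[OF xi_pos] .
  have add\<kappa>: "ord_lt (oadd x y) ?\<kappa>" if "ord_lt x ?\<kappa>" "ord_lt y ?\<kappa>" for x y
    using oadd_lt_oexp that by blast
  have suc\<kappa>: "ord_lt (BS x) ?\<kappa>" if "ord_lt x ?\<kappa>" for x
    using add\<kappa>[OF that lt\<kappa>[of 1]] by simp
  have lead_index: "{} \<in> fderiv (F n) (oexp omega (lead (\<alpha> n)))" for n
    by (rule fderiv_oexp_le_index[OF below]) (use alpha_gt1 lead_spec(1)[OF pos] in auto)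

  obtain b where b: "ord_lt b ?\<kappa>"
    and gam: "\<And>m. ord_le (lead (\<alpha> m)) (oadd (oadd (gam \<theta> \<alpha> (\<theta> 0) m) two) b)"
    using not_dagger theta_pos[of 0] unfolding dagger_def by (metis not_ord_lt_iff)
  \<comment> \<open>The exponent that J has to absorb: 2 and b come from the negated condition, and
    one more is added because \<alpha> m is bounded only by \<omega> to the successor of its leading
    exponent.\<close>
  define \<delta> where "\<delta> = BS (oadd two b)"
  have "two = natord 2" by (simp add: two_def numeral_2_eq_2)
  then have \<delta>: "ord_lt \<delta> ?\<kappa>" unfolding \<delta>_def using suc\<kappa>[OF add\<kappa>[OF lt\<kappa>[of 2] b]] by simp
  obtain m0 where m0: "ord_lt (oexp omega \<delta>) (\<alpha> m0)"
    using alpha_sup oexp_strict_mono[OF \<delta>] unfolding is_ord_sup_def by blast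
  let ?J = "F m0"
  have "\<exists>ns. \<theta> m \<le> \<theta> 0 * prod_list (map \<theta> ns) \<and>
      ord_le (gam \<theta> \<alpha> (\<theta> 0) m) (osum (\<lambda>n. lead (\<alpha> n)) ns)" for m
    using gam_witness[of \<alpha> m, OF pos] by blast
  then obtain ns where ns: "\<And>m. \<theta> m \<le> \<theta> 0 * prod_list (map \<theta> (ns m))"
    "\<And>m. ord_le (gam \<theta> \<alpha> (\<theta> 0) m) (osum (\<lambda>n. lead (\<alpha> n)) (ns m))"
    by metis
  let ?Q = "\<lambda>m. family_comp ?J (fam F (ns m))"
  \<comment> \<open>The start of the diagonal argument: the empty set survives \<alpha> m in the
    composition but not in \<open>F m\<close>.\<close>
  have "dominated (F m) (?Q m) {}" for m
  proof -
    let ?s = "osum (\<lambda>n. lead (\<alpha> n)) (ns m)"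
    have "\<forall>B\<in>fam F (ns m). finite B" using spreading_fam[of F, OF spr] unfolding spreading_def by blast
    then have "{} \<in> fderiv (tail 0 (?Q m)) (omul (oexp omega ?s) (oexp omega \<delta>))"
      using below[OF m0] by (intro fderiv_comp spr fderiv_fam[of F, OF spr lead_index]) auto
    moreover have "tail 0 (?Q m) = ?Q m" by (simp add: tail_def)
    ultimately have Q: "{} \<in> fderiv (?Q m) (oexp omega (oadd ?s \<delta>))" by (simp add: oexp_oadd)
    have "ord_le (lead (\<alpha> m)) (oadd ?s (oadd two b))"
      using gam[of m] oadd_mono_left[OF ns(2)[of m], of "oadd two b"] ord_le_trans
      unfolding oadd_assoc by blast
    then have "ord_le (BS (lead (\<alpha> m))) (oadd ?s \<delta>)" unfolding \<delta>_def by simp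
    then have "ord_le (\<alpha> m) (oexp omega (oadd ?s \<delta>))"
      using lead_spec(2)[OF pos[of m]] oexp_mono ord_lt_le_trans ord_lt_imp_le by blast
    then have "{} \<in> fderiv (?Q m) (\<alpha> m)" using fderiv_anti Q by blast
    then show ?thesis using top unfolding dominated_def by blast
  qed
  then have "\<exists>N\<subseteq>M. infinite N \<and>
      (\<forall>m. \<exists>q. \<forall>A. finite A \<longrightarrow> A \<subseteq> N \<inter> {q..} \<longrightarrow> dominated (F m) (?Q m) A)"
    by (intro diagonal_subset dominated_step her spreading_comp spr spreading_fam M)
  then obtain N q where N: "N \<subseteq> M" "infinite N"
    and dominated: "\<And>m A. finite A \<Longrightarrow> A \<subseteq> N \<inter> {q m..} \<Longrightarrow> dominated (F m) (?Q m) A"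
    by metis
  have dom: "A \<in> ?Q m" if "A \<in> F m" "A \<subseteq> N \<inter> {q m..}" for m A
    by (rule dominated_imp[OF dominated[OF finite_F[OF that(1)] that(2)] that(1)])

  have "ord_lt (\<alpha> m0) ?\<Omega>"
  proof (rule ccontr)
    assume "\<not> ord_lt (\<alpha> m0) ?\<Omega>"
    then have "ord_eq (\<alpha> m0) ?\<Omega>" using alpha_sup unfolding is_ord_sup_def ord_eq_def by simp
    then show False using alpha_ne by blast
  qed
  then have "ord_lt (lead (\<alpha> m0)) ?\<kappa>"
    using lead_spec(1)[OF pos] ord_le_lt_trans oexp_lt_cancel by blast
  \<comment> \<open>One above the leading exponent, so that \<omega>^\<rho> exceeds the index of J;
    it stays below \<omega>^\<xi> because no \<alpha> n equals the supremum.\<close>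
  define \<rho> where "\<rho> = BS (lead (\<alpha> m0))"
  have \<rho>: "ord_lt BZ \<rho>" "ord_lt \<rho> ?\<kappa>" unfolding \<rho>_def using suc\<kappa> \<open>ord_lt (lead (\<alpha> m0)) ?\<kappa>\<close> by auto
  have J\<rho>: "{} \<notin> fderiv ?J (oexp omega \<rho>)"
    using top fderiv_anti ord_lt_imp_le lead_spec(2)[OF pos] unfolding \<rho>_def by blast

  \<comment> \<open>Upper bound for the index\<close>
  let ?D = "l1_tree (espan \<theta> F N) (Xnorm \<theta> F)"
  have upper: "\<exists>\<sigma>. ord_lt \<sigma> ?\<Omega> \<and> tree_deriv (?D K) \<sigma> = {}" if K: "1 \<le> K" for K
  proof -
    have th: "0 < 1 - \<theta> 0" using theta_lt1[of 0] by simp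
    \<comment> \<open>The factor 12 K makes the limiting error 3 e / (1 - \<theta> 0) equal to 1 /
      (4 K); with the power of \<theta> 0 below the same number, the norm drops below 1 / K.\<close>
    define e where "e = (1 - \<theta> 0) / (12 * K)"
    have eq: "3 * e = (1 - \<theta> 0) * (1 / (4 * K))" unfolding e_def using K by (simp add: field_simps)
    have e: "0 < e" "3 * e / (1 - \<theta> 0) = 1 / (4 * K)"
      unfolding eq using K th by (simp_all add: e_def)
    have "3 * e = (1 - \<theta> 0) * (1 / (4 * K))" by (rule eq)
    also have "\<dots> \<le> (1 - \<theta> 0) * 1" using K th by (intro mult_left_mono) (simp_all add: divide_le_eq)
    finally have e3: "3 * e \<le> 1 - \<theta> 0" by simp
    obtain d where d: "\<theta> 0 ^ d < 1 / (4 * K)"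
      using real_arch_pow_inv[of "1 / (4 * K)" "\<theta> 0"] K theta_lt1[of 0] by auto
    let ?\<sigma> = "oadd one (omul \<rho> (natord d))"
    have "ord_lt (omul \<rho> (natord d)) ?\<kappa>"
      using oexp_omega_pos add\<kappa> \<rho>(2) by (induction d) auto
    then have \<sigma>: "ord_lt (oexp omega ?\<sigma>) ?\<Omega>"
      using add\<kappa> lt\<kappa>[of 1] by (intro oexp_strict_mono) (simp add: one_def)
    have "reaches N (oexp omega ?\<sigma>) (\<theta> 0 ^ d + 3 * e / (1 - \<theta> 0))"
      by (rule reaches_iterate[OF e(1) e3 theta_null spr her J\<rho> \<rho>(1) dom ns(1)])
    moreover have "1 / (4 * K) + 1 / (4 * K) \<le> 1 / K" using K by (simp add: field_simps)
    then have "\<theta> 0 ^ d + 3 * e / (1 - \<theta> 0) < 1 / K" unfolding e(2) using d by linarith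
    ultimately have "tree_deriv (?D K) (oexp omega ?\<sigma>) = {}"
      using K by (intro l1_tree_deriv_empty) auto
    then show ?thesis using \<sigma> by blast
  qed
  have index: "\<exists>b. l1_index_K (espan \<theta> F N) (Xnorm \<theta> F) K b \<and> ord_le b ?\<Omega>" if K: "1 \<le> K" for K
  proof -
    obtain \<sigma> where \<sigma>: "ord_lt \<sigma> ?\<Omega>" "tree_deriv (?D K) \<sigma> = {}" using upper[OF K] by blast
    obtain b where "tree_deriv (?D K) b = {}" "\<And>g. ord_lt g b \<Longrightarrow> tree_deriv (?D K) g \<noteq> {}" "ord_le b \<sigma>"
      using least_empty_deriv[OF \<sigma>(2)] by metis
    then show ?thesis
      unfolding l1_index_K_def using \<sigma>(1) ord_le_lt_trans ord_lt_imp_le by blast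
  qed

  \<comment> \<open>Lower bound from the unit vectors\<close>
  have suc\<Omega>: "ord_lt (BS x) ?\<Omega>" if "ord_lt x ?\<Omega>" for x
    using oadd_lt_oexp[OF that natord_lt_oexp[OF oexp_omega_pos], of 1] by simp
  have lower: "\<exists>K\<ge>1. \<exists>b. l1_index_K (espan \<theta> F N) (Xnorm \<theta> F) K b \<and> ord_lt g b" if g: "ord_lt g ?\<Omega>" for g
  proof -
    \<comment> \<open>The successor of g is placed below \<alpha> n because one derivative is lost
      to the missing empty list.\<close>
    obtain n where n: "ord_lt (BS g) (\<alpha> n)"
      using alpha_sup suc\<Omega>[OF g] unfolding is_ord_sup_def by blast
    let ?K = "1 / \<theta> n"
    have K: "1 \<le> ?K" using theta_pos[of n] theta_lt1[of n] by (simp add: le_divide_eq)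
    have "{} \<in> fderiv {A \<in> F n. A \<subseteq> N} (BS g)"
      by (rule fderiv_restrict[OF spr N(2) below[OF n]]) simp
    then have "tree_deriv (?D ?K) g \<noteq> {}"
    proof (rule tree_deriv_nonempty[rotated])
      fix A assume A: "A \<in> {A \<in> F n. A \<subseteq> N}" "A \<noteq> {}"
      then have "finite A" using finite_F by blast
      moreover have "map unit (sorted_list_of_set A) \<in> ?D ?K"
        by (rule l1_treeI) (use A \<open>finite A\<close> unit_espan Xnorm_unit unit_lower[of A n] in \<open>auto simp: mult.commute\<close>)
      ultimately show "finite A \<and> map unit (sorted_list_of_set A) \<in> ?D ?K" by blast
    qed
    moreover obtain b where b: "l1_index_K (espan \<theta> F N) (Xnorm \<theta> F) ?K b" using index[OF K] by blast
    ultimately have "\<not> ord_le b g"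
      using tree_deriv_anti unfolding l1_index_K_def by blast
    then show ?thesis using K b by auto
  qed

  \<comment> \<open>Exclusion of spreading models\<close>
  have "\<not> (\<exists>x. (\<forall>n. x n \<in> espan \<theta> F N) \<and> l1_spreading_model (S ?\<kappa>) (Xnorm \<theta> F) x)"
    if S: "schreier_system S" for S
  proof
    assume "\<exists>x. (\<forall>n. x n \<in> espan \<theta> F N) \<and> l1_spreading_model (S ?\<kappa>) (Xnorm \<theta> F) x"
    then obtain x where xs: "\<forall>n. x n \<in> espan \<theta> F N" "l1_spreading_model (S ?\<kappa>) (Xnorm \<theta> F) x"
      by blast
    then have x: "x n \<in> espan \<theta> F N" "Xnorm \<theta> F (x n) = 1" for n
      unfolding l1_spreading_model_def by simp_all
    obtain K where K: "0 < K" and low: "\<forall>A\<in>S ?\<kappa>. \<forall>a :: nat \<Rightarrow> real.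
        (\<Sum>n\<in>A. \<bar>a n\<bar>) / K \<le> Xnorm \<theta> F (\<lambda>k. \<Sum>n\<in>A. a n * x n k)"
      using xs(2) unfolding l1_spreading_model_def by (elim conjE exE) (rule that; assumption)
    \<comment> \<open>The upper bound concerns constants at least 1, and enlarging the constant only
      weakens the lower estimate.\<close>
    let ?K = "max K 1"
    obtain \<sigma> where \<sigma>: "ord_lt \<sigma> ?\<Omega>" "tree_deriv (?D ?K) \<sigma> = {}" using upper[of ?K] by auto
    have rank: "\<forall>A\<in>S ?\<kappa>. finite A" "{} \<in> fderiv (tail 0 (S ?\<kappa>)) ?\<Omega>"
      using schreier_rank[OF S] by blast+
    \<comment> \<open>The Schreier family has rank beyond \<sigma>, which would make the tree
      survive \<sigma>.\<close>
    have "{} \<in> fderiv (tail 0 (S ?\<kappa>)) (BS \<sigma>)"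
      using fderiv_anti[OF ord_lt_imp_le[OF suc\<Omega>[OF \<sigma>(1)]] rank(2)] .
    then have "tree_deriv (?D ?K) \<sigma> \<noteq> {}"
    proof (rule tree_deriv_nonempty[rotated])
      fix A assume "A \<in> tail 0 (S ?\<kappa>)" "A \<noteq> {}"
      then have A: "A \<in> S ?\<kappa>" "finite A" using rank(1) by (auto simp: tail_def)
      have "(\<Sum>n\<in>A. \<bar>a n\<bar>) / ?K \<le> Xnorm \<theta> F (\<lambda>k. \<Sum>n\<in>A. a n * x n k)" for a
      proof -
        have "(\<Sum>n\<in>A. \<bar>a n\<bar>) / ?K \<le> (\<Sum>n\<in>A. \<bar>a n\<bar>) / K"
          using K by (intro divide_left_mono) (auto intro: sum_nonneg)
        then show ?thesis using spec[OF bspec[OF low A(1)], of a] by linarith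
      qed
      then have "map x (sorted_list_of_set A) \<in> ?D ?K"
        using A(2) \<open>A \<noteq> {}\<close> x by (intro l1_treeI) auto
      then show "finite A \<and> map x (sorted_list_of_set A) \<in> ?D ?K" using A(2) by blast
    qed
    then show False using \<sigma>(2) by blast
  qed
  moreover have "l1_index_is (espan \<theta> F N) (Xnorm \<theta> F) ?\<Omega>"
    unfolding l1_index_is_def using index lower by blast
  ultimately show "\<exists>N \<subseteq> M. infinite N \<and>
      l1_index_is (espan \<theta> F N) (Xnorm \<theta> F) ?\<Omega> \<and>
      (\<forall>S. schreier_system S \<longrightarrow>
         \<not> (\<exists>x. (\<forall>n. x n \<in> espan \<theta> F N) \<and> l1_spreading_model (S ?\<kappa>) (Xnorm \<theta> F) x))"
    using N by blast
qed

end
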